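(* Let $\xi_0,\xi_1,\ldots$ be non-degenerate i.i.d. complex-valued random variables. Let $\alpha>0$, $\beta\in\mathbb{R}$, and let $w_0,w_1,\ldots$ be a complex sequence satisfying $$\log|w_k|=-\alpha(k\log k-k)-\beta k+o(k),\qquad k\to\infty,$$ and such that for some $C>0$, $$|w_{n-k}/w_n|<C\,e^{\beta k}n^{\alpha k}\quad\text{for all } n\in\mathbb{N} \text{ and all integers } 0\le k\leq n .$$ Let $W_n(z)=\sum_{k=0}^n\xi_kw_kz^k$. Then the following are equivalent: (1) With probability $1$, as $n\to\infty$ the sequence of random measures $\frac1n\mu_{W_n}(e^\beta n^\alpha\,\cdot)$ converges to the probability measure with density $z\mapsto\frac1{2\pi\alpha}|z|^{\frac1\alpha-2}\,\mathbb{1}_{\{|z|<1\}}$ with respect to the Lebesgue measure on $\mathbb{C}$. (2) $\mathbb{E}\log(1+|\xi_0|)<\infty$.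
   Context: A random variable is non-degenerate if it is not almost surely equal to a constant. For a polynomial $G\not\equiv0$, $\mu_G=\sum_{z:G(z)=0}n_G(z)\,\delta_z$ is the measure on $\mathbb{C}$ counting zeros with multiplicity $n_G(z)$. For a measure $\mu$ on $\mathbb{C}$ and $c>0$, $\mu(c\,\cdot)$ is the measure $B\mapsto\mu(cB)$; thus $\mu_{W_n}(e^\beta n^\alpha\,\cdot)$ counts the points $z/(e^\beta n^\alpha)$, where $z$ runs over the zeros of $W_n$. Almost surely $W_n\not\equiv0$ for all large $n$; when $W_n\equiv0$ the measure may be given any value, e.g. $0$. The displayed bound on ratios includes the requirement $w_n\ne0$ for $n\in\mathbb{N}=\{1,2,\ldots\}$. Random measures $\mu_n$ converge to $\mu$ with probability $1$ (a.s.) if, for every continuous compactly supported $\varphi:\mathbb{C}\to\mathbb{R}$, $\int\varphi\,d\mu_n\to\int\varphi\,d\mu$ a.s. *)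

theory Defs
  imports "HOL-Probability.Probability" "HOL-Library.Landau_Symbols"
    "HOL-Computational_Algebra.Polynomial"
begin

text \<open>The zero counting measure on the Borel sets of the complex plane. The zero polynomial
  is assigned the null measure by convention.\<close>

definition zero_measure :: "complex poly \<Rightarrow> complex measure" where
  "zero_measure G =
     (if G = 0 then null_measure borel
      else distr (point_measure {z. poly G z = 0} (\<lambda>z. of_nat (order z G))) borel (\<lambda>z. z))"

lemma space_zero_measure [simp]: "space (zero_measure G) = UNIV"
  by (simp add: zero_measure_def)

lemma sets_zero_measure [simp, measurable_cong]: "sets (zero_measure G) = sets borel"
  by (simp add: zero_measure_def)

lemma emeasure_zero_measure:
  assumes "G \<noteq> 0" and "B \<in> sets borel"
  shows "emeasure (zero_measure G) B =
           (\<Sum>z | poly G z = 0. of_nat (order z G) * emeasure (return borel z) B)"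
proof -
  have fin: "finite {z. poly G z = 0}"
    using assms(1) by (rule poly_roots_finite)
  have "emeasure (zero_measure G) B =
      emeasure (point_measure {z. poly G z = 0} (\<lambda>z. of_nat (order z G))) (B \<inter> {z. poly G z = 0})"
    using assms by (simp add: zero_measure_def emeasure_distr space_point_measure)
  also have "\<dots> = (\<Sum>z\<in>B \<inter> {z. poly G z = 0}. of_nat (order z G))"
    using fin by (subst emeasure_point_measure_finite) auto
  also have "\<dots> = (\<Sum>z | poly G z = 0. of_nat (order z G) * emeasure (return borel z) B)"
    using fin assms(2) by (intro sum.mono_neutral_cong_left) (auto simp: indicator_def split: if_splits)
  finally show ?thesis .
qed

text \<open>The rescaled measure \<open>B \<mapsto> \<mu>(cB)\<close> for \<open>c > 0\<close>, as the push-forward under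
  division by \<open>c\<close>.\<close>

definition dilate_measure :: "real \<Rightarrow> complex measure \<Rightarrow> complex measure" where
  "dilate_measure c \<mu> = distr \<mu> borel (\<lambda>z. z /\<^sub>R c)"

lemma emeasure_dilate_measure:
  assumes "c > 0" and "sets \<mu> = sets borel" and "B \<in> sets borel"
  shows "emeasure (dilate_measure c \<mu>) B = emeasure \<mu> ((\<lambda>z. c *\<^sub>R z) ` B)"
proof -
  have "(\<lambda>z. z /\<^sub>R c) \<in> measurable \<mu> borel"
    unfolding measurable_cong_sets[OF assms(2) refl] by measurable
  moreover have "(\<lambda>z. z /\<^sub>R c) -` B \<inter> space \<mu> = (\<lambda>z. c *\<^sub>R z) ` B"
    using assms(1) sets_eq_imp_space_eq[OF assms(2)] by (force simp: image_iff)
  ultimately show ?thesis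
    using assms(3) by (simp add: dilate_measure_def emeasure_distr)
qed

text \<open>Almost sure vague convergence of random measures. The exceptional null set may depend on
  the test function.\<close>

definition as_vague_conv ::
    "'a measure \<Rightarrow> (nat \<Rightarrow> 'a \<Rightarrow> complex measure) \<Rightarrow> complex measure \<Rightarrow> bool" where
  "as_vague_conv M \<mu>s \<mu> \<longleftrightarrow>
     (\<forall>\<phi> :: complex \<Rightarrow> real.
        continuous_on UNIV \<phi> \<longrightarrow> compact (closure {z. \<phi> z \<noteq> 0}) \<longrightarrow>
        (AE \<omega> in M. (\<lambda>n. \<integral>z. \<phi> z \<partial>\<mu>s n \<omega>) \<longlonglongrightarrow> (\<integral>z. \<phi> z \<partial>\<mu>)))"

definition (in prob_space) iid_complex :: "(nat \<Rightarrow> 'a \<Rightarrow> complex) \<Rightarrow> bool" where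
  "iid_complex \<xi> \<longleftrightarrow>
     indep_vars (\<lambda>_. borel) \<xi> UNIV \<and> (\<forall>i. distr M borel (\<xi> i) = distr M borel (\<xi> 0))"

definition (in prob_space) nondegenerate :: "('a \<Rightarrow> complex) \<Rightarrow> bool" where
  "nondegenerate X \<longleftrightarrow> \<not> (\<exists>c. AE \<omega> in M. X \<omega> = c)"

definition random_poly ::
    "(nat \<Rightarrow> 'a \<Rightarrow> complex) \<Rightarrow> (nat \<Rightarrow> complex) \<Rightarrow> nat \<Rightarrow> 'a \<Rightarrow> complex poly" where
  "random_poly \<xi> w n \<omega> = (\<Sum>k\<le>n. monom (\<xi> k \<omega> * w k) k)"

lemma poly_random_poly: "poly (random_poly \<xi> w n \<omega>) z = (\<Sum>k\<le>n. \<xi> k \<omega> * w k * z ^ k)"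
  by (simp add: random_poly_def poly_sum poly_monom)

end

theory Submission
  imports Defs
    "HOL-Computational_Algebra.Fundamental_Theorem_Algebra"
    "HOL-Complex_Analysis.Cauchy_Integral_Formula"
    "HOL-Real_Asymp.Real_Asymp"
begin

text \<open>
  Write \<open>c = exp \<beta> * n powr \<alpha>\<close> and \<open>u z = ln |W\<^sub>n (c * z)| / n\<close>. If the log-moment is finite, then almost
  surely \<open>u\<close> converges to \<open>\<Phi> z = \<alpha> * |z| powr (1 / \<alpha>)\<close> in \<open>L\<^sup>1\<close> on compact subsets of the open unit disc.
  The upper bound is termwise, from \<open>ln x \<le> x - 1\<close> and Borel-Cantelli. For the lower bound, a
  linearly long block of consecutive coefficients with index near \<open>n * |p| powr (1 / \<alpha>)\<close> is recovered
  by Cauchy's inequality from the values of the polynomial on a small disc around \<open>p\<close>, so the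
  probability that \<open>W\<^sub>n\<close> is too small on the whole disc is exponentially small; no inequality for
  single points and no passage to subsequences is needed. The sub-mean value property
  turns a good lower bound at one point of each small disc into the \<open>L\<^sup>1\<close> bound.

  Differences of disc means of \<open>z \<mapsto> ln |z - a|\<close> are compactly supported bumps in \<open>a\<close>, so \<open>L\<^sup>1\<close>
  convergence of the potentials gives convergence of the zero counting measures against bumps,
  hence against continuous functions supported in the open disc. Since \<open>W\<^sub>n\<close> has at most \<open>n\<close>
  zeros and the limit has mass 1 in the open disc, nothing is left for the outside.

  If the log-moment is infinite, then at record values of \<open>ln (1 + |\<xi>\<^sub>n|) / n\<close> the leading term
  dominates for \<open>|z| \<ge> c / 2\<close>, so that infinitely often there are no zeros in this region.
\<close>

section \<open>Anticoncentration of random polynomials on discs\<close>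

text \<open>The coefficients are only assumed non-degenerate, and the general small-ball bound at a
  single point decays only like a power of n, which need not be summable. On a disc, linearly many
  coefficients become visible at once; this is the source of the exponential rate. The index:
  \<open>ln (|w k| * |c * z| ^ k)\<close> is about \<alpha> (k ln (n s / k) + k) with s = |z| powr
  (1 / \<alpha>). This is largest at k = n s, with value \<alpha> n s = n \<Phi>(z). That index is
  at most n exactly when |z| \<le> 1, so \<Phi> can be attained only in the closed unit disc. The
  limit density is the Laplacian of \<Phi> divided by 2 \<pi>, and its logarithmic potential in the
  disc is \<Phi> - \<alpha>. The potential of the rescaled zeros differs from \<open>u\<close> by a
  constant depending on the leading coefficient, over which there is no control. The difference of
  two disc means of the logarithm removes both constants. Throughout, \<gamma> stands for 1 /
  \<alpha>, so that \<Phi>(z) = |z| powr \<gamma> / \<gamma>.\<close>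

lemma higher_deriv_poly: "(deriv ^^ n) (poly P) = poly ((pderiv ^^ n) P)" for P :: "complex poly"
  by (induction n) (auto intro!: DERIV_imp_deriv poly_DERIV)

lemma coeff_bound_sphere:
  fixes P :: "complex poly"
  assumes "0 < r" and bd: "\<And>z. cmod z = r \<Longrightarrow> cmod (poly P z) \<le> B"
  shows "cmod (coeff P i) * r ^ i \<le> B"
proof -
  have "cmod ((deriv ^^ i) (poly P) 0) \<le> fact i * B / r ^ i"
    by (rule Cauchy_inequality) (use assms in \<open>auto intro!: holomorphic_intros continuous_intros\<close>)
  moreover have "(deriv ^^ i) (poly P) 0 = fact i * coeff P i"
    unfolding higher_deriv_poly
    by (simp add: poly_0_coeff_0 coeff_higher_pderiv pochhammer_fact)
  ultimately have "fact i * cmod (coeff P i) \<le> fact i * (B / r ^ i)"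
    by (simp add: norm_mult)
  then have "cmod (coeff P i) \<le> B / r ^ i"
    by (rule mult_left_le_imp_le) simp
  then show ?thesis
    using assms(1) by (simp add: field_simps)
qed

text \<open>Cauchy on the circle of radius \<delta> / 2 bounds the Taylor coefficients at
  \<open>p\<close> by \<open>B * (2 / \<delta>) ^ i\<close>. The unit circle lies within distance 2
  of \<open>p\<close>, so the values there are at most a sum of \<open>m + 1\<close> terms
  \<open>B * (4 / \<delta>) ^ m\<close>, and Cauchy on the unit circle returns to the coefficients
  at 0. The loss is exponential in the degree only, hence affordable for short blocks.\<close>

lemma coeff_bound_ball:
  fixes P :: "complex poly"
  assumes deg: "degree P \<le> m" and p: "cmod p \<le> 1" and d: "0 < \<delta>" "\<delta> \<le> 1"
    and bd: "\<And>z. z \<in> ball p \<delta> \<Longrightarrow> cmod (poly P z) \<le> B"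
  shows "cmod (coeff P i) \<le> B * (real m + 1) * (4 / \<delta>) ^ m"
proof -
  define R where "R = pcompose P [:p, 1:]"
  have B: "0 \<le> B"
    using order.trans[OF norm_ge_zero bd[of p]] d by simp
  have R: "poly R z = poly P (p + z)" for z
    by (simp add: R_def poly_pcompose)
  have cR: "cmod (coeff R i) \<le> B * (2 / \<delta>) ^ i" for i
  proof -
    have "cmod (coeff R i) * (\<delta> / 2) ^ i \<le> B"
      by (rule coeff_bound_sphere) (use d in \<open>auto simp: R dist_norm intro!: bd\<close>)
    then show ?thesis
      using d by (simp add: field_simps)
  qed
  have degR: "degree R \<le> m"
    using deg by (simp add: R_def degree_pcompose)
  have "cmod (coeff P i) * 1 ^ i \<le> B * (real m + 1) * (4 / \<delta>) ^ m"
  proof (rule coeff_bound_sphere)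
    fix z :: complex assume z: "cmod z = 1"
    have zp: "cmod (z - p) \<le> 2"
      using norm_triangle_ineq4[of z p] z p by simp
    have "poly P z = poly R (z - p)"
      by (simp add: R)
    also have "\<dots> = (\<Sum>i\<le>m. coeff R i * (z - p) ^ i)"
      unfolding poly_altdef
      by (rule sum.mono_neutral_left) (use degR in \<open>auto simp: coeff_eq_0\<close>)
    finally have "cmod (poly P z) \<le> (\<Sum>i\<le>m. cmod (coeff R i * (z - p) ^ i))"
      by (simp add: norm_sum)
    also have "\<dots> \<le> (\<Sum>i\<le>m. B * (4 / \<delta>) ^ m)"
    proof (rule sum_mono)
      fix i assume i: "i \<in> {..m}"
      have "cmod (coeff R i * (z - p) ^ i) \<le> (B * (2 / \<delta>) ^ i) * 2 ^ i"
        unfolding norm_mult norm_power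
        by (intro mult_mono cR power_mono zp) (use B d in auto)
      also have "\<dots> = B * (4 / \<delta>) ^ i"
        by (simp flip: power_mult_distrib)
      also have "\<dots> \<le> B * (4 / \<delta>) ^ m"
        by (intro mult_left_mono power_increasing) (use B d i in auto)
      finally show "cmod (coeff R i * (z - p) ^ i) \<le> B * (4 / \<delta>) ^ m" .
    qed
    finally show "cmod (poly P z) \<le> B * (real m + 1) * (4 / \<delta>) ^ m"
      by (simp add: algebra_simps)
  qed simp
  then show ?thesis by simp
qed

text \<open>A law that is not a point mass has two distinct points \<open>a\<close>,
  \<open>b\<close> in its support. \<open>U\<close> is the complement of the support, a null set
  because the topology has a countable basis. A small disc misses a ball around \<open>a\<close> or
  one around \<open>b\<close>, and so misses a fixed amount of mass.\<close>

lemma nondegenerate_imp_anticoncentrated: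
  fixes N :: "complex measure"
  assumes "prob_space N" and sets: "sets N = sets borel"
    and nd: "\<nexists>c. AE x in N. x = c"
  obtains \<rho> c where "0 < \<rho>" "0 \<le> c" "c < 1" "\<And>x. measure N (cball x \<rho>) \<le> c"
proof -
  interpret prob_space N by fact
  have [measurable_cong]: "sets N = sets borel" by fact
  have sp: "space N = UNIV"
    using sets_eq_imp_space_eq[OF sets] by simp
  obtain \<B> :: "complex set set" where \<B>: "countable \<B>" "topological_basis \<B>"
    using ex_countable_basis by blast
  define U where "U = \<Union>{b \<in> \<B>. emeasure N b = 0}"
  have open_b: "open b" if "b \<in> \<B>" for b
    using \<B>(2) that by (rule topological_basis_open)
  have U: "U \<in> null_sets N"
    unfolding U_def
    by (rule null_sets_UN'[where N="\<lambda>b. b" and I="{b \<in> \<B>. emeasure N b = 0}", simplified])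
       (use \<B> open_b sets in \<open>auto simp: null_sets_def intro: countable_subset\<close>)
  have pos: "0 < measure N (ball a r)" if ar: "a \<notin> U" "0 < r" for a r
  proof -
    obtain b where b: "b \<in> \<B>" "a \<in> b" "b \<subseteq> ball a r"
      using topological_basisE[OF \<B>(2) open_ball, of a a r] ar by (metis centre_in_ball)
    have "emeasure N b \<noteq> 0"
      using b ar by (auto simp: U_def)
    then have "0 < measure N b"
      by (simp add: emeasure_eq_measure zero_less_measure_iff)
    also have "\<dots> \<le> measure N (ball a r)"
      by (rule finite_measure_mono) (use b sets in auto)
    finally show ?thesis .
  qed
  have AEU: "AE x in N. x \<notin> U"
    using U by (rule AE_not_in)
  have "\<exists>a. a \<notin> U"
  proof (rule ccontr)
    assume "\<nexists>a. a \<notin> U"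
    then have "AE x in N. False" using AEU by simp
    then show False by simp
  qed
  then obtain a where a: "a \<notin> U" by blast
  have "\<exists>b. b \<notin> U \<and> b \<noteq> a"
  proof (rule ccontr)
    assume "\<nexists>b. b \<notin> U \<and> b \<noteq> a"
    then have "AE x in N. x = a" using AEU by (auto elim!: eventually_mono)
    then show False using nd by blast
  qed
  then obtain b where b: "b \<notin> U" "b \<noteq> a" by blast
  \<comment> \<open>A fifth is small enough: a closed disc of radius \<open>\<rho>\<close> meeting
    both open balls would force \<open>dist a b < 4 * \<rho>\<close>.\<close>
  define \<rho> where "\<rho> = dist a b / 5"
  define c where "c = 1 - min (measure N (ball a \<rho>)) (measure N (ball b \<rho>))"
  have \<rho>: "0 < \<rho>" using b by (simp add: \<rho>_def)
  show ?thesis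
  proof
    show "0 < \<rho>" by fact
    show "c < 1" using pos[OF a \<rho>] pos[OF b(1) \<rho>] by (simp add: c_def)
    show "0 \<le> c" by (simp add: c_def min_le_iff_disj)
    fix x
    have *: "measure N (cball x \<rho>) \<le> 1 - measure N (ball y \<rho>)" if "cball x \<rho> \<inter> ball y \<rho> = {}" for y
    proof -
      have "measure N (cball x \<rho>) \<le> measure N (space N - ball y \<rho>)"
        by (rule finite_measure_mono) (use that sets sp in auto)
      also have "\<dots> = 1 - measure N (ball y \<rho>)"
        by (rule prob_compl) (simp add: sets)
      finally show ?thesis .
    qed
    have "cball x \<rho> \<inter> ball a \<rho> = {} \<or> cball x \<rho> \<inter> ball b \<rho> = {}"
    proof (rule ccontr)
      assume "\<not> ?thesis"
      then obtain s t where st: "dist x s \<le> \<rho>" "dist a s < \<rho>" "dist x t \<le> \<rho>" "dist b t < \<rho>"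
        by (auto simp: disjoint_iff)
      have "dist a b \<le> dist a s + dist x s + dist x t + dist b t"
        by (smt (verit) dist_triangle dist_commute)
      then show False using st \<rho> unfolding \<rho>_def by linarith
    qed
    then show "measure N (cball x \<rho>) \<le> c"
      using *[of a] *[of b] by (auto simp: c_def)
  qed
qed

text \<open>Fubini with the coordinates in \<open>J\<close> frozen: by \<open>sec\<close>, a
  nonempty section lies in a product of closed discs of radius \<open>\<rho>\<close> centred at any
  one of its points, and each factor has probability at most \<open>c\<close>.\<close>

lemma emeasure_PiM_small_sections:
  fixes N :: "complex measure"
  assumes "prob_space N" and sets: "sets N = sets borel"
    and conc: "\<And>x. measure N (cball x \<rho>) \<le> c"
    and fin: "finite I" "finite J" and disj: "I \<inter> J = {}"
    and A: "A \<in> sets (\<Pi>\<^sub>M i\<in>I \<union> J. N)"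
    and sec: "\<And>x y i. x \<in> A \<Longrightarrow> y \<in> A \<Longrightarrow> (\<forall>j\<in>J. x j = y j) \<Longrightarrow> i \<in> I \<Longrightarrow> dist (x i) (y i) \<le> \<rho>"
  shows "emeasure (\<Pi>\<^sub>M i\<in>I \<union> J. N) A \<le> ennreal (c ^ card I)"
proof -
  interpret N: prob_space N by fact
  interpret P: product_prob_space "\<lambda>_. N" UNIV by standard
  interpret PJ: prob_space "\<Pi>\<^sub>M i\<in>J. N" by (rule prob_space_PiM) (rule assms)
  have c: "0 \<le> c"
    using conc[of 0] measure_nonneg[of N] by (rule order.trans[rotated])
  have sp: "space N = UNIV"
    using sets_eq_imp_space_eq[OF sets] by simp
  have A': "A \<in> sets (\<Pi>\<^sub>M i\<in>J \<union> I. N)"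
    using A by (simp add: Un_commute)
  have "emeasure (\<Pi>\<^sub>M i\<in>J \<union> I. N) A =
      (\<integral>\<^sup>+ x. emeasure (\<Pi>\<^sub>M i\<in>I. N) ((\<lambda>y. merge J I (x, y)) -` A \<inter> space (\<Pi>\<^sub>M i\<in>I. N)) \<partial>(\<Pi>\<^sub>M i\<in>J. N))"
    using disj by (intro P.emeasure_fold_integral fin A') auto
  also have "\<dots> \<le> (\<integral>\<^sup>+ x. ennreal (c ^ card I) \<partial>(\<Pi>\<^sub>M i\<in>J. N))"
  proof (rule nn_integral_mono)
    fix x assume "x \<in> space (\<Pi>\<^sub>M i\<in>J. N)"
    define S where "S = (\<lambda>y. merge J I (x, y)) -` A \<inter> space (\<Pi>\<^sub>M i\<in>I. N)"
    show "emeasure (\<Pi>\<^sub>M i\<in>I. N) S \<le> ennreal (c ^ card I)"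
    proof (cases "S = {}")
      case False
      then obtain y where y: "y \<in> S" by blast
      have sub: "S \<subseteq> (\<Pi>\<^sub>E i\<in>I. cball (y i) \<rho>)"
      proof
        fix y' assume y': "y' \<in> S"
        have "dist (y i) (y' i) \<le> \<rho>" if i: "i \<in> I" for i
        proof -
          have "dist (merge J I (x, y) i) (merge J I (x, y') i) \<le> \<rho>"
            using y y' i by (intro sec) (auto simp: S_def merge_def)
          then show ?thesis using i disj by (auto simp: merge_def split: if_splits)
        qed
        then show "y' \<in> (\<Pi>\<^sub>E i\<in>I. cball (y i) \<rho>)"
          using y' by (auto simp: S_def space_PiM PiE_def)
      qed
      have "emeasure (\<Pi>\<^sub>M i\<in>I. N) S \<le> emeasure (\<Pi>\<^sub>M i\<in>I. N) (\<Pi>\<^sub>E i\<in>I. cball (y i) \<rho>)"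
        by (rule emeasure_mono[OF sub]) (use fin sets in \<open>auto intro!: sets_PiM_I_finite\<close>)
      also have "\<dots> = (\<Prod>i\<in>I. emeasure N (cball (y i) \<rho>))"
        by (rule P.emeasure_PiM) (use fin sets in auto)
      also have "\<dots> = ennreal (\<Prod>i\<in>I. measure N (cball (y i) \<rho>))"
        by (simp add: N.emeasure_eq_measure prod_ennreal)
      also have "\<dots> \<le> ennreal (\<Prod>i\<in>I. c)"
        by (intro ennreal_leI prod_mono conjI conc) auto
      also have "\<dots> = ennreal (c ^ card I)"
        by simp
      finally show ?thesis .
    qed simp
  qed
  also have "\<dots> = ennreal (c ^ card I)"
    by (simp add: PJ.emeasure_space_1)
  finally show ?thesis by (simp add: Un_commute)
qed

text \<open>On the disc |z| \<ge> |p| - \<delta>, so the common factor \<open>z ^ k0\<close> can be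
  divided out, leaving a polynomial of degree at most \<open>m\<close>. Thus the loss
  \<open>(4 / \<delta>) ^ m\<close> involves the length of the block and not
  \<open>n\<close>.\<close>

lemma block_coeff_bound:
  fixes a :: "nat \<Rightarrow> complex"
  assumes km: "k0 + m \<le> n" and zero: "\<And>k. k \<le> n \<Longrightarrow> k \<notin> {k0..k0 + m} \<Longrightarrow> a k = 0"
    and bd: "\<And>z. z \<in> ball p \<delta> \<Longrightarrow> cmod (\<Sum>k\<le>n. a k * z ^ k) \<le> B"
    and d: "0 < \<delta>" "\<delta> < cmod p" "cmod p \<le> 1" and k: "k \<in> {k0..k0 + m}"
  shows "cmod (a k) \<le> B / (cmod p - \<delta>) ^ k0 * (real m + 1) * (4 / \<delta>) ^ m"
proof -
  define Q where "Q = (\<Sum>i\<le>m. monom (a (k0 + i)) i)"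
  have coeffQ: "coeff Q i = (if i \<le> m then a (k0 + i) else 0)" for i
    by (simp add: Q_def coeff_sum if_distrib sum.delta cong: if_cong)
  have sumQ: "(\<Sum>k\<le>n. a k * z ^ k) = z ^ k0 * poly Q z" for z
  proof -
    have "(\<Sum>k\<le>n. a k * z ^ k) = (\<Sum>k\<in>{k0..k0 + m}. a k * z ^ k)"
      by (rule sum.mono_neutral_right) (use km zero in auto)
    also have "\<dots> = (\<Sum>i\<le>m. a (k0 + i) * z ^ (k0 + i))"
      by (rule sum.reindex_bij_witness[where j = "\<lambda>k. k - k0" and i = "\<lambda>i. k0 + i"]) auto
    also have "\<dots> = z ^ k0 * poly Q z"
      by (simp add: Q_def poly_sum poly_monom sum_distrib_left power_add algebra_simps)
    finally show ?thesis .
  qed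
  have pd: "0 < cmod p - \<delta>" using d by simp
  have "cmod (coeff Q (k - k0)) \<le> B / (cmod p - \<delta>) ^ k0 * (real m + 1) * (4 / \<delta>) ^ m"
  proof (rule coeff_bound_ball)
    show "degree Q \<le> m" by (rule degree_le) (simp add: coeffQ)
    fix z assume z: "z \<in> ball p \<delta>"
    have "cmod p - \<delta> \<le> cmod z"
      using z norm_triangle_ineq2[of p z] by (simp add: dist_norm)
    then have "(cmod p - \<delta>) ^ k0 * cmod (poly Q z) \<le> cmod z ^ k0 * cmod (poly Q z)"
      using pd by (intro mult_right_mono power_mono) auto
    also have "\<dots> \<le> B"
      using bd[OF z] by (simp add: sumQ norm_mult norm_power)
    finally show "cmod (poly Q z) \<le> B / (cmod p - \<delta>) ^ k0"
      using pd by (simp add: field_simps)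
  qed (use d in auto)
  then show ?thesis
    using k by (auto simp: coeffQ split: if_splits)
qed

text \<open>Two realisations which agree off the block and are both small on the disc have nearly equal
  coefficients on the block, so conditionally on the other coefficients each coefficient of the
  block is confined to a small disc.\<close>

lemma (in prob_space) prob_small_on_ball:
  fixes \<xi> :: "nat \<Rightarrow> 'a \<Rightarrow> complex" and a :: "nat \<Rightarrow> complex"
  assumes iid: "iid_complex \<xi>" and conc: "\<And>x. measure (distr M borel (\<xi> 0)) (cball x \<rho>) \<le> c"
    and km: "k0 + m \<le> n" and d: "0 < \<delta>" "\<delta> < cmod p" "cmod p \<le> 1"
    and a: "\<And>k. k \<in> {k0..k0 + m} \<Longrightarrow>
      2 * \<eta> / (cmod p - \<delta>) ^ k0 * (real m + 1) * (4 / \<delta>) ^ m \<le> \<rho> * cmod (a k) \<and> a k \<noteq> 0"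
  shows "{\<omega> \<in> space M. \<forall>z\<in>ball p \<delta>. cmod (\<Sum>k\<le>n. \<xi> k \<omega> * a k * z ^ k) \<le> \<eta>} \<in> sets M"
      (is "?E \<in> _")
    and "emeasure M {\<omega> \<in> space M. \<forall>z\<in>ball p \<delta>. cmod (\<Sum>k\<le>n. \<xi> k \<omega> * a k * z ^ k) \<le> \<eta>}
      \<le> ennreal (c ^ (m + 1))"
proof -
  define N where "N = distr M borel (\<xi> 0)"
  have ind: "indep_vars (\<lambda>_. borel) \<xi> UNIV" and distr: "distr M borel (\<xi> i) = N" for i
    using iid by (auto simp: iid_complex_def N_def)
  have [measurable]: "\<xi> i \<in> borel_measurable M" for i
    using ind by (simp add: indep_vars_def)
  have N: "prob_space N" and [measurable_cong]: "sets N = sets borel"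
    by (auto simp: N_def intro!: prob_space_distr)
  obtain D :: "complex set" where D: "countable D" "\<And>X. open X \<Longrightarrow> X \<noteq> {} \<Longrightarrow> \<exists>d\<in>D. d \<in> X"
    by (rule countable_dense_setE) blast
  define S where "S x z = (\<Sum>k\<le>n. x k * a k * z ^ k)" for x z
  \<comment> \<open>A bound on the whole ball is an uncountable intersection of events. By
    continuity in \<open>z\<close> the points of a countable dense set suffice, which gives
    measurability.\<close>
  have dense: "(\<forall>z\<in>ball p \<delta>. cmod (S x z) \<le> \<eta>) \<longleftrightarrow> (\<forall>z\<in>D \<inter> ball p \<delta>. cmod (S x z) \<le> \<eta>)" for x
  proof
    assume *: "\<forall>z\<in>D \<inter> ball p \<delta>. cmod (S x z) \<le> \<eta>"
    show "\<forall>z\<in>ball p \<delta>. cmod (S x z) \<le> \<eta>"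
    proof (rule ccontr)
      assume "\<not> ?thesis"
      then have "ball p \<delta> \<inter> {z. \<eta> < cmod (S x z)} \<noteq> {}" by (auto simp: not_le)
      moreover have "open (ball p \<delta> \<inter> {z. \<eta> < cmod (S x z)})"
        unfolding S_def by (intro open_Int open_ball open_Collect_less continuous_intros)
      ultimately obtain u where "u \<in> D" "u \<in> ball p \<delta> \<inter> {z. \<eta> < cmod (S x z)}"
        using D(2) by blast
      moreover from this have "cmod (S x u) \<le> \<eta>" using * by blast
      ultimately show False by simp
    qed
  qed auto
  define A where "A = {x \<in> space (\<Pi>\<^sub>M i\<in>{..n}. N). \<forall>z\<in>ball p \<delta>. cmod (S x z) \<le> \<eta>}"
  have cD: "countable (D \<inter> ball p \<delta>)" using D(1) by auto
  have A: "A \<in> sets (\<Pi>\<^sub>M i\<in>{..n}. N)"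
  proof -
    have ne: "D \<inter> ball p \<delta> \<noteq> {}" using D(2)[of "ball p \<delta>"] d by auto
    have "A = (\<Inter>z\<in>D \<inter> ball p \<delta>. {x \<in> space (\<Pi>\<^sub>M i\<in>{..n}. N). cmod (S x z) \<le> \<eta>})"
      unfolding A_def dense using ne by auto
    also have "\<dots> \<in> sets (\<Pi>\<^sub>M i\<in>{..n}. N)"
    proof (rule sets.countable_INT'[OF cD ne], safe)
      fix z show "{x \<in> space (\<Pi>\<^sub>M i\<in>{..n}. N). cmod (S x z) \<le> \<eta>} \<in> sets (\<Pi>\<^sub>M i\<in>{..n}. N)"
        unfolding S_def by measurable
    qed
    finally show ?thesis .
  qed
  define X where "X = (\<lambda>\<omega>. \<lambda>i\<in>{..n}. \<xi> i \<omega>)"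
  have X[measurable]: "X \<in> M \<rightarrow>\<^sub>M (\<Pi>\<^sub>M i\<in>{..n}. N)"
    unfolding X_def by measurable
  have SX: "S (X \<omega>) z = S (\<lambda>i. \<xi> i \<omega>) z" for \<omega> z
    by (simp add: S_def X_def)
  have E: "?E = X -` A \<inter> space M"
    using measurable_space[OF X] by (auto simp: A_def SX) (auto simp: S_def)
  show "?E \<in> sets M"
    unfolding E by (rule measurable_sets[OF X A])
  have "indep_vars (\<lambda>_. borel) \<xi> {..n}"
    by (rule indep_vars_subset[OF ind]) simp
  then have "distr M (\<Pi>\<^sub>M i\<in>{..n}. borel) X = (\<Pi>\<^sub>M i\<in>{..n}. N)"
    by (subst (asm) indep_vars_iff_distr_eq_PiM') (auto simp: distr X_def)
  also have "distr M (\<Pi>\<^sub>M i\<in>{..n}. borel) X = distr M (\<Pi>\<^sub>M i\<in>{..n}. N) X"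
    by (rule distr_cong) (auto intro!: sets_PiM_cong simp: N_def)
  finally have dX: "distr M (\<Pi>\<^sub>M i\<in>{..n}. N) X = (\<Pi>\<^sub>M i\<in>{..n}. N)" .
  have split: "{k0..k0 + m} \<union> ({..n} - {k0..k0 + m}) = {..n}" using km by auto
  have "emeasure M ?E = emeasure (\<Pi>\<^sub>M i\<in>{..n}. N) A"
    using emeasure_distr[OF X A] by (simp only: dX E)
  also have "\<dots> = emeasure (\<Pi>\<^sub>M i\<in>{k0..k0 + m} \<union> ({..n} - {k0..k0 + m}). N) A"
    unfolding split ..
  also have "\<dots> \<le> ennreal (c ^ card {k0..k0 + m})"
  proof (rule emeasure_PiM_small_sections[where \<rho> = \<rho>])
    show "A \<in> sets (\<Pi>\<^sub>M i\<in>{k0..k0 + m} \<union> ({..n} - {k0..k0 + m}). N)"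
      unfolding split by (rule A)
    fix x y k assume x: "x \<in> A" and y: "y \<in> A" and xy: "\<forall>j\<in>{..n} - {k0..k0 + m}. x j = y j"
      and k: "k \<in> {k0..k0 + m}"
    have "cmod ((x k - y k) * a k) \<le> 2 * \<eta> / (cmod p - \<delta>) ^ k0 * (real m + 1) * (4 / \<delta>) ^ m"
    proof (rule block_coeff_bound[OF km _ _ d k])
      fix z assume z: "z \<in> ball p \<delta>"
      have "(\<Sum>k\<le>n. (x k - y k) * a k * z ^ k) = S x z - S y z"
        by (simp add: S_def sum_subtractf algebra_simps)
      also have "cmod \<dots> \<le> \<eta> + \<eta>"
        using x y z by (intro order.trans[OF norm_triangle_ineq4] add_mono) (auto simp: A_def)
      finally show "cmod (\<Sum>k\<le>n. (x k - y k) * a k * z ^ k) \<le> 2 * \<eta>" by simp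
    qed (use xy in auto)
    also have "\<dots> \<le> \<rho> * cmod (a k)" using a[OF k] by blast
    finally show "dist (x k) (y k) \<le> \<rho>"
      using a[OF k] by (simp add: norm_mult dist_norm)
  qed (use N conc in \<open>auto simp: N_def\<close>)
  finally show "emeasure M ?E \<le> ennreal (c ^ (m + 1))"
    by simp
qed

section \<open>Size of the rescaled weights\<close>

text \<open>The logarithm of the right-hand side is \<alpha> k + \<alpha> k ln (s n / k) up to the
  o(k) error, and the second term is nonnegative because k \<le> s n. The lower limit on k pushes k
  beyond the threshold of the asymptotics. The lemma is meant for s powr \<alpha> = |p|, where k
  near s n gives nearly n \<Phi>(p).\<close>

lemma weight_lower_bound:
  fixes w :: "nat \<Rightarrow> complex"
  assumes asy: "(\<lambda>k. ln (cmod (w k)) - (- \<alpha> * (real k * ln (real k) - real k) - \<beta> * real k))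
           \<in> o(\<lambda>k. real k)"
    and a: "0 < \<alpha>" and w: "\<forall>n\<ge>1. w n \<noteq> 0" and s: "0 < s" and e: "0 < \<epsilon>"
  shows "\<forall>\<^sub>F n in sequentially. \<forall>k. s / 2 * real n \<le> real k \<longrightarrow> real k \<le> s * real n \<longrightarrow>
    exp (\<alpha> * real k - \<epsilon> * s * real n) \<le> cmod (w k) * (exp \<beta> * real n powr \<alpha>) ^ k * (s powr \<alpha>) ^ k"
proof -
  have "\<forall>\<^sub>F k in sequentially. norm (ln (cmod (w k)) - (- \<alpha> * (real k * ln (real k) - real k) - \<beta> * real k))
      \<le> \<epsilon> * norm (real k)"
    using landau_o.smallD[OF asy e] by simp
  then obtain K where K: "\<And>k. k \<ge> K \<Longrightarrow>
      \<bar>ln (cmod (w k)) - (- \<alpha> * (real k * ln (real k) - real k) - \<beta> * real k)\<bar> \<le> \<epsilon> * real k"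
    by (auto simp: eventually_sequentially)
  have "filterlim (\<lambda>n. s / 2 * real n) at_top sequentially"
    by (rule filterlim_tendsto_pos_mult_at_top[OF tendsto_const _ filterlim_real_sequentially]) (use s in auto)
  then have "\<forall>\<^sub>F n in sequentially. real (K + 1) \<le> s / 2 * real n"
    unfolding filterlim_at_top by blast
  moreover have "\<forall>\<^sub>F n :: nat in sequentially. n \<ge> 1" by (rule eventually_ge_at_top)
  ultimately show ?thesis
  proof eventually_elim
    case (elim n)
    show ?case
    proof (intro allI impI)
      fix k assume k: "s / 2 * real n \<le> real k" "real k \<le> s * real n"
      then have kK: "k \<ge> K" "k \<ge> 1" using elim by linarith+
      have n: "0 < real n" using elim by simp
      have "ln (real k) \<le> ln (s * real n)"
        using k kK by (intro ln_mono) auto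
      then have lnk: "ln (real k) \<le> ln s + ln (real n)"
        using s n by (simp add: ln_mult)
      have pos: "0 < cmod (w k)" using w kK by simp
      have "\<alpha> * real k * (ln s + ln (real n) - ln (real k)) \<ge> 0"
        using a lnk by simp
      moreover have "\<epsilon> * real k \<le> \<epsilon> * s * real n"
        using e k mult_left_mono[of "real k" "s * real n" \<epsilon>] by (simp add: mult.assoc)
      ultimately have "\<alpha> * real k - \<epsilon> * s * real n \<le>
          ln (cmod (w k)) + real k * (\<beta> + \<alpha> * ln (real n)) + real k * (\<alpha> * ln s)"
        using K[OF kK(1)] by (simp add: algebra_simps abs_le_iff)
      also have "\<dots> = ln (cmod (w k) * (exp \<beta> * real n powr \<alpha>) ^ k * (s powr \<alpha>) ^ k)"
        using pos s n by (simp add: ln_mult ln_realpow ln_powr)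
      finally show "exp (\<alpha> * real k - \<epsilon> * s * real n) \<le>
          cmod (w k) * (exp \<beta> * real n powr \<alpha>) ^ k * (s powr \<alpha>) ^ k"
        using pos s n by (subst ln_ge_iff[symmetric]) auto
    qed
  qed
qed

text \<open>With s = r powr (1 / \<alpha>) the main exponent is \<alpha> (k ln (n s / k) + k), and
  ln x \<le> x - 1 at x = n s / k bounds it by \<alpha> n s for every k at once. The constant does
  not depend on n, k or r, since only the finitely many weights before the threshold of the
  asymptotics need it.\<close>

lemma weight_upper_bound:
  fixes w :: "nat \<Rightarrow> complex"
  assumes asy: "(\<lambda>k. ln (cmod (w k)) - (- \<alpha> * (real k * ln (real k) - real k) - \<beta> * real k))
           \<in> o(\<lambda>k. real k)"
    and a: "0 < \<alpha>" and e: "0 < \<epsilon>"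
  obtains K where "0 < K" "\<And>n k r. 0 \<le> r \<Longrightarrow> 
    cmod (w k) * (exp \<beta> * real n powr \<alpha> * r) ^ k \<le> K * exp (\<epsilon> * real k + \<alpha> * real n * r powr (1 / \<alpha>))"
proof -
  define E where "E k = exp (- \<alpha> * (real k * ln (real k) - real k) - \<beta> * real k + \<epsilon> * real k)" for k
  have E: "0 < E k" for k by (simp add: E_def)
  have "\<forall>\<^sub>F k in sequentially. norm (ln (cmod (w k)) - (- \<alpha> * (real k * ln (real k) - real k) - \<beta> * real k))
      \<le> \<epsilon> * norm (real k)"
    using landau_o.smallD[OF asy e] by simp
  then obtain K where K: "\<And>k. k \<ge> K \<Longrightarrow>
      \<bar>ln (cmod (w k)) - (- \<alpha> * (real k * ln (real k) - real k) - \<beta> * real k)\<bar> \<le> \<epsilon> * real k"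
    by (auto simp: eventually_sequentially)
  define L where "L = 1 + (\<Sum>k<K. cmod (w k) / E k)"
  have L: "1 \<le> L" using E by (auto simp: L_def intro!: sum_nonneg divide_nonneg_pos)
  have wE: "cmod (w k) \<le> L * E k" for k
  proof (cases "k < K")
    case True
    have "cmod (w k) / E k \<le> (\<Sum>k<K. cmod (w k) / E k)"
      using True E by (intro member_le_sum) (auto intro!: divide_nonneg_pos)
    then have "cmod (w k) / E k \<le> L" by (simp add: L_def)
    then show ?thesis using E[of k] by (simp add: field_simps)
  next
    case False
    show ?thesis
    \<comment> \<open>As \<open>ln 0 = 0\<close>, the asymptotic estimate carries no upper bound for
      a vanishing weight; there the claim is trivial.\<close>
    proof (cases "w k = 0")
      case False
      have "ln (cmod (w k)) \<le> - \<alpha> * (real k * ln (real k) - real k) - \<beta> * real k + \<epsilon> * real k"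
        using K[of k] \<open>\<not> k < K\<close> by (simp add: abs_le_iff)
      then have "exp (ln (cmod (w k))) \<le> E k"
        unfolding E_def by (rule exp_le_cancel_iff[THEN iffD2])
      then have "cmod (w k) \<le> E k"
        using False by simp
      also have "\<dots> \<le> L * E k" using L E[of k] by simp
      finally show ?thesis .
    qed (use L E[of k] in auto)
  qed
  show ?thesis
  proof
    show "0 < L" using L by simp
    fix n k :: nat and r :: real assume r: "0 \<le> r"
    have "E k * (exp \<beta> * real n powr \<alpha> * r) ^ k \<le> exp (\<epsilon> * real k + \<alpha> * real n * r powr (1 / \<alpha>))"
    proof (cases "k = 0 \<or> r = 0 \<or> n = 0")
      case True
      then show ?thesis using a by (auto simp: E_def power_0_left)
    next
      case False
      define s where "s = r powr (1 / \<alpha>)"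
      have s: "0 < s" and rs: "r = s powr \<alpha>" using False r a by (auto simp: s_def powr_powr)
      have pos: "0 < real n" "0 < real k" using False by auto
      have "ln (real n * s / real k) \<le> real n * s / real k - 1"
        by (rule ln_le_minus_one) (use s pos in simp)
      then have "real k * ln (real n * s / real k) \<le> real k * (real n * s / real k - 1)"
        using pos by (intro mult_left_mono) auto
      also have "\<dots> = real n * s - real k" using pos by (simp add: field_simps)
      finally have "real k * (ln (real n) + ln s - ln (real k)) \<le> real n * s - real k"
        using pos s by (simp add: ln_mult ln_div)
      then have "\<alpha> * (real k * (ln (real n) + ln s - ln (real k))) \<le> \<alpha> * (real n * s - real k)"
        using a by (intro mult_left_mono) auto
      then have "- \<alpha> * (real k * ln (real k) - real k) - \<beta> * real k + \<epsilon> * real k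
          + real k * (\<beta> + \<alpha> * ln (real n) + \<alpha> * ln s) \<le> \<epsilon> * real k + \<alpha> * real n * s"
        by (simp add: algebra_simps)
      moreover have "(exp \<beta> * real n powr \<alpha> * r) ^ k = exp (real k * (\<beta> + \<alpha> * ln (real n) + \<alpha> * ln s))"
        using pos s by (simp add: rs powr_def exp_of_nat_mult flip: exp_add)
      ultimately show ?thesis
        unfolding E_def s_def[symmetric] by (simp flip: exp_add)
    qed
    then have "L * (E k * (exp \<beta> * real n powr \<alpha> * r) ^ k) \<le> L * exp (\<epsilon> * real k + \<alpha> * real n * r powr (1 / \<alpha>))"
      using L by (intro mult_left_mono) auto
    moreover have "cmod (w k) * (exp \<beta> * real n powr \<alpha> * r) ^ k \<le> L * E k * (exp \<beta> * real n powr \<alpha> * r) ^ k"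
      using r by (intro mult_right_mono wE) auto
    ultimately show "cmod (w k) * (exp \<beta> * real n powr \<alpha> * r) ^ k \<le> L * exp (\<epsilon> * real k + \<alpha> * real n * r powr (1 / \<alpha>))"
      by (simp add: mult.assoc)
  qed
qed

section \<open>Almost sure lower bounds on small discs\<close>

lemma nat_floor_bounds:
  fixes x :: real
  assumes "0 \<le> x"
  shows "real (nat \<lfloor>x\<rfloor>) \<le> x" "x - 1 \<le> real (nat \<lfloor>x\<rfloor>)"
proof -
  have *: "real (nat \<lfloor>x\<rfloor>) = of_int \<lfloor>x\<rfloor>" using assms by simp
  show "real (nat \<lfloor>x\<rfloor>) \<le> x" "x - 1 \<le> real (nat \<lfloor>x\<rfloor>)" unfolding * by linarith+
qed

text \<open>The block consists of the \<open>m + 1\<close> indices ending at the floor of s n, where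
  s = |p| powr (1 / \<alpha>) is the optimal index ratio and \<open>m\<close> is about \<theta> n.
  Smallness on the disc then has probability at most \<open>c ^ (m + 1)\<close>, a geometric rate in
  \<open>n\<close>, and the first Borel-Cantelli lemma applies.\<close>

lemma (in prob_space) AE_poly_lower_bound:
  fixes \<xi> :: "nat \<Rightarrow> 'a \<Rightarrow> complex" and w :: "nat \<Rightarrow> complex"
  assumes iid: "iid_complex \<xi>" and nd: "nondegenerate (\<xi> 0)"
    and asy: "(\<lambda>k. ln (cmod (w k)) - (- \<alpha> * (real k * ln (real k) - real k) - \<beta> * real k))
           \<in> o(\<lambda>k. real k)"
    and a: "0 < \<alpha>" and w: "\<forall>n\<ge>1. w n \<noteq> 0"
    and p: "p \<noteq> 0" "cmod p < 1" and e: "0 < \<epsilon>" and d: "0 < \<delta>"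
  shows "AE \<omega> in M. \<forall>\<^sub>F n in sequentially. \<exists>z\<in>ball p \<delta>.
    exp (real n * (\<alpha> * cmod p powr (1 / \<alpha>) - \<epsilon>))
      < cmod (\<Sum>k\<le>n. \<xi> k \<omega> * w k * (complex_of_real (exp \<beta> * real n powr \<alpha>) * z) ^ k)"
proof -
  define N where "N = distr M borel (\<xi> 0)"
  have [measurable]: "\<xi> i \<in> borel_measurable M" for i
    using iid by (simp add: iid_complex_def indep_vars_def)
  have "(AE x in N. x = c) \<longleftrightarrow> (AE \<omega> in M. \<xi> 0 \<omega> = c)" for c
    unfolding N_def by (rule AE_distr_iff) auto
  then have "\<nexists>c. AE x in N. x = c"
    using nd by (simp add: nondegenerate_def)
  moreover have "prob_space N" "sets N = sets borel"
    by (auto simp: N_def intro!: prob_space_distr)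
  ultimately obtain \<rho> c0 where \<rho>: "0 < \<rho>" "c0 < 1" and conc0: "\<And>x. measure N (cball x \<rho>) \<le> c0"
    by (metis nondegenerate_imp_anticoncentrated)
  \<comment> \<open>Makes the bound positive, so that real powers of \<open>c\<close> can be
    taken.\<close>
  define c where "c = max c0 (1 / 2)"
  have c: "0 < c" "c < 1" and conc: "\<And>x. measure N (cball x \<rho>) \<le> c"
    using \<rho> conc0 by (auto simp: c_def le_max_iff_disj)
  define s where "s = cmod p powr (1 / \<alpha>)"
  have s: "0 < s" "s < 1" and sa: "s powr \<alpha> = cmod p"
    using p a powr_less_mono2[of "1 / \<alpha>" "cmod p" 1] by (auto simp: s_def powr_powr)
  \<comment> \<open>One share each for the error in the weights, for block indices below s n, for
    replacing |p| by |p| - \<delta>', and for the factor \<open>(4 / \<delta>') ^ m\<close>. The two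
    remaining shares beat the factor \<open>2 * (real n + 1) / \<rho>\<close>.\<close>
  define \<epsilon>' where "\<epsilon>' = \<epsilon> / 6"
  have e': "0 < \<epsilon>'" using e by (simp add: \<epsilon>'_def)
  \<comment> \<open>A point found in a smaller ball serves as well, so the radius may shrink until
    |p| - \<delta>' \<ge> |p| exp (- \<epsilon>').\<close>
  define \<delta>' where "\<delta>' = min \<delta> (cmod p * (1 - exp (- \<epsilon>')))"
  have d': "0 < \<delta>'" "\<delta>' \<le> \<delta>" "\<delta>' < cmod p" and pd: "cmod p * exp (- \<epsilon>') \<le> cmod p - \<delta>'"
    using p d e' by (auto simp: \<delta>'_def algebra_simps min_less_iff_disj)
  have d1: "\<delta>' < 1" using d'(3) p by simp
  have lnd: "0 < ln (4 / \<delta>')" using d' d1 by simp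
  \<comment> \<open>The three constraints keep the block above s n / 2, where the weight bound
    applies, make its indices lose at most \<epsilon>' n in \<alpha> k, and pay for
    \<open>(4 / \<delta>') ^ m\<close>.\<close>
  define \<theta> where "\<theta> = min (s / 4) (min (\<epsilon>' / (2 * \<alpha>)) (\<epsilon>' / ln (4 / \<delta>')))"
  have th: "0 < \<theta>" "\<theta> \<le> s / 4" "2 * \<alpha> * \<theta> \<le> \<epsilon>'" "\<theta> * ln (4 / \<delta>') \<le> \<epsilon>'"
  proof -
    show "0 < \<theta>" using s e' a lnd by (simp add: \<theta>_def)
    show "\<theta> \<le> s / 4" unfolding \<theta>_def by (rule min.cobounded1)
    have "\<theta> \<le> \<epsilon>' / (2 * \<alpha>)" "\<theta> \<le> \<epsilon>' / ln (4 / \<delta>')" by (auto simp: \<theta>_def)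
    then show "2 * \<alpha> * \<theta> \<le> \<epsilon>'" "\<theta> * ln (4 / \<delta>') \<le> \<epsilon>'" using a lnd by (auto simp: field_simps)
  qed
  define cn where "cn n = exp \<beta> * real n powr \<alpha>" for n :: nat
  define \<eta> where "\<eta> n = exp (real n * (\<alpha> * s - \<epsilon>))" for n :: nat
  define E where "E n = {\<omega> \<in> space M. \<forall>z\<in>ball p \<delta>'.
      cmod (\<Sum>k\<le>n. \<xi> k \<omega> * (w k * of_real (cn n) ^ k) * z ^ k) \<le> \<eta> n}" for n
  have "(\<lambda>n. 2 * (real n + 1) * exp (- 2 * \<epsilon>' * real n)) \<longlonglongrightarrow> 0"
    using e' by real_asymp
  then have ev1: "\<forall>\<^sub>F n in sequentially. 2 * (real n + 1) * exp (- 2 * \<epsilon>' * real n) < \<rho>"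
    using \<rho>(1) by (rule order_tendstoD)
  have "filterlim (\<lambda>n. \<theta> * real n) at_top sequentially"
    by (rule filterlim_tendsto_pos_mult_at_top[OF tendsto_const _ filterlim_real_sequentially]) (use th in auto)
  then have ev2: "\<forall>\<^sub>F n in sequentially. 1 \<le> \<theta> * real n"
    unfolding filterlim_at_top by blast
  have ev3: "\<forall>\<^sub>F n in sequentially. \<forall>k. s / 2 * real n \<le> real k \<longrightarrow> real k \<le> s * real n \<longrightarrow>
    exp (\<alpha> * real k - \<epsilon>' / s * s * real n) \<le> cmod (w k) * (exp \<beta> * real n powr \<alpha>) ^ k * (s powr \<alpha>) ^ k"
    using weight_lower_bound[OF asy a w s(1), of "\<epsilon>' / s"] e' s by simp
  have "\<forall>\<^sub>F n in sequentially. E n \<in> sets M \<and> measure M (E n) \<le> (c powr \<theta>) ^ n"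
    using ev1 ev2 ev3 eventually_ge_at_top[of 1]
  proof eventually_elim
    case (elim n)
    define k1 where "k1 = nat \<lfloor>s * real n\<rfloor>"
    define m where "m = nat \<lfloor>\<theta> * real n\<rfloor>"
    define k0 where "k0 = k1 - m"
    have n: "0 < real n" using elim by simp
    have cn: "0 < cn n" using n by (simp add: cn_def)
    have k1: "real k1 \<le> s * real n" "s * real n - 1 \<le> real k1"
      using nat_floor_bounds[of "s * real n"] s n unfolding k1_def by auto
    have m: "real m \<le> \<theta> * real n" "\<theta> * real n - 1 \<le> real m"
      using nat_floor_bounds[of "\<theta> * real n"] th n unfolding m_def by auto
    have tn: "\<theta> * real n \<le> s / 4 * real n" using th n by (intro mult_right_mono) auto
    have "real m \<le> real k1" using k1 m tn elim(2) by linarith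
    then have mk: "k0 + m = k1" and k0: "real k0 = real k1 - real m"
      by (auto simp: k0_def)
    have "s * real n < real n" using s n by simp
    then have k1n: "k1 \<le> n" using k1 by linarith
    have "m \<le> k1" "m \<le> n" using mk k1n by auto
    have key: "2 * \<eta> n / (cmod p - \<delta>') ^ k0 * (real m + 1) * (4 / \<delta>') ^ m
        \<le> \<rho> * cmod (w k * of_real (cn n) ^ k) \<and> w k * of_real (cn n) ^ k \<noteq> 0"
      if k: "k \<in> {k0..k0 + m}" for k
    proof
      \<comment> \<open>The two floors together with the block length cost at most \<theta> n + 1,
        and 1 \<le> \<theta> n turns this into 2 \<theta> n.\<close>
      have k2: "real k \<le> s * real n" "(s - 2 * \<theta>) * real n \<le> real k"
        using k k0 k1 m mk elim(2) by (auto simp: algebra_simps)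
      have "s / 2 * real n \<le> (s - 2 * \<theta>) * real n"
        using th n by (intro mult_right_mono) auto
      then have k3: "s / 2 * real n \<le> real k" using k2 by simp
      moreover have "0 < s * real n" using s n by simp
      ultimately have "k \<noteq> 0" by (intro notI) simp
      then have "w k \<noteq> 0" using w by simp
      then show "w k * of_real (cn n) ^ k \<noteq> 0" using cn by simp
      define b where "b = cmod (w k) * cn n ^ k"
      have b: "exp (\<alpha> * real k - \<epsilon>' * real n) \<le> b * cmod p ^ k"
        using elim(3) k3 k2(1) s unfolding b_def sa cn_def by auto
      have b0: "0 < b" using \<open>w k \<noteq> 0\<close> cn by (simp add: b_def)
      have p0: "0 < cmod p" using p by simp
      have "cmod p ^ k \<le> cmod p ^ k0"
        using k p by (intro power_decreasing) auto
      also have "\<dots> = (cmod p * exp (- \<epsilon>')) ^ k0 * exp (\<epsilon>' * real k0)"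
        by (simp add: power_mult_distrib flip: exp_of_nat2_mult exp_add)
      also have "\<dots> \<le> (cmod p - \<delta>') ^ k0 * exp (\<epsilon>' * real n)"
        using pd p0 e' d' k1n mk by (intro mult_mono power_mono) auto
      finally have A1: "cmod p ^ k \<le> (cmod p - \<delta>') ^ k0 * exp (\<epsilon>' * real n)" .
      have "(4 / \<delta>') ^ m = exp (real m * ln (4 / \<delta>'))"
        using d' by (simp add: exp_of_nat_mult)
      also have "\<dots> \<le> exp (\<epsilon>' * real n)"
      proof -
        have "real m * ln (4 / \<delta>') \<le> \<theta> * real n * ln (4 / \<delta>')"
          using m lnd by (intro mult_right_mono) auto
        also have "\<dots> \<le> \<epsilon>' * real n"
          using mult_right_mono[OF th(4), of "real n"] by (simp add: mult.assoc mult.commute mult.left_commute)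
        finally show ?thesis by simp
      qed
      finally have A2: "(4 / \<delta>') ^ m \<le> exp (\<epsilon>' * real n)" .
      have "2 * \<alpha> * \<theta> * real n \<le> \<epsilon>' * real n" using th n by (intro mult_right_mono) auto
      moreover have "\<alpha> * ((s - 2 * \<theta>) * real n) \<le> \<alpha> * real k" using k2 a by (intro mult_left_mono) auto
      ultimately have "\<alpha> * s * real n - 2 * \<epsilon>' * real n \<le> \<alpha> * real k - \<epsilon>' * real n"
        by (simp add: algebra_simps)
      then have "exp (\<alpha> * s * real n - 2 * \<epsilon>' * real n) \<le> b * ((cmod p - \<delta>') ^ k0 * exp (\<epsilon>' * real n))"
        using b A1 b0 by (smt (verit) exp_le_cancel_iff mult_left_mono)
      moreover have "exp (\<alpha> * s * real n - 2 * \<epsilon>' * real n) = exp (\<alpha> * s * real n - 3 * \<epsilon>' * real n) * exp (\<epsilon>' * real n)"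
        by (simp add: algebra_simps flip: exp_add)
      ultimately have A3: "exp (\<alpha> * s * real n - 3 * \<epsilon>' * real n) \<le> b * (cmod p - \<delta>') ^ k0"
        by (simp add: mult.assoc[symmetric])
      have "2 * \<eta> n * (real m + 1) * (4 / \<delta>') ^ m \<le> 2 * \<eta> n * (real n + 1) * exp (\<epsilon>' * real n)"
        using A2 \<open>m \<le> n\<close> d' by (intro mult_mono) (auto simp: \<eta>_def)
      also have "\<dots> = 2 * (real n + 1) * exp (- 2 * \<epsilon>' * real n) * exp (\<alpha> * s * real n - 3 * \<epsilon>' * real n)"
      proof -
        have "\<eta> n * exp (\<epsilon>' * real n) = exp (- 2 * \<epsilon>' * real n) * exp (\<alpha> * s * real n - 3 * \<epsilon>' * real n)"
          by (simp add: \<eta>_def \<epsilon>'_def algebra_simps flip: exp_add)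
        then have "2 * (real n + 1) * (\<eta> n * exp (\<epsilon>' * real n)) = 2 * (real n + 1) * (exp (- 2 * \<epsilon>' * real n) * exp (\<alpha> * s * real n - 3 * \<epsilon>' * real n))"
          by (rule arg_cong)
        then show ?thesis by (simp only: mult_ac)
      qed
      also have "\<dots> \<le> \<rho> * (b * (cmod p - \<delta>') ^ k0)"
        using elim(1) A3 \<rho> by (intro mult_mono) auto
      finally have "2 * \<eta> n * (real m + 1) * (4 / \<delta>') ^ m \<le> \<rho> * b * (cmod p - \<delta>') ^ k0" by (simp add: mult.assoc)
      moreover have "0 < (cmod p - \<delta>') ^ k0" using d' by simp
      moreover have "cmod (w k * of_real (cn n) ^ k) = b" using cn by (simp add: b_def norm_mult norm_power)
      ultimately show "2 * \<eta> n / (cmod p - \<delta>') ^ k0 * (real m + 1) * (4 / \<delta>') ^ m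
        \<le> \<rho> * cmod (w k * of_real (cn n) ^ k)"
        by (simp only: times_divide_eq_left pos_divide_le_eq)
    qed
    have km: "k0 + m \<le> n" using mk k1n by simp
    note pr = prob_small_on_ball[OF iid conc[unfolded N_def] km d'(1,3) _ key]
    have "E n \<in> sets M" unfolding E_def by (rule pr(1)) (use p in auto)
    have "emeasure M (E n) \<le> ennreal (c ^ (m + 1))"
      unfolding E_def by (rule pr(2)) (use p in auto)
    then have "measure M (E n) \<le> c ^ (m + 1)"
      using c by (simp add: emeasure_eq_measure)
    also have "\<dots> = c powr real (m + 1)"
      using c by (simp only: powr_realpow)
    \<comment> \<open>The block has one index more than \<open>m\<close>, which exactly compensates
      the floor: m + 1 \<ge> \<theta> n.\<close>
    also have "\<dots> \<le> c powr (\<theta> * real n)"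
      using m c by (intro powr_mono') auto
    also have "\<dots> = (c powr \<theta>) ^ n"
      using c by (simp add: powr_powr flip: powr_realpow)
    finally show ?case using \<open>E n \<in> sets M\<close> by simp
  qed
  then obtain n0 where n0: "\<And>n. n \<ge> n0 \<Longrightarrow> E n \<in> sets M \<and> measure M (E n) \<le> (c powr \<theta>) ^ n"
    by (auto simp: eventually_sequentially)
  \<comment> \<open>Measurability and the probability bound hold only from \<open>n0\<close> on;
    earlier events are emptied so that Borel-Cantelli applies to the whole sequence.\<close>
  define E' where "E' n = (if n \<ge> n0 then E n else {})" for n
  have "AE \<omega> in M. \<forall>\<^sub>F n in sequentially. \<omega> \<in> space M - E' n"
  proof (rule borel_cantelli_AE1)
    show "E' n \<in> sets M" for n using n0 by (auto simp: E'_def)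
    show "emeasure M (E' n) < \<infinity>" for n by (simp add: emeasure_eq_measure)
    have "c powr \<theta> < 1" using c th powr01_less_one[of c \<theta>] by simp
    then have "summable (\<lambda>n. (c powr \<theta>) ^ n)" by (intro summable_geometric) simp
    then show "summable (\<lambda>n. measure M (E' n))"
      by (rule summable_comparison_test[rotated]) (use n0 in \<open>auto simp: E'_def intro!: exI[of _ n0]\<close>)
  qed
  then show ?thesis
  proof (rule AE_mp, intro AE_I2 impI)
    fix \<omega> assume "\<omega> \<in> space M" "\<forall>\<^sub>F n in sequentially. \<omega> \<in> space M - E' n"
    from this(2) eventually_ge_at_top[of n0]
    show "\<forall>\<^sub>F n in sequentially. \<exists>z\<in>ball p \<delta>.
      exp (real n * (\<alpha> * cmod p powr (1 / \<alpha>) - \<epsilon>))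
        < cmod (\<Sum>k\<le>n. \<xi> k \<omega> * w k * (complex_of_real (exp \<beta> * real n powr \<alpha>) * z) ^ k)"
    proof eventually_elim
      case (elim n)
      then obtain z where z: "z \<in> ball p \<delta>'"
        "\<eta> n < cmod (\<Sum>k\<le>n. \<xi> k \<omega> * (w k * of_real (cn n) ^ k) * z ^ k)"
        by (auto simp: E'_def E_def not_le)
      show ?case
        by (rule bexI[of _ z])
           (use z d' in \<open>auto simp: \<eta>_def s_def cn_def power_mult_distrib mult_ac\<close>)
    qed
  qed
qed

section \<open>Growth of the coefficients under a finite log-moment\<close>

text \<open>All \<open>\<xi> n\<close> have the law \<open>N\<close>, so the sum of the exceedance
  probabilities is the \<open>N\<close>-integral of the number of \<open>n\<close> with \<epsilon> n
  \<le> ln (1 + |x|). That number is at most 1 + ln (1 + |x|) / \<epsilon>, where the 1 counts n =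
  0.\<close>

lemma (in prob_space) AE_growth:
  fixes \<xi> :: "nat \<Rightarrow> 'a \<Rightarrow> complex"
  assumes iid: "iid_complex \<xi>" and fin: "(\<integral>\<^sup>+ \<omega>. ennreal (ln (1 + cmod (\<xi> 0 \<omega>))) \<partial>M) < \<infinity>"
    and e: "0 < \<epsilon>"
  shows "AE \<omega> in M. \<forall>\<^sub>F n in sequentially. ln (1 + cmod (\<xi> n \<omega>)) < \<epsilon> * real n"
proof -
  define N where "N = distr M borel (\<xi> 0)"
  have distr: "distr M borel (\<xi> i) = N" for i
    using iid by (auto simp: iid_complex_def N_def)
  have [measurable]: "\<xi> i \<in> borel_measurable M" for i
    using iid by (simp add: iid_complex_def indep_vars_def)
  interpret N: prob_space N by (auto simp: N_def intro!: prob_space_distr)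
  have [measurable_cong]: "sets N = sets borel" by (simp add: N_def)
  define A where "A n = {x. \<epsilon> * real n \<le> ln (1 + cmod x)}" for n :: nat
  have [measurable]: "A n \<in> sets borel" for n unfolding A_def by measurable
  have "(\<Sum>n. emeasure N (A n)) = (\<integral>\<^sup>+ x. (\<Sum>n. indicator (A n) x) \<partial>N)"
    by (subst nn_integral_suminf) auto
  also have "\<dots> \<le> (\<integral>\<^sup>+ x. 1 + ennreal (1 / \<epsilon>) * ennreal (ln (1 + cmod x)) \<partial>N)"
  proof (rule nn_integral_mono)
    fix x
    define K where "K = nat \<lfloor>ln (1 + cmod x) / \<epsilon>\<rfloor>"
    have AK: "x \<in> A n \<longleftrightarrow> n \<le> K" for n
    proof -
      have "x \<in> A n \<longleftrightarrow> real n \<le> ln (1 + cmod x) / \<epsilon>"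
        using e by (simp add: A_def field_simps)
      also have "\<dots> \<longleftrightarrow> int n \<le> \<lfloor>ln (1 + cmod x) / \<epsilon>\<rfloor>"
        by (simp add: le_floor_iff)
      also have "\<dots> \<longleftrightarrow> n \<le> K"
        using e by (simp add: K_def nat_le_iff le_nat_iff)
      finally show ?thesis .
    qed
    have "(\<Sum>n. indicator (A n) x) = (\<Sum>n\<le>K. 1 :: ennreal)"
      by (subst suminf_finite[of "{..K}"]) (auto simp: AK indicator_def)
    also have "\<dots> = ennreal (1 + real K)"
      by (simp add: ennreal_of_nat_eq_real_of_nat add.commute)
    also have "\<dots> \<le> ennreal (1 + 1 / \<epsilon> * ln (1 + cmod x))"
      using e by (intro ennreal_leI) (simp add: K_def)
    also have "\<dots> = 1 + ennreal (1 / \<epsilon>) * ennreal (ln (1 + cmod x))"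
      using e by (simp add: ennreal_plus ennreal_mult flip: ennreal_mult)
    finally show "(\<Sum>n. indicator (A n) x) \<le> 1 + ennreal (1 / \<epsilon>) * ennreal (ln (1 + cmod x))" .
  qed
  also have "\<dots> = 1 + ennreal (1 / \<epsilon>) * (\<integral>\<^sup>+ x. ennreal (ln (1 + cmod x)) \<partial>N)"
    by (subst nn_integral_add) (auto simp: nn_integral_cmult N.emeasure_space_1)
  also have "\<dots> < \<infinity>"
    using fin unfolding N_def by (subst nn_integral_distr) (auto simp: ennreal_mult_less_top)
  finally have fin': "(\<Sum>n. emeasure N (A n)) < \<infinity>" .
  have "AE \<omega> in M. \<forall>\<^sub>F n in sequentially. \<omega> \<in> space M - (\<xi> n -` A n \<inter> space M)"
  proof (rule borel_cantelli_AE1)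
    show "\<xi> n -` A n \<inter> space M \<in> sets M" for n by measurable
    show "emeasure M (\<xi> n -` A n \<inter> space M) < \<infinity>" for n by (simp add: emeasure_eq_measure)
    have eq: "measure M (\<xi> n -` A n \<inter> space M) = measure N (A n)" for n
      by (subst distr[of n, symmetric], subst measure_distr) auto
    have "summable (\<lambda>n. measure N (A n))"
      using fin' by (intro summable_suminf_not_top) (auto simp: N.emeasure_eq_measure)
    then show "summable (\<lambda>n. measure M (\<xi> n -` A n \<inter> space M))" unfolding eq .
  qed
  then show ?thesis
    by (rule AE_mp) (auto simp: A_def not_le elim!: eventually_mono intro!: AE_I2)
qed

section \<open>Infinite log-moment\<close>

text \<open>Counting in the other direction, ln (1 + |x|) is at most 1 + A times the number of
  \<open>n\<close> with \<open>x \<in> B n\<close>, so an infinite log-moment makes the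
  probabilities diverge. Independence and 1 - p \<le> exp (- p) then exclude that no exceedance
  occurs. A single \<open>n\<close> for each \<open>A\<close> is enough, because \<open>A\<close>
  can be raised afterwards to force \<open>n\<close> to be large.\<close>

lemma (in prob_space) AE_unbounded_growth:
  fixes \<xi> :: "nat \<Rightarrow> 'a \<Rightarrow> complex"
  assumes iid: "iid_complex \<xi>" and inf: "(\<integral>\<^sup>+ \<omega>. ennreal (ln (1 + cmod (\<xi> 0 \<omega>))) \<partial>M) = \<infinity>"
  shows "AE \<omega> in M. \<forall>A::nat. \<exists>n\<ge>1. real A * real n < ln (1 + cmod (\<xi> n \<omega>))"
proof -
  define N where "N = distr M borel (\<xi> 0)"
  have ind: "indep_vars (\<lambda>_. borel) \<xi> UNIV" and distr: "distr M borel (\<xi> i) = N" for i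
    using iid by (auto simp: iid_complex_def N_def)
  have [measurable]: "\<xi> i \<in> borel_measurable M" for i
    using ind by (simp add: indep_vars_def)
  interpret N: prob_space N by (auto simp: N_def intro!: prob_space_distr)
  have setsN[measurable_cong]: "sets N = sets borel" by (simp add: N_def)
  have "AE \<omega> in M. \<exists>n\<ge>1. real A * real n < ln (1 + cmod (\<xi> n \<omega>))" for A :: nat
  proof -
    define B where "B n = {x. real A * real n < ln (1 + cmod x)}" for n :: nat
    have B[measurable]: "B n \<in> sets borel" for n unfolding B_def by measurable
    have nsum: "\<not> summable (\<lambda>n. measure N (B n))"
    proof
      assume s: "summable (\<lambda>n. measure N (B n))"
      have "(\<integral>\<^sup>+ x. ennreal (ln (1 + cmod x)) \<partial>N) \<le> (\<integral>\<^sup>+ x. ennreal (1 + real A) * (\<Sum>n. indicator (B n) x) \<partial>N)"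
      proof (rule nn_integral_mono)
        fix x
        \<comment> \<open>The divisor is 1 + A instead of A because A may be 0.\<close>
        define K where "K = nat \<lceil>ln (1 + cmod x) / (1 + real A)\<rceil>"
        have inB: "x \<in> B n" if "n < K" for n
        proof -
          have "int n < \<lceil>ln (1 + cmod x) / (1 + real A)\<rceil>" using that by (simp add: K_def)
          then have "real n < ln (1 + cmod x) / (1 + real A)" by (simp add: less_ceiling_iff)
          then have "real n * (1 + real A) < ln (1 + cmod x)" by (simp add: field_simps)
          moreover have "real A * real n \<le> real n * (1 + real A)" by (simp add: algebra_simps)
          ultimately show ?thesis by (simp add: B_def)
        qed
        have "ln (1 + cmod x) / (1 + real A) \<le> real K" by (simp add: K_def real_nat_ceiling_ge)
        then have "ln (1 + cmod x) \<le> (1 + real A) * real K" by (simp add: field_simps)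
        then have "ennreal (ln (1 + cmod x)) \<le> ennreal (1 + real A) * ennreal (real K)"
          by (subst ennreal_mult[symmetric]) (auto intro: ennreal_leI)
        also have "ennreal (real K) = (\<Sum>n<K. indicator (B n) x)"
          by (simp add: inB ennreal_of_nat_eq_real_of_nat)
        also have "\<dots> \<le> (\<Sum>n. indicator (B n) x)"
          by (rule sum_le_suminf) auto
        finally show "ennreal (ln (1 + cmod x)) \<le> ennreal (1 + real A) * (\<Sum>n. indicator (B n) x)"
          by (simp add: mult_left_mono)
      qed
      also have "\<dots> = ennreal (1 + real A) * (\<Sum>n. emeasure N (B n))"
        by (subst nn_integral_cmult) (auto simp: nn_integral_suminf)
      also have "(\<Sum>n. emeasure N (B n)) = ennreal (\<Sum>n. measure N (B n))"
        using s by (simp add: N.emeasure_eq_measure suminf_ennreal2)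
      finally have "(\<integral>\<^sup>+ x. ennreal (ln (1 + cmod x)) \<partial>N) < \<infinity>"
        by (rule le_less_trans) (simp add: ennreal_mult_less_top)
      then show False
        using inf unfolding N_def by (subst (asm) nn_integral_distr) auto
    qed
    define G where "G = {\<omega> \<in> space M. \<forall>n\<ge>1. \<xi> n \<omega> \<notin> B n}"
    have [measurable]: "G \<in> sets M" unfolding G_def by measurable
    have "measure M G = 0"
    proof (rule ccontr)
      assume "measure M G \<noteq> 0"
      then have G: "0 < measure M G" by (simp add: zero_less_measure_iff)
      \<comment> \<open>Chosen so that exp (- K) is the measure of \<open>G\<close> divided by e,
        hence strictly smaller than it.\<close>
      define K where "K = 1 - ln (measure M G)"
      \<comment> \<open>The extra 1 pays for the index 0, about which \<open>G\<close> says
        nothing.\<close>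
      have "\<exists>m. K + 1 < (\<Sum>n<m. measure N (B n))"
      proof (rule ccontr)
        assume "\<not> ?thesis"
        then have "summable (\<lambda>n. measure N (B n))"
          by (intro summableI_nonneg_bounded[of _ "K + 1"]) (auto simp: not_less)
        then show False using nsum by simp
      qed
      then obtain m where m: "K + 1 < (\<Sum>n<m. measure N (B n))" ..
      have "(\<Sum>n<m. measure N (B n)) \<le> (\<Sum>n\<in>insert 0 {1..m}. measure N (B n))"
        by (rule sum_mono2) auto
      also have "\<dots> \<le> 1 + (\<Sum>n\<in>{1..m}. measure N (B n))"
        by simp
      finally have m': "K < (\<Sum>n\<in>{1..m}. measure N (B n))" using m by simp
      have "measure M G \<le> exp (- K)"
      proof (cases "m = 0")
        case False
        have "measure M G \<le> measure M (\<Inter>n\<in>{1..m}. \<xi> n -` (UNIV - B n) \<inter> space M)"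
          using False by (intro finite_measure_mono sets.countable_INT') (auto simp: G_def)
        also have "\<dots> = (\<Prod>n\<in>{1..m}. measure M (\<xi> n -` (UNIV - B n) \<inter> space M))"
          using False by (intro indep_varsD[OF ind]) auto
        also have "\<dots> = (\<Prod>n\<in>{1..m}. 1 - measure N (B n))"
        proof (rule prod.cong)
          fix n
          have "measure M (\<xi> n -` (UNIV - B n) \<inter> space M) = measure N (space N - B n)"
            by (subst (1) distr[of n, symmetric], subst measure_distr)
               (auto simp: setsN sets_eq_imp_space_eq[OF setsN])
          also have "\<dots> = 1 - measure N (B n)" by (rule N.prob_compl) (simp add: setsN)
          finally show "measure M (\<xi> n -` (UNIV - B n) \<inter> space M) = 1 - measure N (B n)" .
        qed simp
        also have "\<dots> \<le> (\<Prod>n\<in>{1..m}. exp (- measure N (B n)))"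
          by (intro prod_mono) (use exp_ge_add_one_self[of "- measure N (B _)"] in auto)
        also have "\<dots> = exp (- (\<Sum>n\<in>{1..m}. measure N (B n)))"
          by (simp add: exp_sum flip: sum_negf)
        also have "\<dots> \<le> exp (- K)" using m' by simp
        finally show ?thesis .
      qed (use m' in \<open>auto intro: order.trans[OF prob_le_1]\<close>)
      also have "\<dots> = measure M G * exp (- 1)"
        using G by (simp add: K_def exp_diff exp_minus field_simps)
      also have "\<dots> < measure M G * 1"
        using G by (intro mult_strict_left_mono) auto
      finally show False by simp
    qed
    then have "AE \<omega> in M. \<omega> \<notin> G" by (intro AE_not_in) (auto simp: null_sets_def emeasure_eq_measure)
    then show ?thesis
      by (rule AE_mp) (auto simp: G_def B_def intro!: AE_I2)
  qed
  then show ?thesis by (simp add: AE_all_countable)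
qed

text \<open>\<open>y n\<close> is the normalised logarithmic size of \<open>x n\<close>. At the
  first \<open>n\<close> with \<open>y n\<close> above the level \<open>A\<close>, all earlier
  coefficients satisfy |x k| \<le> D R^k with R = exp (y n), while |x n| \<ge> R^n / 2. Combined
  with |w k| \<le> C |w n| c^(n - k), the lower terms are dominated by a geometric series in q = R
  |z| / c, and q - 1 > 2 D C makes their sum smaller than the leading term.\<close>

lemma record_dominates:
  fixes x w :: "nat \<Rightarrow> complex"
  assumes unb: "\<forall>A::nat. \<exists>n\<ge>1. real A * real n < ln (1 + cmod (x n))"
    and C: "0 < C" and w: "\<forall>n\<ge>1. w n \<noteq> 0"
    and ratio: "\<forall>n\<ge>1. \<forall>k\<le>n. cmod (w (n - k) / w n) < C * exp (\<beta> * real k) * real n powr (\<alpha> * real k)"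
  shows "\<exists>n\<ge>N. \<forall>z. exp \<beta> * real n powr \<alpha> / 2 \<le> cmod z \<longrightarrow> (\<Sum>k\<le>n. x k * w k * z ^ k) \<noteq> 0"
proof -
  define y where "y n = ln (1 + cmod (x n)) / real n" for n
  \<comment> \<open>Division by zero gives \<open>y 0 = 0\<close>, so \<open>y\<close> carries no
    information about \<open>x 0\<close>; this factor accounts for it.\<close>
  define D where "D = 1 + cmod (x 0)"
  have D: "1 \<le> D" by (simp add: D_def)
  \<comment> \<open>The sum exceeds every \<open>y k\<close> with k \<le> N and so forces n > N. The
    logarithm forces R > 4 D C + 4, hence q > 2 D C + 1 even at |z| = c / 2.\<close>
  define A where "A = nat \<lceil>(\<Sum>k\<le>N. \<bar>y k\<bar>) + ln (4 * D * C + 4)\<rceil>"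
  have A: "(\<Sum>k\<le>N. \<bar>y k\<bar>) + ln (4 * D * C + 4) \<le> real A"
    unfolding A_def by (rule real_nat_ceiling_ge)
  have DC: "0 < D * C" using D C by simp
  have lnDC: "0 < ln (4 * D * C + 4)" using DC by (simp add: mult.assoc)
  have sumpos: "0 \<le> (\<Sum>k\<le>N. \<bar>y k\<bar>)" by (intro sum_nonneg) auto
  define n where "n = (LEAST n. 1 \<le> n \<and> real A < y n)"
  have "\<exists>n. 1 \<le> n \<and> real A < y n"
    using unb[rule_format, of A] by (auto simp: y_def field_simps)
  then have n: "1 \<le> n" "real A < y n"
    unfolding n_def using LeastI_ex[of "\<lambda>n. 1 \<le> n \<and> real A < y n"] by auto
  have least: "y k \<le> real A" if "1 \<le> k" "k < n" for k
    using not_less_Least[of k "\<lambda>n. 1 \<le> n \<and> real A < y n"] that unfolding n_def by auto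
  have nN: "N < n"
  proof (rule ccontr)
    assume "\<not> N < n"
    then have "\<bar>y n\<bar> \<le> (\<Sum>k\<le>N. \<bar>y k\<bar>)" by (intro member_le_sum) auto
    then show False using n A lnDC by linarith
  qed
  define R where "R = exp (y n)"
  have "ln (4 * D * C + 4) < y n" using n A sumpos by linarith
  then have R: "4 * D * C + 4 < R"
  proof -
    have "exp (ln (4 * D * C + 4)) < R" unfolding R_def using \<open>ln (4 * D * C + 4) < y n\<close> by simp
    then show ?thesis using DC by (simp add: mult.assoc)
  qed
  then have R4: "4 < R" using DC by (simp add: mult.assoc)
  have powR: "1 + cmod (x k) = exp (y k) ^ k" if "1 \<le> k" for k
  proof -
    have "exp (y k) ^ k = exp (real k * y k)" by (simp add: exp_of_nat_mult)
    also have "real k * y k = ln (1 + cmod (x k))" using that by (simp add: y_def)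
    also have "exp \<dots> = 1 + cmod (x k)" by (simp add: add_pos_nonneg)
    finally show ?thesis by simp
  qed
  have xk: "cmod (x k) \<le> D * R ^ k" if k: "k < n" for k
  proof (cases "k = 0")
    case False
    have "1 + cmod (x k) = exp (y k) ^ k" using False by (intro powR) simp
    also have "\<dots> \<le> R ^ k" using least[of k] False k n unfolding R_def by (intro power_mono) auto
    also have "\<dots> \<le> D * R ^ k" using D R4 by simp
    finally show ?thesis by simp
  qed (simp add: D_def)
  \<comment> \<open>Since 1 + |x n| = R^n, this absorbs the 1 at the price of a factor 2.\<close>
  have "2 \<le> R ^ n" using self_le_power[of R n] R4 n by simp
  then have xn: "R ^ n / 2 \<le> cmod (x n)"
    using powR[OF n(1)] unfolding R_def[symmetric] by simp
  define c where "c = exp \<beta> * real n powr \<alpha>"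
  have c: "0 < c" using n by (simp add: c_def)
  have wk: "cmod (w k) \<le> C * cmod (w n) * c ^ (n - k)" if k: "k \<le> n" for k
  proof -
    have "cmod (w (n - (n - k)) / w n) < C * exp (\<beta> * real (n - k)) * real n powr (\<alpha> * real (n - k))"
      using ratio n by simp
    also have "\<dots> = C * c ^ (n - k)"
      using n by (simp add: c_def power_mult_distrib exp_of_nat2_mult powr_power flip: powr_powr powr_realpow)
    finally show ?thesis using k w n by (simp add: norm_divide field_simps)
  qed
  have wn: "0 < cmod (w n)" using w n by simp
  show ?thesis
  proof (intro exI[of _ n] conjI allI impI notI)
    show "N \<le> n" using nN by simp
    fix z assume z: "exp \<beta> * real n powr \<alpha> / 2 \<le> cmod z" and eq: "(\<Sum>k\<le>n. x k * w k * z ^ k) = 0"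
    define t where "t = cmod z / c"
    have t: "1 / 2 \<le> t" and zt: "cmod z = c * t" using z c by (auto simp: t_def c_def field_simps)
    define q where "q = R * t"
    have q: "2 * (D * C) + 1 < q"
    proof -
      have "R * (1 / 2) \<le> q" unfolding q_def using t R4 by (intro mult_left_mono) auto
      then show ?thesis using R by simp
    qed
    have q1: "1 < q" using q DC by simp
    have "x n * w n * z ^ n = - (\<Sum>k<n. x k * w k * z ^ k)"
      using eq by (simp add: lessThan_Suc_atMost[symmetric] eq_neg_iff_add_eq_0 add.commute)
    then have "cmod (x n) * cmod (w n) * cmod z ^ n = cmod (\<Sum>k<n. x k * w k * z ^ k)"
      by (metis norm_minus_cancel norm_mult norm_power)
    also have "\<dots> \<le> (\<Sum>k<n. cmod (w n) * c ^ n * (D * C) * q ^ k)"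
    proof (rule sum_norm_le)
      fix k assume k: "k \<in> {..<n}"
      have "cmod (x k * w k * z ^ k) = cmod (x k) * cmod (w k) * cmod z ^ k" by (simp add: norm_mult norm_power)
      also have "\<dots> \<le> (D * R ^ k) * (C * cmod (w n) * c ^ (n - k)) * (c * t) ^ k"
        unfolding zt using k xk wk R4 c t D C by (intro mult_mono mult_nonneg_nonneg) auto
      also have "\<dots> = cmod (w n) * (c ^ (n - k) * c ^ k) * (D * C) * q ^ k"
        by (simp add: q_def power_mult_distrib)
      also have "c ^ (n - k) * c ^ k = c ^ n" using k by (simp flip: power_add)
      finally show "cmod (x k * w k * z ^ k) \<le> cmod (w n) * c ^ n * (D * C) * q ^ k" .
    qed
    also have "\<dots> = cmod (w n) * c ^ n * (D * C) * ((q ^ n - 1) / (q - 1))"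
      using q1 by (simp add: geometric_sum flip: sum_distrib_left)
    also have "\<dots> < cmod (w n) * c ^ n * (q ^ n / 2)"
    proof -
      have "D * C * (q ^ n - 1) \<le> D * C * q ^ n" by (rule mult_left_mono) (use DC in auto)
      also have "\<dots> < (q - 1) / 2 * q ^ n" using q q1 by (intro mult_strict_right_mono) auto
      finally have A: "D * C * ((q ^ n - 1) / (q - 1)) < q ^ n / 2" using q1 by (simp add: field_simps)
      have "0 < cmod (w n) * c ^ n" using wn c by simp
      from mult_strict_left_mono[OF A this] show ?thesis by (simp only: mult.assoc)
    qed
    also have "\<dots> = R ^ n / 2 * cmod (w n) * cmod z ^ n"
      by (simp add: zt q_def power_mult_distrib)
    also have "\<dots> \<le> cmod (x n) * cmod (w n) * cmod z ^ n"
      using xn by (intro mult_right_mono) auto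
    finally show False by simp
  qed
qed

section \<open>Radial measures and their logarithmic potentials\<close>

lemma emeasure_lborel_ball_complex:
  fixes a :: complex
  assumes "0 \<le> r" shows "emeasure lborel (ball a r) = ennreal (pi * r\<^sup>2)"
  using assms unit_ball_vol_even[of 1] by (simp add: emeasure_ball)

lemma emeasure_lborel_cball_complex:
  fixes a :: complex
  assumes "0 \<le> r" shows "emeasure lborel (cball a r) = ennreal (pi * r\<^sup>2)"
  using assms unit_ball_vol_even[of 1] by (simp add: emeasure_cball)

text \<open>Boxes correspond to boxes of the same area. Through this identification, facts about
  orthogonal maps of \<open>real ^ 2\<close> become available for multiplication by unit complex
  numbers.\<close>

lemma distr_lborel_Complex:
  "distr (lborel :: (real ^ 2) measure) borel (\<lambda>v. Complex (v $ 1) (v $ 2)) = lborel"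
proof (rule lborel_eqI[symmetric])
  fix l u :: complex assume lu: "\<And>b. b \<in> Basis \<Longrightarrow> l \<bullet> b \<le> u \<bullet> b"
  have meas: "(\<lambda>v :: real ^ 2. Complex (v $ 1) (v $ 2)) \<in> borel_measurable borel"
    unfolding Complex_eq by (intro borel_measurable_continuous_onI continuous_intros)
  have pre: "(\<lambda>v :: real ^ 2. Complex (v $ 1) (v $ 2)) -` box l u = box (vector [Re l, Im l]) (vector [Re u, Im u])"
    by (auto simp: in_box_complex_iff mem_box_cart forall_2)
  have le: "Re l \<le> Re u" "Im l \<le> Im u" using lu[of 1] lu[of \<i>] by (auto simp: Basis_complex_def)
  have Basis: "Basis = {axis 1 1, axis 2 1 :: real ^ 2}"
    by (auto simp: Basis_vec_def UNIV_2)
  have ne: "axis 1 1 \<noteq> (axis 2 1 :: real ^ 2)"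
    by (simp add: axis_eq_axis)
  have "emeasure lborel (box (vector [Re l, Im l]) (vector [Re u, Im u] :: real ^ 2)) = ennreal ((Re u - Re l) * (Im u - Im l))"
    using le by (subst emeasure_lborel_box) (auto simp: Basis ne inner_axis)
  then show "emeasure (distr lborel borel (\<lambda>v :: real ^ 2. Complex (v $ 1) (v $ 2))) (box l u) = ennreal (prod ((\<bullet>) (u - l)) Basis)"
    using meas by (subst emeasure_distr) (auto simp: pre Basis_complex_def)
qed simp

text \<open>The preimage of a set under multiplication by \<open>u\<close> is its image under
  multiplication by \<open>cnj u\<close>, which in real coordinates is the orthogonal map
  \<open>g\<close>. It suffices to check boxes; being bounded, they have finite measure, as the
  transformation rule requires.\<close>

lemma distr_lborel_rotation:
  fixes u :: complex
  assumes u: "cmod u = 1"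
  shows "distr lborel borel (\<lambda>z. u * z) = lborel"
proof (rule lborel_eqI[symmetric])
  define \<phi> where "\<phi> = (\<lambda>v :: real ^ 2. Complex (v $ 1) (v $ 2))"
  define \<psi> where "\<psi> = (\<lambda>z. vector [Re z, Im z] :: real ^ 2)"
  have inv: "\<phi> (\<psi> z) = z" "\<psi> (\<phi> v) = v" for z v
    by (auto simp: \<phi>_def \<psi>_def vec_eq_iff forall_2)
  have meas[measurable]: "\<phi> \<in> borel_measurable borel"
    unfolding \<phi>_def Complex_eq by (intro borel_measurable_continuous_onI continuous_intros)
  have norm\<phi>: "norm v = cmod (\<phi> v)" for v
    by (simp add: \<phi>_def norm_vec_def L2_set_def sum_2 cmod_def)
  define g where "g v = \<psi> (cnj u * \<phi> v)" for v
  have "linear g"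
    by (rule linearI) (auto simp: g_def \<psi>_def \<phi>_def vec_eq_iff forall_2 algebra_simps)
  moreover have "norm (g v) = norm v" for v
    using u by (simp add: norm\<phi> g_def inv norm_mult)
  ultimately have g: "orthogonal_transformation g"
    by (simp add: orthogonal_transformation)
  have uu: "u * cnj u = 1"
    using u by (simp add: complex_mult_cnj cmod_def complex_eq_iff power2_eq_square)
  have lb: "emeasure lborel B = emeasure lborel (\<phi> -` B)" if "B \<in> sets borel" for B
    using emeasure_distr[OF meas[folded measurable_lborel2], of B] that
    by (simp add: distr_lborel_Complex[folded \<phi>_def])
  fix l r :: complex assume lr: "\<And>b. b \<in> Basis \<Longrightarrow> l \<bullet> b \<le> r \<bullet> b"
  define B where "B = box l r"
  have B[measurable]: "B \<in> sets borel" by (simp add: B_def)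
  have rotB: "(\<lambda>z. u * z) -` B \<in> sets borel"
    by (rule measurable_sets_borel[OF _ B]) measurable
  have img: "\<phi> -` ((\<lambda>z. u * z) -` B) = g ` (\<phi> -` B)"
  proof (intro equalityI subsetI)
    fix v assume "v \<in> \<phi> -` ((\<lambda>z. u * z) -` B)"
    then show "v \<in> g ` (\<phi> -` B)"
      by (intro image_eqI[of _ _ "\<psi> (u * \<phi> v)"]) (auto simp: g_def inv mult.assoc[symmetric] uu mult.commute[of "cnj u"])
  next
    fix v assume "v \<in> g ` (\<phi> -` B)"
    then show "v \<in> \<phi> -` ((\<lambda>z. u * z) -` B)"
      by (auto simp: g_def inv mult.assoc[symmetric] uu)
  qed
  have "emeasure lborel (\<phi> -` B) < \<infinity>"
    using emeasure_bounded_finite[OF bounded_box, of l r] by (subst lb[symmetric]) (auto simp: B_def)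
  then have L: "\<phi> -` B \<in> lmeasurable"
    using measurable_sets_borel[OF meas B] by (intro fmeasurableI) auto
  have "emeasure (distr lborel borel (\<lambda>z. u * z)) B = emeasure lborel ((\<lambda>z. u * z) -` B)"
    by (subst emeasure_distr) auto
  also have "\<dots> = emeasure lebesgue (g ` (\<phi> -` B))"
    using measurable_sets_borel[OF meas rotB] by (simp add: lb[OF rotB] flip: img)
  also have "\<dots> = ennreal (measure lebesgue (\<phi> -` B))"
    using measurable_orthogonal_image[OF g L] measure_orthogonal_image[OF g L]
    by (simp add: emeasure_eq_measure2)
  also have "\<dots> = emeasure lebesgue (\<phi> -` B)"
    using L by (simp add: emeasure_eq_measure2)
  also have "\<dots> = emeasure lborel B"
    using measurable_sets_borel[OF meas B] by (simp add: lb[OF B])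
  also have "\<dots> = ennreal (prod ((\<bullet>) (r - l)) Basis)"
    unfolding B_def by (rule emeasure_lborel_box) (use lr in auto)
  finally show "emeasure (distr lborel borel (\<lambda>z. u * z)) (box l r) = ennreal (prod ((\<bullet>) (r - l)) Basis)"
    by (simp add: B_def)
qed simp

lemma distr_density_rotation:
  fixes g :: "real \<Rightarrow> ennreal" and u :: complex
  assumes [measurable]: "g \<in> borel_measurable borel" and u: "cmod u = 1"
  shows "distr (density lborel (\<lambda>z. g (cmod z))) borel (\<lambda>z. u * z) = density lborel (\<lambda>z. g (cmod z))"
proof -
  have "density (distr lborel borel (\<lambda>z. u * z)) (\<lambda>z. g (cmod z)) =
      distr (density lborel (\<lambda>z. g (cmod (u * z)))) borel (\<lambda>z. u * z)"
    by (rule density_distr) measurable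
  then show ?thesis
    using u by (simp add: distr_lborel_rotation norm_mult)
qed

text \<open>Polar coordinates for radial functions: the disc of radius \<open>x\<close> has area
  \<pi> x^2, with derivative 2 \<pi> x, and half-lines generate the Borel sets.\<close>

lemma distr_lborel_cmod:
  "distr (lborel :: complex measure) borel cmod = density lborel (\<lambda>r. ennreal (2 * pi * r) * indicator {0..} r)"
proof (rule measure_eqI_generator_eq[where E = "range (\<lambda>x. {..x})" and \<Omega> = UNIV and A = "\<lambda>i. {..real i}"])
  show "Int_stable (range (\<lambda>x::real. {..x}))"
    by (auto simp: Int_stable_def)
  have b: "sets borel = sigma_sets UNIV (range (\<lambda>x::real. {..x}))"
    unfolding borel_eq_atMost by (simp add: sets_measure_of)
  show "sets (distr (lborel :: complex measure) borel cmod) = sigma_sets UNIV (range (\<lambda>x. {..x}))"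
    "sets (density lborel (\<lambda>r. ennreal (2 * pi * r) * indicator {0..} r)) = sigma_sets UNIV (range (\<lambda>x. {..x}))"
    using b by simp_all
  have A: "emeasure (distr (lborel :: complex measure) borel cmod) {..x} = (if 0 \<le> x then ennreal (pi * x\<^sup>2) else 0)" for x
  proof -
    have "cmod -` {..x} = (if 0 \<le> x then cball 0 x else {})"
      by (auto simp: not_le) (meson dual_order.trans norm_ge_zero not_le)
    then show ?thesis
      by (simp add: emeasure_distr emeasure_lborel_cball_complex)
  qed
  show "(\<Union>i. {..real i}) = UNIV"
    using real_arch_simple by auto
  show "emeasure (distr (lborel :: complex measure) borel cmod) {..real i} \<noteq> \<infinity>" for i
    by (simp add: A)
  fix X assume "X \<in> range (\<lambda>x::real. {..x})"
  then obtain x where X: "X = {..x}" by auto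
  have "emeasure (density lborel (\<lambda>r. ennreal (2 * pi * r) * indicator {0..} r)) {..x} =
      (\<integral>\<^sup>+ r. ennreal (2 * pi * r) * indicator {0..x} r \<partial>lborel)"
    by (subst emeasure_density) (auto intro!: nn_integral_cong simp: indicator_def)
  also have "\<dots> = (if 0 \<le> x then ennreal (pi * x\<^sup>2) else 0)"
  proof (cases "0 \<le> x")
    case True
    have "(\<integral>\<^sup>+ r. ennreal (2 * pi * r) * indicator {0..x} r \<partial>lborel) = ennreal (pi * x\<^sup>2 - pi * 0\<^sup>2)"
      by (rule nn_integral_FTC_Icc) (use True in \<open>auto intro!: derivative_eq_intros\<close>)
    then show ?thesis using True by simp
  qed auto
  finally show "emeasure (distr (lborel :: complex measure) borel cmod) X =
      emeasure (density lborel (\<lambda>r. ennreal (2 * pi * r) * indicator {0..} r)) X"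
    by (simp add: A X)
qed auto

text \<open>The case \<open>\<gamma> = 2\<close> is, up to the factor \<open>\<pi>\<close>, Lebesgue measure on a disc.\<close>

definition radial_measure :: "real \<Rightarrow> real \<Rightarrow> complex measure" where
  "radial_measure \<gamma> R = density lborel (\<lambda>z. ennreal (\<gamma> / (2 * pi) * cmod z powr (\<gamma> - 2) * indicator {..<R} (cmod z)))"

lemma sets_radial_measure [simp, measurable_cong]: "sets (radial_measure \<gamma> R) = sets borel"
  by (simp add: radial_measure_def)

lemma space_radial_measure [simp]: "space (radial_measure \<gamma> R) = UNIV"
  by (simp add: radial_measure_def)

lemma radial_measure_rotation:
  assumes "cmod u = 1"
  shows "distr (radial_measure \<gamma> R) borel (\<lambda>z. u * z) = radial_measure \<gamma> R"
  unfolding radial_measure_def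
  by (rule distr_density_rotation[of "\<lambda>r. ennreal (\<gamma> / (2 * pi) * r powr (\<gamma> - 2) * indicator {..<R} r)"])
     (use assms in auto)

lemma distr_radial_measure:
  assumes g: "0 < \<gamma>"
  shows "distr (radial_measure \<gamma> R) borel cmod =
    density lborel (\<lambda>r. ennreal (\<gamma> * r powr (\<gamma> - 1) * indicator {0<..<R} r))"
proof -
  define h where "h r = ennreal (\<gamma> / (2 * pi) * r powr (\<gamma> - 2) * indicator {..<R} r)" for r :: real
  have [measurable]: "h \<in> borel_measurable borel" unfolding h_def by measurable
  have "distr (radial_measure \<gamma> R) borel cmod = density (distr lborel borel cmod) h"
    unfolding radial_measure_def h_def[symmetric] by (rule density_distr[symmetric]) auto
  also have "\<dots> = density lborel (\<lambda>r. ennreal (2 * pi * r) * indicator {0..} r * h r)"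
    unfolding distr_lborel_cmod by (rule density_density_eq) auto
  also have "\<dots> = density lborel (\<lambda>r. ennreal (\<gamma> * r powr (\<gamma> - 1) * indicator {0<..<R} r))"
  proof (intro density_cong AE_I2)
    fix r :: real
    have "2 * pi * r * (\<gamma> / (2 * pi) * r powr (\<gamma> - 2)) = \<gamma> * r powr (\<gamma> - 1)" if "0 < r"
      using that powr_mult_base[of r "\<gamma> - 2"] by (simp add: field_simps)
    then show "ennreal (2 * pi * r) * indicator {0..} r * h r = ennreal (\<gamma> * r powr (\<gamma> - 1) * indicator {0<..<R} r)"
      using g by (auto simp: h_def indicator_def simp flip: ennreal_mult)
  qed auto
  finally show ?thesis .
qed

lemma radial_measure_ball:
  assumes g: "0 < \<gamma>" and r: "0 \<le> r" "r \<le> R"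
  shows "emeasure (radial_measure \<gamma> R) {z. cmod z < r} = ennreal (r powr \<gamma>)"
proof -
  have "emeasure (radial_measure \<gamma> R) {z. cmod z < r} = emeasure (distr (radial_measure \<gamma> R) borel cmod) {..<r}"
    by (subst emeasure_distr) (auto simp: vimage_def)
  also have "\<dots> = (\<integral>\<^sup>+ x. ennreal (\<gamma> * x powr (\<gamma> - 1) * indicator {0<..<r} x) \<partial>lborel)"
    unfolding distr_radial_measure[OF g]
    by (subst emeasure_density) (use r in \<open>auto intro!: nn_integral_cong simp: indicator_def\<close>)
  also have "\<dots> = ennreal (r powr \<gamma>)"
  proof (rule nn_integral_has_integral_lborel)
    have "((\<lambda>x. \<gamma> * x powr (\<gamma> - 1)) has_integral \<gamma> * (r powr (\<gamma> - 1 + 1) / (\<gamma> - 1 + 1))) {0..r}"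
      using g r by (intro has_integral_mult_right has_integral_powr_from_0) auto
    then have "((\<lambda>x. \<gamma> * x powr (\<gamma> - 1)) has_integral r powr \<gamma>) {0<..<r}"
      using g by (simp add: has_integral_Icc_iff_Ioo)
    then show "((\<lambda>x. \<gamma> * x powr (\<gamma> - 1) * indicator {0<..<r} x) has_integral r powr \<gamma>) UNIV"
      by (subst (asm) has_integral_restrict_UNIV[symmetric]) (auto elim!: has_integral_eq[rotated] simp: indicator_def)
  qed (use g in auto)
  finally show ?thesis .
qed

lemma finite_radial_measure:
  assumes "0 < \<gamma>" "0 \<le> R"
  shows "finite_measure (radial_measure \<gamma> R)"
proof
  have "emeasure (radial_measure \<gamma> R) UNIV = emeasure (radial_measure \<gamma> R) {z. cmod z < R}"
    unfolding radial_measure_def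
    by (subst (1 2) emeasure_density) (auto intro!: nn_integral_cong simp: indicator_def)
  then show "emeasure (radial_measure \<gamma> R) (space (radial_measure \<gamma> R)) \<noteq> \<infinity>"
    using assms by (simp add: radial_measure_ball)
qed

section \<open>Integrals of the logarithm against radial measures\<close>

lemma integrable_powr_Ioo:
  fixes a c :: real
  assumes "- 1 < a" "0 \<le> c"
  shows "integrable lborel (\<lambda>x. x powr a * indicator {0<..<c} x)"
proof -
  have "((\<lambda>x. x powr a) has_integral c powr (a + 1) / (a + 1)) {0<..<c}"
    using has_integral_powr_from_0[OF assms] by (simp add: has_integral_Icc_iff_Ioo)
  then have "((\<lambda>x. x powr a * indicator {0<..<c} x) has_integral c powr (a + 1) / (a + 1)) UNIV"
    by (subst (asm) has_integral_restrict_UNIV[symmetric]) (auto elim!: has_integral_eq[rotated] simp: indicator_def)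
  then have "(\<integral>\<^sup>+ x. ennreal (x powr a * indicator {0<..<c} x) \<partial>lborel) = ennreal (c powr (a + 1) / (a + 1))"
    by (intro nn_integral_has_integral_lborel) auto
  then show ?thesis
    by (intro integrableI_nonneg) auto
qed

text \<open>The bound ln y \<le> y powr \<eta> / \<eta>, applied to x and to 1 / x. It reduces the
  integrability of a logarithmic singularity to that of powers.\<close>

lemma abs_ln_le_powr:
  fixes x \<eta> :: real
  assumes "0 < x" "0 < \<eta>"
  shows "\<bar>ln x\<bar> \<le> (x powr \<eta> + x powr - \<eta>) / \<eta>"
proof -
  have up: "ln y \<le> y powr \<eta> / \<eta>" if "0 < y" for y
  proof -
    have "\<eta> * ln y = ln (y powr \<eta>)" using that by (simp add: ln_powr)
    also have "\<dots> \<le> y powr \<eta>" using ln_le_minus_one[of "y powr \<eta>"] that by simp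
    finally show ?thesis using assms by (simp add: field_simps)
  qed
  have "ln x \<le> x powr \<eta> / \<eta>" "- ln x \<le> x powr - \<eta> / \<eta>"
    using up[of x] up[of "inverse x"] assms by (auto simp: ln_inverse powr_minus inverse_powr)
  moreover have "0 \<le> x powr \<eta> / \<eta>" "0 \<le> x powr - \<eta> / \<eta>" using assms by auto
  ultimately show ?thesis unfolding add_divide_distrib by linarith
qed

text \<open>Rotations give \<open>\<integral> ln |z^n + a^n| = \<integral> ln |z^n - a^n|\<close>, so the integral of
  \<open>ln |z^n - a^n| / n\<close> does not change when \<open>n\<close> is doubled; pointwise this integrand
  tends to \<open>ln (max |z| |a|)\<close>.\<close>

lemma integral_ln_dist_rotation_invariant:
  fixes N :: "complex measure" and a :: complex
  assumes N[measurable_cong]: "sets N = sets borel" and fin: "finite_measure N"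
    and rot: "\<And>u. cmod u = 1 \<Longrightarrow> distr N borel (\<lambda>z. u * z) = N"
    and ne: "AE z in N. cmod z \<noteq> cmod a"
    and int1: "integrable N (\<lambda>z. ln (max (cmod z) (cmod a)))"
    and int2: "integrable N (\<lambda>z. ln (cmod z - cmod a))"
  shows "integrable N (\<lambda>z. ln (cmod (z - a)))"
    and "(\<integral>z. ln (cmod (z - a)) \<partial>N) = (\<integral>z. ln (max (cmod z) (cmod a)) \<partial>N)"
proof -
  interpret finite_measure N by fact
  define F where "F n z = ln (cmod (z ^ n - a ^ n)) / real n" for n z
  \<comment> \<open>A majorant independent of \<open>n\<close>. With S the larger and s the smaller
    of the two moduli, S^n (1 - s / S) \<le> |z^n - a^n| \<le> 2 S^n, and ln (1 - s / S) = ln ||z| -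
    |a|| - ln S.\<close>
  define D where "D z = ln 2 + 2 * \<bar>ln (max (cmod z) (cmod a))\<bar> + \<bar>ln (cmod z - cmod a)\<bar>" for z
  have bounds: "\<bar>F n z\<bar> \<le> D z"
    and sandwich: "F n z \<le> ln (max (cmod z) (cmod a)) + ln 2 / real n"
      "ln (max (cmod z) (cmod a)) + ln (1 - min (cmod z) (cmod a) / max (cmod z) (cmod a)) / real n \<le> F n z"
    if z: "cmod z \<noteq> cmod a" and n: "0 < n" for n z
  proof -
    define S where "S = max (cmod z) (cmod a)"
    define s where "s = min (cmod z) (cmod a)"
    have S: "0 < S" "0 \<le> s" "s < S"
      using z norm_ge_zero[of z] norm_ge_zero[of a] unfolding S_def s_def by (auto simp del: norm_ge_zero)
    have Ss: "\<bar>cmod z - cmod a\<bar> = S - s" by (auto simp: S_def s_def)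
    define x where "x = s / S"
    have x: "0 \<le> x" "x < 1" using S by (auto simp: x_def)
    have "\<bar>cmod (z ^ n) - cmod (a ^ n)\<bar> = S ^ n - s ^ n"
      using power_mono[of "cmod z" "cmod a" n] power_mono[of "cmod a" "cmod z" n]
      unfolding S_def s_def norm_power by (cases "cmod z \<le> cmod a") auto
    then have "S ^ n - s ^ n \<le> cmod (z ^ n - a ^ n)"
      using norm_triangle_ineq3[of "z ^ n" "a ^ n"] by simp
    moreover have "S ^ n - s ^ n = S ^ n * (1 - x ^ n)"
      using S by (simp add: x_def field_simps)
    moreover have "x ^ n \<le> x" using x n by (cases n) (auto simp: mult_le_cancel_left1 mult_left_le power_le_one)
    then have "S ^ n * (1 - x) \<le> S ^ n * (1 - x ^ n)" using S by (intro mult_left_mono) auto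
    ultimately have lo: "S ^ n * (1 - x) \<le> cmod (z ^ n - a ^ n)" by linarith
    have hi: "cmod (z ^ n - a ^ n) \<le> 2 * S ^ n"
    proof -
      have "cmod z ^ n \<le> S ^ n" "cmod a ^ n \<le> S ^ n" by (auto simp: S_def intro!: power_mono)
      then show ?thesis using norm_triangle_ineq4[of "z ^ n" "a ^ n"] by (simp add: norm_power)
    qed
    have pos: "0 < S ^ n * (1 - x)" using S x by simp
    have "ln (cmod (z ^ n - a ^ n)) \<le> ln (2 * S ^ n)"
      using hi lo pos by (intro ln_mono) auto
    also have "\<dots> = ln 2 + real n * ln S" using S by (simp add: ln_mult ln_realpow)
    finally show U: "F n z \<le> ln (max (cmod z) (cmod a)) + ln 2 / real n"
      using n by (simp add: F_def S_def[symmetric] field_simps)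
    have "ln (S ^ n * (1 - x)) \<le> ln (cmod (z ^ n - a ^ n))"
      using lo pos by (intro ln_mono) auto
    moreover have "ln (S ^ n * (1 - x)) = real n * ln S + ln (1 - x)"
      using S x by (simp add: ln_mult ln_realpow)
    ultimately have "(real n * ln S + ln (1 - x)) / real n \<le> F n z"
      unfolding F_def by (intro divide_right_mono) auto
    then show L: "ln (max (cmod z) (cmod a)) + ln (1 - min (cmod z) (cmod a) / max (cmod z) (cmod a)) / real n \<le> F n z"
      using n by (simp add: S_def[symmetric] s_def[symmetric] x_def[symmetric] add_divide_distrib)
    have "1 - x = (S - s) / S" using S by (simp add: x_def field_simps)
    then have "ln (1 - x) = ln \<bar>cmod z - cmod a\<bar> - ln S" using S by (simp add: ln_div Ss)
    \<comment> \<open>The real \<open>ln\<close> is even, so this integrand stays meaningful for |z|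
      < |a|.\<close>
    also have "ln \<bar>cmod z - cmod a\<bar> = ln (cmod z - cmod a)"
      using ln_minus[of "cmod z - cmod a"] by (auto simp: abs_if)
    finally have "\<bar>ln (1 - x)\<bar> \<le> \<bar>ln (cmod z - cmod a)\<bar> + \<bar>ln S\<bar>" by simp
    moreover have "\<bar>ln (1 - x) / real n\<bar> \<le> \<bar>ln (1 - x)\<bar>" "ln 2 / real n \<le> ln 2"
      using n by (auto simp: divide_le_eq mult_le_cancel_left1)
    moreover have "0 < ln (2::real)" by simp
    ultimately show "\<bar>F n z\<bar> \<le> D z"
      using U L unfolding D_def S_def[symmetric] s_def[symmetric] x_def[symmetric] by linarith
  qed
  have intD: "integrable N D"
    unfolding D_def by (intro Bochner_Integration.integrable_add integrable_mult_right integrable_abs int1 int2 integrable_const)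
  have [measurable]: "F n \<in> borel_measurable N" for n unfolding F_def by measurable
  have intF: "integrable N (F n)" if "0 < n" for n
    by (rule Bochner_Integration.integrable_bound[OF intD])
       (use ne bounds that in \<open>auto elim!: eventually_mono intro: order.trans[OF _ abs_ge_self]\<close>)
  have "integrable N (F 1)" by (rule intF) simp
  then show "integrable N (\<lambda>z. ln (cmod (z - a)))" by (simp add: F_def[abs_def])
  have double: "integral\<^sup>L N (F (2 * n)) = integral\<^sup>L N (F n)" if n: "0 < n" for n
  proof -
    define u where "u = cis (pi / real n)"
    have un: "u ^ n = - 1" using n by (simp add: u_def Complex.DeMoivre)
    have u: "cmod u = 1" by (simp add: u_def)
    have mult[measurable]: "(\<lambda>z. u * z) \<in> N \<rightarrow>\<^sub>M borel" by measurable
    have meas: "F n \<in> borel_measurable borel" unfolding F_def by measurable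
    have "integral\<^sup>L N (F n) = integral\<^sup>L (distr N borel (\<lambda>z. u * z)) (F n)" by (simp add: rot[OF u])
    also have "\<dots> = (\<integral>z. F n (u * z) \<partial>N)" by (rule integral_distr[OF mult meas])
    finally have I: "(\<integral>z. F n (u * z) \<partial>N) = integral\<^sup>L N (F n)" by simp
    have int: "integrable N (\<lambda>z. F n (u * z))"
      using intF[OF n] integrable_distr_eq[OF mult meas] by (simp add: rot[OF u])
    have "integral\<^sup>L N (F (2 * n)) = (\<integral>z. (F n z + F n (u * z)) / 2 \<partial>N)"
    proof (rule integral_cong_AE)
      show "AE z in N. F (2 * n) z = (F n z + F n (u * z)) / 2"
        using ne
      proof eventually_elim
        case (elim z)
        have nz: "z ^ n \<noteq> a ^ n" "z ^ n \<noteq> - (a ^ n)"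
        proof -
          have "cmod (z ^ n) \<noteq> cmod (a ^ n)"
            using elim n by (auto simp: norm_power power_eq_iff_eq_base)
          then show "z ^ n \<noteq> a ^ n" "z ^ n \<noteq> - (a ^ n)" by (auto simp: norm_minus_cancel)
        qed
        have fact: "z ^ (2 * n) - a ^ (2 * n) = (z ^ n - a ^ n) * (z ^ n + a ^ n)"
          by (simp add: power_mult power2_eq_square algebra_simps power_mult_distrib mult_2 power_add)
        have "(u * z) ^ n - a ^ n = - (z ^ n + a ^ n)" by (simp add: power_mult_distrib un)
        then have "cmod ((u * z) ^ n - a ^ n) = cmod (z ^ n + a ^ n)" by (metis norm_minus_cancel)
        moreover have "z ^ n + a ^ n \<noteq> 0" using nz by (simp add: add_eq_0_iff2)
        moreover have "ln (cmod (X * Y)) = ln (cmod X) + ln (cmod Y)" if "X \<noteq> 0" "Y \<noteq> 0" for X Y :: complex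
          using that by (simp add: norm_mult ln_mult)
        ultimately have "ln (cmod (z ^ (2 * n) - a ^ (2 * n))) = ln (cmod (z ^ n - a ^ n)) + ln (cmod ((u * z) ^ n - a ^ n))"
          unfolding fact using nz by simp
        then show ?case
          unfolding F_def by (simp add: add_divide_distrib)
      qed
    qed (use meas mult in measurable)
    also have "\<dots> = integral\<^sup>L N (F n)"
      using I int intF[OF n] by simp
    finally show ?thesis .
  qed
  have pow: "integral\<^sup>L N (F (2 ^ j)) = integral\<^sup>L N (F 1)" for j
    by (induction j) (auto simp: double)
  have "(\<lambda>j. integral\<^sup>L N (F (2 ^ j))) \<longlonglongrightarrow> (\<integral>z. ln (max (cmod z) (cmod a)) \<partial>N)"
  proof (rule integral_dominated_convergence)
    show "integrable N D" by fact
    show "AE z in N. norm (F (2 ^ j) z) \<le> D z" for j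
      using ne by eventually_elim (simp add: bounds)
    show "AE z in N. (\<lambda>j. F (2 ^ j) z) \<longlonglongrightarrow> ln (max (cmod z) (cmod a))"
      using ne
    proof eventually_elim
      case (elim z)
      have lim: "(\<lambda>j. c + d / real (2 ^ j)) \<longlonglongrightarrow> c" for c d :: real
        by real_asymp
      show ?case
        by (rule tendsto_sandwich[OF _ _ lim lim]) (auto intro!: always_eventually sandwich[OF elim] simp del: of_nat_power)
    qed
  qed (use int1 in auto)
  then have "integral\<^sup>L N (F 1) = (\<integral>z. ln (max (cmod z) (cmod a)) \<partial>N)"
    unfolding pow by (simp add: LIMSEQ_const_iff)
  then show "(\<integral>z. ln (cmod (z - a)) \<partial>N) = (\<integral>z. ln (max (cmod z) (cmod a)) \<partial>N)"
    by (simp add: F_def[abs_def])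
qed

lemma
  fixes f :: "real \<Rightarrow> real"
  assumes g: "0 < \<gamma>" and [measurable]: "f \<in> borel_measurable borel"
  shows integrable_radial_measure_iff: "integrable (radial_measure \<gamma> R) (\<lambda>z. f (cmod z)) \<longleftrightarrow>
      integrable lborel (\<lambda>r. \<gamma> * r powr (\<gamma> - 1) * indicator {0<..<R} r * f r)"
    and integral_radial_measure: "(\<integral>z. f (cmod z) \<partial>radial_measure \<gamma> R) =
      (\<integral>r. \<gamma> * r powr (\<gamma> - 1) * indicator {0<..<R} r * f r \<partial>lborel)"
proof -
  have 1: "integrable (radial_measure \<gamma> R) (\<lambda>z. f (cmod z)) \<longleftrightarrow> integrable (distr (radial_measure \<gamma> R) borel cmod) f"
    by (rule integrable_distr_eq[symmetric]) auto
  show "integrable (radial_measure \<gamma> R) (\<lambda>z. f (cmod z)) \<longleftrightarrow>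
      integrable lborel (\<lambda>r. \<gamma> * r powr (\<gamma> - 1) * indicator {0<..<R} r * f r)"
    unfolding 1 distr_radial_measure[OF g] by (rule integrable_real_density) (use g in auto)
  have 2: "(\<integral>z. f (cmod z) \<partial>radial_measure \<gamma> R) = integral\<^sup>L (distr (radial_measure \<gamma> R) borel cmod) f"
    by (rule integral_distr[symmetric]) auto
  show "(\<integral>z. f (cmod z) \<partial>radial_measure \<gamma> R) =
      (\<integral>r. \<gamma> * r powr (\<gamma> - 1) * indicator {0<..<R} r * f r \<partial>lborel)"
    unfolding 2 distr_radial_measure[OF g] by (rule integral_real_density) (use g in auto)
qed

lemma AE_radial_measure_cmod_neq:
  assumes "0 < \<gamma>"
  shows "AE z in radial_measure \<gamma> R. cmod z \<noteq> b"
proof (rule AE_distrD[where M' = borel and f = cmod and P = "\<lambda>r. r \<noteq> b"])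
  show "AE r in distr (radial_measure \<gamma> R) borel cmod. r \<noteq> b"
    unfolding distr_radial_measure[OF assms]
    by (subst AE_density) (auto intro: AE_mp[OF AE_lborel_singleton])
qed simp

text \<open>There are two possible singularities, the density at 0 and the logarithm at b. If b = 0
  they coincide and a slightly worse power absorbs the logarithm. If b > 0 they are separated: at
  distance at least b / 2 from b the logarithm is bounded, and closer to b the density is
  bounded.\<close>

lemma integrable_radial_ln_diff:
  assumes g: "0 < \<gamma>" and R: "0 < R" and b: "0 \<le> b"
  shows "integrable (radial_measure \<gamma> R) (\<lambda>z. ln (cmod z - b))"
proof (subst integrable_radial_measure_iff[where f = "\<lambda>r. ln (r - b)", OF g])
  show "integrable lborel (\<lambda>r. \<gamma> * r powr (\<gamma> - 1) * indicator {0<..<R} r * ln (r - b))"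
  proof (cases "b = 0")
    case True
    \<comment> \<open>Half of \<gamma>, so that the exponent \<gamma> - 1 - \<eta> stays above -
      1.\<close>
    define \<eta> where "\<eta> = \<gamma> / 2"
    have e: "0 < \<eta>" using g by (simp add: \<eta>_def)
    show ?thesis
    proof (rule Bochner_Integration.integrable_bound)
      show "integrable lborel (\<lambda>r. \<gamma> / \<eta> * (r powr (\<gamma> - 1 + \<eta>) * indicator {0<..<R} r + r powr (\<gamma> - 1 - \<eta>) * indicator {0<..<R} r))"
        by (intro integrable_mult_right Bochner_Integration.integrable_add integrable_powr_Ioo) (use g R in \<open>auto simp: \<eta>_def\<close>)
      show "AE r in lborel. norm (\<gamma> * r powr (\<gamma> - 1) * indicator {0<..<R} r * ln (r - b))
        \<le> norm (\<gamma> / \<eta> * (r powr (\<gamma> - 1 + \<eta>) * indicator {0<..<R} r + r powr (\<gamma> - 1 - \<eta>) * indicator {0<..<R} r))"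
      proof (rule AE_I2)
        fix r :: real
        show "norm (\<gamma> * r powr (\<gamma> - 1) * indicator {0<..<R} r * ln (r - b))
          \<le> norm (\<gamma> / \<eta> * (r powr (\<gamma> - 1 + \<eta>) * indicator {0<..<R} r + r powr (\<gamma> - 1 - \<eta>) * indicator {0<..<R} r))"
        proof (cases "r \<in> {0<..<R}")
          case True
          have "\<gamma> * r powr (\<gamma> - 1) * \<bar>ln r\<bar> \<le> \<gamma> * r powr (\<gamma> - 1) * ((r powr \<eta> + r powr - \<eta>) / \<eta>)"
            using True g e by (intro mult_left_mono abs_ln_le_powr) auto
          also have "\<dots> = \<gamma> / \<eta> * (r powr (\<gamma> - 1 + \<eta>) + r powr (\<gamma> - 1 - \<eta>))"
            unfolding diff_conv_add_uminus[of "\<gamma> - 1"] powr_add by (simp add: algebra_simps add_divide_distrib)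
          finally show ?thesis using True g e \<open>b = 0\<close> by (simp add: abs_mult)
        qed simp
      qed
    qed measurable
  next
    case False
    then have b: "0 < b" using b by simp
    define K1 where "K1 = \<bar>ln (b / 2)\<bar> + \<bar>ln (R + b)\<bar>"
    \<comment> \<open>Bounds r powr (\<gamma> - 1) for b / 2 < r < 3 b / 2; there is one term for
      each sign of \<gamma> - 1.\<close>
    define K2 where "K2 = (b / 2) powr (\<gamma> - 1) + (3 * b / 2) powr (\<gamma> - 1)"
    define h where "h a x = x powr a * indicator {0<..<b / 2} x" for a x :: real
    \<comment> \<open>This is |r - b| powr a restricted to 0 < |r - b| < b / 2, written as two
      affine copies of one integrable function. The exponents 1/2 and - 1/2 used below come from
      \<open>abs_ln_le_powr\<close> with \<eta> = 1/2.\<close>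
    define H where "H a r = h a (- b + 1 * r) + h a (b + (- 1) * r)" for a r
    have intH: "integrable lborel (H a)" if "- 1 < a" for a
      unfolding H_def by (intro Bochner_Integration.integrable_add lborel_integrable_real_affine)
        (use b that in \<open>auto simp: h_def[abs_def] intro!: integrable_powr_Ioo\<close>)
    define G where "G r = \<gamma> * K1 * (r powr (\<gamma> - 1) * indicator {0<..<R} r) + \<gamma> * K2 * (2 * (H (1/2) r + H (- (1/2)) r))" for r
    have H0: "0 \<le> H a r" for a r by (simp add: H_def h_def)
    have K: "0 \<le> K1" "0 \<le> K2" by (auto simp: K1_def K2_def)
    show ?thesis
    proof (rule Bochner_Integration.integrable_bound)
      show "integrable lborel G"
        unfolding G_def
        by (intro integrable_mult_right Bochner_Integration.integrable_add integrable_powr_Ioo intH) (use g R in auto)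
      show "AE r in lborel. norm (\<gamma> * r powr (\<gamma> - 1) * indicator {0<..<R} r * ln (r - b)) \<le> norm (G r)"
      proof (rule AE_I2)
        fix r :: real
        have G0: "0 \<le> \<gamma> * K1 * (r powr (\<gamma> - 1) * indicator {0<..<R} r)" "0 \<le> \<gamma> * K2 * (2 * (H (1/2) r + H (- (1/2)) r))"
          using g K H0 by (auto intro!: mult_nonneg_nonneg add_nonneg_nonneg)
        show "norm (\<gamma> * r powr (\<gamma> - 1) * indicator {0<..<R} r * ln (r - b)) \<le> norm (G r)"
        proof (cases "r \<in> {0<..<R} \<and> r \<noteq> b")
          case True
          then have r: "0 < r" "r < R" "r \<noteq> b" by auto
          have lnabs: "\<bar>ln (r - b)\<bar> = \<bar>ln \<bar>r - b\<bar>\<bar>" using ln_minus[of "r - b"] by (auto simp: abs_if)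
          have "\<gamma> * r powr (\<gamma> - 1) * \<bar>ln (r - b)\<bar> \<le> G r"
          proof (cases "b / 2 \<le> \<bar>r - b\<bar>")
            case True
            have "ln (b / 2) \<le> ln \<bar>r - b\<bar>" "ln \<bar>r - b\<bar> \<le> ln (R + b)"
              using True r b R by (auto intro!: ln_mono)
            then have "\<bar>ln (r - b)\<bar> \<le> K1" unfolding lnabs K1_def by linarith
            then have "\<gamma> * r powr (\<gamma> - 1) * \<bar>ln (r - b)\<bar> \<le> \<gamma> * r powr (\<gamma> - 1) * K1"
              using g by (intro mult_left_mono) auto
            also have "\<dots> = \<gamma> * K1 * (r powr (\<gamma> - 1) * indicator {0<..<R} r)" using r by simp
            also have "\<dots> \<le> G r" unfolding G_def using G0(2) by simp
            finally show ?thesis .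
          next
            case False
            then have rb: "b / 2 < r" "r < 3 * b / 2" by (auto simp: abs_if split: if_splits)
            have HH: "H a r = \<bar>r - b\<bar> powr a" for a
              using False r by (auto simp: H_def h_def indicator_def abs_if not_le split: if_splits)
            have "r powr (\<gamma> - 1) \<le> K2"
            proof (cases "1 \<le> \<gamma>")
              case True
              then have "r powr (\<gamma> - 1) \<le> (3 * b / 2) powr (\<gamma> - 1)" using rb r by (intro powr_mono2) auto
              then show ?thesis unfolding K2_def using powr_ge_zero[of "b / 2" "\<gamma> - 1"] by linarith
            next
              case False
              then have "r powr (\<gamma> - 1) \<le> (b / 2) powr (\<gamma> - 1)" using rb r b by (intro powr_mono2') auto
              then show ?thesis unfolding K2_def using powr_ge_zero[of "3 * b / 2" "\<gamma> - 1"] by linarith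
            qed
            moreover have "\<bar>ln (r - b)\<bar> \<le> 2 * (H (1/2) r + H (- (1/2)) r)"
              unfolding lnabs HH using abs_ln_le_powr[of "\<bar>r - b\<bar>" "1/2"] r by simp
            ultimately have "\<gamma> * (r powr (\<gamma> - 1) * \<bar>ln (r - b)\<bar>) \<le> \<gamma> * (K2 * (2 * (H (1/2) r + H (- (1/2)) r)))"
              using g K by (intro mult_left_mono mult_mono) auto
            then show ?thesis unfolding G_def using G0(1) by (simp only: mult.assoc)
          qed
          then show ?thesis using r g by (simp add: abs_mult)
        next
          case False
          then have eq: "\<gamma> * r powr (\<gamma> - 1) * indicator {0<..<R} r * ln (r - b) = 0" by auto
          show ?thesis unfolding eq by simp
        qed
      qed
    qed measurable
  qed
qed auto

lemma integrable_radial_ln_max: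
  assumes g: "0 < \<gamma>" and R: "0 < R" and b: "0 \<le> b"
  shows "integrable (radial_measure \<gamma> R) (\<lambda>z. ln (max (cmod z) b))"
proof (rule Bochner_Integration.integrable_bound)
  interpret finite_measure "radial_measure \<gamma> R" by (rule finite_radial_measure) (use assms in auto)
  show "integrable (radial_measure \<gamma> R) (\<lambda>z. \<bar>ln (cmod z - 0)\<bar> + \<bar>ln b\<bar>)"
    by (intro Bochner_Integration.integrable_add integrable_abs integrable_radial_ln_diff) (use assms in auto)
qed (auto simp: max_def)

text \<open>For 0 < b < R the radial integral splits at r = b; beyond b the antiderivative of
  \<gamma> r powr (\<gamma> - 1) ln r is r powr \<gamma> ln r - r powr \<gamma> / \<gamma>. The case
  b = 0 is the limit of small positive b.\<close>

lemma integral_radial_ln_max: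
  assumes g: "0 < \<gamma>" and R: "0 < R" and b: "0 \<le> b"
  shows "(\<integral>z. ln (max (cmod z) b) \<partial>radial_measure \<gamma> R) =
    R powr \<gamma> * ln (max R b) - R powr \<gamma> / \<gamma> + min R b powr \<gamma> / \<gamma>"
proof -
  interpret finite_measure "radial_measure \<gamma> R" by (rule finite_radial_measure) (use assms in auto)
  have mass: "(\<integral>r. \<gamma> * r powr (\<gamma> - 1) * indicator {0<..<c} r \<partial>lborel) = c powr \<gamma>" if c: "0 \<le> c" for c
  proof -
    interpret C: finite_measure "radial_measure \<gamma> c" by (rule finite_radial_measure) (use g c in auto)
    have "emeasure (radial_measure \<gamma> c) UNIV = emeasure (radial_measure \<gamma> c) {z. cmod z < c}"
      unfolding radial_measure_def
      by (subst (1 2) emeasure_density) (auto intro!: nn_integral_cong simp: indicator_def)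
    then have "measure (radial_measure \<gamma> c) UNIV = c powr \<gamma>"
      using g c by (simp add: measure_def radial_measure_ball)
    then show ?thesis
      using integral_radial_measure[OF g, of "\<lambda>_. 1" c] by simp
  qed
  have pos: "(\<integral>z. ln (max (cmod z) b) \<partial>radial_measure \<gamma> R) =
    R powr \<gamma> * ln (max R b) - R powr \<gamma> / \<gamma> + min R b powr \<gamma> / \<gamma>" if b: "0 < b" for b
  proof (cases "R \<le> b")
    case True
    have "(\<integral>z. ln (max (cmod z) b) \<partial>radial_measure \<gamma> R) = (\<integral>r. \<gamma> * r powr (\<gamma> - 1) * indicator {0<..<R} r * ln (max r b) \<partial>lborel)"
      by (rule integral_radial_measure[OF g]) auto
    also have "\<dots> = (\<integral>r. ln b * (\<gamma> * r powr (\<gamma> - 1) * indicator {0<..<R} r) \<partial>lborel)"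
      using True by (intro Bochner_Integration.integral_cong) (auto simp: indicator_def max_def)
    also have "\<dots> = ln b * R powr \<gamma>" using R by (simp only: integral_mult_right_zero mass)
    finally show ?thesis using True by simp
  next
    case False
    then have bR: "b < R" by simp
    define F where "F r = r powr \<gamma> * ln r - r powr \<gamma> / \<gamma>" for r
    define f where "f r = \<gamma> * r powr (\<gamma> - 1) * ln r" for r
    have hb: "has_bochner_integral lborel (\<lambda>r. indicator {b..R} r *\<^sub>R f r) (F R - F b)"
    proof (rule has_bochner_integral_FTC_Icc)
      fix x assume x: "b \<le> x" "x \<le> R"
      then have x0: "0 < x" using b by simp
      have "x powr \<gamma> * inverse x = x powr (\<gamma> - 1)"
        using x0 by (simp add: powr_diff divide_inverse)
      then have "(F has_real_derivative f x) (at x within {b..R})"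
        unfolding F_def f_def using x0 g by (auto intro!: derivative_eq_intros simp: field_simps powr_diff)
      then show "(F has_vector_derivative f x) (at x within {b..R})"
        by (simp add: has_real_derivative_iff_has_vector_derivative)
    next
      show "continuous_on {b..R} f"
        unfolding f_def using b by (intro continuous_intros) auto
    qed (use bR in auto)
    have intm: "integrable lborel (\<lambda>r. \<gamma> * r powr (\<gamma> - 1) * indicator {0<..<b} r)"
      unfolding mult.assoc by (intro integrable_mult_right integrable_powr_Ioo) (use g b in auto)
    have "(\<integral>z. ln (max (cmod z) b) \<partial>radial_measure \<gamma> R) = (\<integral>r. \<gamma> * r powr (\<gamma> - 1) * indicator {0<..<R} r * ln (max r b) \<partial>lborel)"
      by (rule integral_radial_measure[OF g]) auto
    also have "\<dots> = (\<integral>r. ln b * (\<gamma> * r powr (\<gamma> - 1) * indicator {0<..<b} r) + indicator {b..R} r *\<^sub>R f r \<partial>lborel)"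
    proof (rule integral_cong_AE)
      show "AE r in lborel. \<gamma> * r powr (\<gamma> - 1) * indicator {0<..<R} r * ln (max r b) =
          ln b * (\<gamma> * r powr (\<gamma> - 1) * indicator {0<..<b} r) + indicator {b..R} r *\<^sub>R f r"
        using AE_lborel_singleton[of R]
        by eventually_elim (use b bR in \<open>auto simp: indicator_def f_def max_def\<close>)
    qed (auto simp: f_def)
    also have "\<dots> = ln b * b powr \<gamma> + (F R - F b)"
      using hb intm b by (subst Bochner_Integration.integral_add) (auto simp: has_bochner_integral_iff mass)
    finally show ?thesis using bR b by (simp add: F_def)
  qed
  show ?thesis
  proof (cases "b = 0")
    case True
    \<comment> \<open>Lies below both R and 1. Values of b below R keep the closed form in one case,
      and values below 1 let |ln |z|| serve as a majorant.\<close>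
    define q where "q = R / (1 + R)"
    have q: "0 < q" "q < R" "q < 1" using R by (auto simp: q_def divide_less_eq)
    define \<beta> where "\<beta> i = q / real (i + 2)" for i :: nat
    have \<beta>q: "0 < \<beta> i" "\<beta> i < q" for i
      using q by (auto simp: \<beta>_def divide_less_eq)
    then have \<beta>: "0 < \<beta> i" "\<beta> i < R" "\<beta> i < 1" for i
      using q by (auto intro: less_trans)
    have \<beta>0: "\<beta> \<longlonglongrightarrow> 0" unfolding \<beta>_def by real_asymp
    have "(\<lambda>i. \<integral>z. ln (max (cmod z) (\<beta> i)) \<partial>radial_measure \<gamma> R) \<longlonglongrightarrow> (\<integral>z. ln (max (cmod z) b) \<partial>radial_measure \<gamma> R)"
    proof (rule integral_dominated_convergence)
      show "integrable (radial_measure \<gamma> R) (\<lambda>z. \<bar>ln (cmod z - 0)\<bar>)"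
        by (intro integrable_abs integrable_radial_ln_diff) (use assms in auto)
      show "AE z in radial_measure \<gamma> R. norm (ln (max (cmod z) (\<beta> i))) \<le> \<bar>ln (cmod z - 0)\<bar>" for i
        using AE_radial_measure_cmod_neq[OF g, where R = R and b = 0]
      proof eventually_elim
        case (elim z)
        then have "ln (cmod z) \<le> ln (\<beta> i)" "ln (\<beta> i) < 0" if "cmod z \<le> \<beta> i" using that \<beta>[of i] by auto
        then show ?case by (auto simp: max_def)
      qed
      show "AE z in radial_measure \<gamma> R. (\<lambda>i. ln (max (cmod z) (\<beta> i))) \<longlonglongrightarrow> ln (max (cmod z) b)"
        using AE_radial_measure_cmod_neq[OF g, where R = R and b = 0]
      proof eventually_elim
        case (elim z)
        have "(\<lambda>i. ln (max (cmod z) (\<beta> i))) \<longlonglongrightarrow> ln (max (cmod z) 0)"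
          by (intro tendsto_intros \<beta>0) (use elim in \<open>auto simp: max_def\<close>)
        then show ?case using True by simp
      qed
    qed measurable
    moreover have "(\<lambda>i. \<integral>z. ln (max (cmod z) (\<beta> i)) \<partial>radial_measure \<gamma> R) \<longlonglongrightarrow> R powr \<gamma> * ln R - R powr \<gamma> / \<gamma> + 0 powr \<gamma> / \<gamma>"
    proof -
      have eq: "(\<integral>z. ln (max (cmod z) (\<beta> i)) \<partial>radial_measure \<gamma> R) = R powr \<gamma> * ln R - R powr \<gamma> / \<gamma> + \<beta> i powr \<gamma> / \<gamma>" for i
        using \<beta>[of i] by (subst pos) auto
      have "(\<lambda>i. \<beta> i powr \<gamma>) \<longlonglongrightarrow> 0 powr \<gamma>"
        using \<beta>0 \<beta>(1) g by (intro tendsto_powr') (auto intro!: always_eventually less_imp_le)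
      then show ?thesis unfolding eq using g by (intro tendsto_add tendsto_divide tendsto_const) auto
    qed
    ultimately show ?thesis using True R by (auto dest: LIMSEQ_unique)
  qed (use b pos in auto)
qed

text \<open>Two instances are used. For R = 1 and |a| < 1 the value is |a| powr \<gamma> / \<gamma>
  - 1 / \<gamma>, the limiting potential up to a constant; for \<gamma> = 2 it yields the area means
  of ln |z - a| over discs.\<close>

lemma
  assumes g: "0 < \<gamma>" and R: "0 < R"
  shows integrable_radial_ln_dist: "integrable (radial_measure \<gamma> R) (\<lambda>z. ln (cmod (z - a)))"
    and integral_radial_ln_dist: "(\<integral>z. ln (cmod (z - a)) \<partial>radial_measure \<gamma> R) =
      R powr \<gamma> * ln (max R (cmod a)) - R powr \<gamma> / \<gamma> + min R (cmod a) powr \<gamma> / \<gamma>"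
proof -
  note L = integral_ln_dist_rotation_invariant[of "radial_measure \<gamma> R" a]
  show "integrable (radial_measure \<gamma> R) (\<lambda>z. ln (cmod (z - a)))"
    by (intro L(1) finite_radial_measure radial_measure_rotation AE_radial_measure_cmod_neq
      integrable_radial_ln_max integrable_radial_ln_diff) (use assms in auto)
  have "(\<integral>z. ln (cmod (z - a)) \<partial>radial_measure \<gamma> R) = (\<integral>z. ln (max (cmod z) (cmod a)) \<partial>radial_measure \<gamma> R)"
    by (intro L(2) finite_radial_measure radial_measure_rotation AE_radial_measure_cmod_neq
      integrable_radial_ln_max integrable_radial_ln_diff) (use assms in auto)
  then show "(\<integral>z. ln (cmod (z - a)) \<partial>radial_measure \<gamma> R) =
      R powr \<gamma> * ln (max R (cmod a)) - R powr \<gamma> / \<gamma> + min R (cmod a) powr \<gamma> / \<gamma>"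
    by (simp add: integral_radial_ln_max[OF g R])
qed

section \<open>Convergence of logarithmic potentials in the unit disc\<close>

lemma sets_ball [measurable]: "ball (c :: 'a :: metric_space) r \<in> sets borel"
  by simp

text \<open>The average of ln |z - a| over a disc of radius \<open>r\<close> whose centre has
  distance \<open>b\<close> from \<open>a\<close>: ln b when \<open>a\<close> lies outside, by
  harmonicity, and a quadratic in \<open>b\<close> inside.\<close>

definition ball_mean_ln :: "real \<Rightarrow> real \<Rightarrow> real" where
  "ball_mean_ln r b = ln (max r b) - 1 / 2 + (min r b)\<^sup>2 / (2 * r\<^sup>2)"

lemma ball_mean_ln_outside: "0 < r \<Longrightarrow> r \<le> b \<Longrightarrow> ball_mean_ln r b = ln b"
  by (simp add: ball_mean_ln_def)

lemma continuous_on_ball_mean_ln [continuous_intros]: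
  assumes "0 < r" "continuous_on S f"
  shows "continuous_on S (\<lambda>x. ball_mean_ln r (f x))"
  unfolding ball_mean_ln_def using assms by (intro continuous_intros) (auto simp: max_def)

lemma measurable_ball_mean_ln [measurable]: "ball_mean_ln r \<in> borel_measurable borel"
  unfolding ball_mean_ln_def by measurable

text \<open>The sub-mean value property of ln |z - a| in closed form. For b < r it is half of ln x
  \<le> x - 1 at x = (b / r)^2.\<close>

lemma ln_le_ball_mean_ln:
  assumes "0 < r" "0 < b"
  shows "ln b \<le> ball_mean_ln r b"
proof (cases "r \<le> b")
  case False
  define x where "x = (b / r)\<^sup>2"
  have x: "0 < x" using assms by (simp add: x_def)
  have "ln x = 2 * ln b - 2 * ln r" using assms by (simp add: x_def ln_realpow ln_div)
  moreover have "ln x \<le> x - 1" using x by (rule ln_le_minus_one)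
  moreover have "b\<^sup>2 / (2 * r\<^sup>2) = x / 2" by (simp add: x_def power_divide)
  ultimately show ?thesis using False by (simp add: ball_mean_ln_def)
qed (use assms in \<open>simp add: ball_mean_ln_outside\<close>)

lemma ball_mean_ln_ge: "0 < r \<Longrightarrow> ln r - 1 / 2 \<le> ball_mean_ln r b"
  unfolding ball_mean_ln_def by (intro add_increasing2 diff_right_mono ln_mono) auto

lemma
  fixes f :: "complex \<Rightarrow> real"
  assumes r: "0 < r" and [measurable]: "f \<in> borel_measurable borel"
  shows set_integrable_ball_radial_measure:
      "set_integrable lborel (ball 0 r) f \<longleftrightarrow> integrable (radial_measure 2 r) f"
    and set_integral_ball_radial_measure:
      "(LINT z:ball 0 r|lborel. f z) = pi * (\<integral>z. f z \<partial>radial_measure 2 r)"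
proof -
  \<comment> \<open>Only almost everywhere, because \<open>0 powr 0 = 0\<close> makes the density
    vanish at the origin.\<close>
  have ae: "AE z in lborel. 2 / (2 * pi) * cmod z powr (2 - 2) * indicator {..<r} (cmod z) * f z
      = (1 / pi) * (indicator (ball 0 r) z *\<^sub>R f z)"
    using AE_lborel_singleton[of 0] by eventually_elim (auto simp: indicator_def)
  have "integrable (radial_measure 2 r) f \<longleftrightarrow>
      integrable lborel (\<lambda>z. 2 / (2 * pi) * cmod z powr (2 - 2) * indicator {..<r} (cmod z) * f z)"
    unfolding radial_measure_def by (rule integrable_real_density) auto
  also have "\<dots> \<longleftrightarrow> integrable lborel (\<lambda>z. (1 / pi) * (indicator (ball 0 r) z *\<^sub>R f z))"
    by (rule integrable_cong_AE[OF _ _ ae]) auto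
  also have "\<dots> \<longleftrightarrow> set_integrable lborel (ball 0 r) f"
    unfolding set_integrable_def by (subst integrable_mult_left_iff) simp
  finally show "set_integrable lborel (ball 0 r) f \<longleftrightarrow> integrable (radial_measure 2 r) f" ..
  have "(\<integral>z. f z \<partial>radial_measure 2 r) =
      (\<integral>z. 2 / (2 * pi) * cmod z powr (2 - 2) * indicator {..<r} (cmod z) * f z \<partial>lborel)"
    unfolding radial_measure_def by (rule integral_real_density) auto
  also have "\<dots> = (\<integral>z. (1 / pi) * (indicator (ball 0 r) z *\<^sub>R f z) \<partial>lborel)"
    by (rule integral_cong_AE[OF _ _ ae]) auto
  also have "\<dots> = (1 / pi) * (LINT z:ball 0 r|lborel. f z)"
    unfolding set_lebesgue_integral_def by (rule integral_mult_right_zero)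
  finally show "(LINT z:ball 0 r|lborel. f z) = pi * (\<integral>z. f z \<partial>radial_measure 2 r)" by simp
qed

lemma
  fixes a c :: complex
  assumes r: "0 < r"
  shows set_integrable_ball_ln: "set_integrable lborel (ball c r) (\<lambda>z. ln (cmod (z - a)))"
    and set_integral_ball_ln:
      "(LINT z:ball c r|lborel. ln (cmod (z - a))) = pi * r\<^sup>2 * ball_mean_ln r (cmod (a - c))"
proof -
  define f where "f z = indicator (ball c r) z *\<^sub>R ln (cmod (z - a))" for z
  have [measurable]: "f \<in> borel_measurable borel" unfolding f_def by measurable
  have shift: "f (c + z) = indicator (ball 0 r) z *\<^sub>R ln (cmod (z - (a - c)))" for z
    by (simp add: f_def indicator_def dist_norm algebra_simps)
  have int: "integrable (radial_measure 2 r) (\<lambda>z. ln (cmod (z - (a - c))))"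
    using r by (intro integrable_radial_ln_dist) auto
  then have "integrable lborel (\<lambda>z. f (c + z))"
    unfolding shift using set_integrable_ball_radial_measure[OF r, of "\<lambda>z. ln (cmod (z - (a - c)))"]
    by (simp add: set_integrable_def)
  then have "integrable (distr lborel borel ((+) c)) f"
    by (subst integrable_distr_eq) auto
  then show "set_integrable lborel (ball c r) (\<lambda>z. ln (cmod (z - a)))"
    by (simp add: lborel_distr_plus set_integrable_def f_def[abs_def])
  have "(LINT z:ball c r|lborel. ln (cmod (z - a))) = integral\<^sup>L (distr lborel borel ((+) c)) f"
    by (simp add: lborel_distr_plus set_lebesgue_integral_def f_def[abs_def])
  also have "\<dots> = (\<integral>z. f (c + z) \<partial>lborel)"
    by (rule integral_distr) auto
  also have "\<dots> = pi * (\<integral>z. ln (cmod (z - (a - c))) \<partial>radial_measure 2 r)"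
    unfolding shift using set_integral_ball_radial_measure[OF r, of "\<lambda>z. ln (cmod (z - (a - c)))"]
    by (simp add: set_lebesgue_integral_def)
  also have "\<dots> = pi * r\<^sup>2 * ball_mean_ln r (cmod (a - c))"
    using r by (subst integral_radial_ln_dist) (simp_all add: ball_mean_ln_def field_simps)
  finally show "(LINT z:ball c r|lborel. ln (cmod (z - a))) = pi * r\<^sup>2 * ball_mean_ln r (cmod (a - c))" .
qed

lemma measure_lborel_ball_complex:
  fixes c :: complex shows "0 \<le> r \<Longrightarrow> measure lborel (ball c r) = pi * r\<^sup>2"
  by (simp add: measure_def emeasure_lborel_ball_complex)

lemma
  fixes c :: complex and K :: real
  assumes "0 \<le> r"
  shows set_integrable_ball_const: "set_integrable lborel (ball c r) (\<lambda>z. K)"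
    and set_integral_ball_const: "(LINT z:ball c r|lborel. K) = pi * r\<^sup>2 * K"
  unfolding set_integrable_def set_lebesgue_integral_def
  using assms by (auto simp: emeasure_lborel_ball_complex measure_lborel_ball_complex)

text \<open>Abstracts ln |W (c z)| / n for a polynomial W: \<open>t\<close> gives the rescaled
  zeros, \<open>m\<close> their multiplicities divided by n, and \<open>K\<close> collects the
  leading coefficient and the scaling. At a zero the summand is \<open>ln 0 = 0\<close> instead of
  minus infinity, so pointwise bounds are required only off the image of \<open>t\<close>.\<close>

definition log_potential :: "real \<Rightarrow> 'i set \<Rightarrow> ('i \<Rightarrow> real) \<Rightarrow> ('i \<Rightarrow> complex) \<Rightarrow> complex \<Rightarrow> real" where
  "log_potential K A m t z = K + (\<Sum>i\<in>A. m i * ln (cmod (z - t i)))"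

lemma measurable_log_potential [measurable]: "log_potential K A m t \<in> borel_measurable borel"
  unfolding log_potential_def by measurable

lemma
  assumes r: "0 < r" and fin: "finite A"
  shows set_integrable_log_potential: "set_integrable lborel (ball c r) (log_potential K A m t)"
    and set_integral_log_potential: "(LINT z:ball c r|lborel. log_potential K A m t z) =
      pi * r\<^sup>2 * (K + (\<Sum>i\<in>A. m i * ball_mean_ln r (cmod (t i - c))))"
proof -
  have 1: "set_integrable lborel (ball c r) (\<lambda>z. m i * ln (cmod (z - t i)))" for i
    by (intro set_integrable_mult_right impI set_integrable_ball_ln r)
  have 2: "set_integrable lborel (ball c r) (\<lambda>z. K)"
    using r by (intro set_integrable_ball_const) simp
  have 3: "set_integrable lborel (ball c r) (\<lambda>z. \<Sum>i\<in>A. m i * ln (cmod (z - t i)))"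
    using 1 unfolding set_integrable_def scaleR_sum_right by (intro Bochner_Integration.integrable_sum) auto
  show "set_integrable lborel (ball c r) (log_potential K A m t)"
    unfolding log_potential_def[abs_def] by (rule set_integral_add(1)[OF 2 3])
  have "(LINT z:ball c r|lborel. log_potential K A m t z) =
      (LINT z:ball c r|lborel. K) + (LINT z:ball c r|lborel. \<Sum>i\<in>A. m i * ln (cmod (z - t i)))"
    unfolding log_potential_def by (rule set_integral_add(2)[OF 2 3])
  also have "(LINT z:ball c r|lborel. \<Sum>i\<in>A. m i * ln (cmod (z - t i))) =
      (\<Sum>i\<in>A. LINT z:ball c r|lborel. m i * ln (cmod (z - t i)))"
    using 1 unfolding set_integrable_def set_lebesgue_integral_def scaleR_sum_right
    by (intro Bochner_Integration.integral_sum) auto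
  also have "\<dots> = (\<Sum>i\<in>A. m i * (pi * r\<^sup>2 * ball_mean_ln r (cmod (t i - c))))"
    by (simp add: set_integral_ball_ln[OF r])
  also have "(LINT z:ball c r|lborel. K) = pi * r\<^sup>2 * K"
    using r by (simp add: set_integral_ball_const)
  finally show "(LINT z:ball c r|lborel. log_potential K A m t z) =
      pi * r\<^sup>2 * (K + (\<Sum>i\<in>A. m i * ball_mean_ln r (cmod (t i - c))))"
    by (simp add: algebra_simps sum_distrib_left)
qed

text \<open>The deficit \<open>\<Phi> + \<epsilon> - u\<close> is nonnegative, so by the sub-mean value property
  near-maximality of \<open>u\<close> at one point controls the deficit on a disc around it.\<close>

lemma nn_integral_ball_log_potential_diff:
  assumes r: "0 < r" and fin: "finite A" and m: "\<And>i. i \<in> A \<Longrightarrow> 0 \<le> m i"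
    and [measurable]: "\<Phi> \<in> borel_measurable borel"
    and upper: "\<And>z. z \<notin> t ` A \<Longrightarrow> log_potential K A m t z \<le> \<Phi> z + \<epsilon>"
    and q: "q \<notin> t ` A" "\<Phi> q - \<epsilon> \<le> log_potential K A m t q"
    and \<Phi>: "\<And>z. z \<in> ball q r \<Longrightarrow> \<bar>\<Phi> z - \<Phi> q\<bar> \<le> \<epsilon>"
  shows "(\<integral>\<^sup>+ z. ennreal \<bar>log_potential K A m t z - \<Phi> z\<bar> * indicator (ball q r) z \<partial>lborel) \<le> ennreal (4 * \<epsilon> * (pi * r\<^sup>2))"
proof -
  define u where "u = log_potential K A m t"
  have e: "0 \<le> \<epsilon>" using \<Phi>[of q] r by simp
  have [measurable]: "u \<in> borel_measurable borel" unfolding u_def by measurable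
  have AEt: "AE z in lborel. z \<notin> t ` A"
    using fin by (intro AE_not_in finite_imp_null_set_lborel) auto
  have int: "set_integrable lborel (ball q r) u"
    unfolding u_def by (rule set_integrable_log_potential[OF r fin])
  have intc: "set_integrable lborel (ball q r) (\<lambda>z. \<Phi> q + 3 * \<epsilon>)"
    using r by (intro set_integrable_ball_const) simp
  have intd: "set_integrable lborel (ball q r) (\<lambda>z. \<Phi> q + 3 * \<epsilon> - u z)"
    by (rule set_integral_diff(1)[OF intc int])
  \<comment> \<open>From u \<le> \<Phi> + \<epsilon> follows |u - \<Phi>| \<le> \<Phi> - u + 2
    \<epsilon>, and the oscillation of \<Phi> costs a third \<epsilon>. The fourth one in the claim
    comes from the lower bound at \<open>q\<close>.\<close>
  have pt: "\<bar>u z - \<Phi> z\<bar> \<le> \<Phi> q + 3 * \<epsilon> - u z" if "z \<notin> t ` A" "z \<in> ball q r" for z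
    using upper[OF that(1)] \<Phi>[OF that(2)] e unfolding u_def by linarith
  have "(\<integral>\<^sup>+ z. ennreal \<bar>u z - \<Phi> z\<bar> * indicator (ball q r) z \<partial>lborel) \<le>
      (\<integral>\<^sup>+ z. ennreal (indicator (ball q r) z *\<^sub>R (\<Phi> q + 3 * \<epsilon> - u z)) \<partial>lborel)"
    using AEt by (intro nn_integral_mono_AE) (auto elim!: eventually_mono intro!: ennreal_leI pt simp: indicator_def)
  also have "\<dots> = ennreal (LINT z:ball q r|lborel. \<Phi> q + 3 * \<epsilon> - u z)"
    unfolding set_lebesgue_integral_def
  proof (rule nn_integral_eq_integral)
    show "AE z in lborel. 0 \<le> indicator (ball q r) z *\<^sub>R (\<Phi> q + 3 * \<epsilon> - u z)"
      using AEt
    proof eventually_elim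
      case (elim z)
      show ?case using order.trans[OF abs_ge_zero pt[OF elim]] by (auto simp: indicator_def)
    qed
  qed (rule intd[unfolded set_integrable_def])
  also have "(LINT z:ball q r|lborel. \<Phi> q + 3 * \<epsilon> - u z) = pi * r\<^sup>2 * (\<Phi> q + 3 * \<epsilon>) - (LINT z:ball q r|lborel. u z)"
    using r by (subst set_integral_diff(2)[OF intc int]) (simp add: set_integral_ball_const)
  also have "(LINT z:ball q r|lborel. u z) = pi * r\<^sup>2 * (K + (\<Sum>i\<in>A. m i * ball_mean_ln r (cmod (t i - q))))"
    unfolding u_def by (rule set_integral_log_potential[OF r fin])
  also have "ennreal (pi * r\<^sup>2 * (\<Phi> q + 3 * \<epsilon>) - pi * r\<^sup>2 * (K + (\<Sum>i\<in>A. m i * ball_mean_ln r (cmod (t i - q)))))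
      \<le> ennreal (4 * \<epsilon> * (pi * r\<^sup>2))"
  proof (rule ennreal_leI)
    have "u q \<le> K + (\<Sum>i\<in>A. m i * ball_mean_ln r (cmod (t i - q)))"
      unfolding u_def log_potential_def
    proof (intro add_left_mono sum_mono mult_left_mono m)
      fix i assume "i \<in> A"
      then have "t i \<noteq> q" using q by auto
      then show "ln (cmod (q - t i)) \<le> ball_mean_ln r (cmod (t i - q))"
        by (subst norm_minus_commute) (intro ln_le_ball_mean_ln r, simp)
    qed
    then have "\<Phi> q + 3 * \<epsilon> - (K + (\<Sum>i\<in>A. m i * ball_mean_ln r (cmod (t i - q)))) \<le> 4 * \<epsilon>"
      using q(2) unfolding u_def by linarith
    then have "pi * r\<^sup>2 * (\<Phi> q + 3 * \<epsilon> - (K + (\<Sum>i\<in>A. m i * ball_mean_ln r (cmod (t i - q))))) \<le> pi * r\<^sup>2 * (4 * \<epsilon>)"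
      by (intro mult_left_mono) auto
    then show "pi * r\<^sup>2 * (\<Phi> q + 3 * \<epsilon>) - pi * r\<^sup>2 * (K + (\<Sum>i\<in>A. m i * ball_mean_ln r (cmod (t i - q)))) \<le> 4 * \<epsilon> * (pi * r\<^sup>2)"
      by (simp add: algebra_simps)
  qed
  finally show ?thesis unfolding u_def .
qed

text \<open>The half-integer offsets keep the grid away from the origin.\<close>

definition offset_grid :: "nat \<Rightarrow> complex set" where
  "offset_grid N = (\<lambda>(i, j). Complex (real_of_int (2 * i + 1) / (2 * real N)) (real_of_int (2 * j + 1) / (2 * real N)))
     ` ({- int N..<int N} \<times> {- int N..<int N})"

lemma finite_offset_grid: "finite (offset_grid N)"
  by (simp add: offset_grid_def)

lemma card_offset_grid: "card (offset_grid N) \<le> 4 * N\<^sup>2"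
proof -
  have "card (offset_grid N) \<le> card ({- int N..<int N} \<times> {- int N..<int N})"
    unfolding offset_grid_def by (rule card_image_le) simp
  then show ?thesis by (simp add: card_cartesian_product power2_eq_square nat_mult_distrib mult.assoc)
qed

lemma zero_notin_offset_grid: "0 < N \<Longrightarrow> 0 \<notin> offset_grid N"
proof
  assume "0 < N" "0 \<in> offset_grid N"
  then obtain i :: int where "real_of_int (2 * i + 1) / (2 * real N) = 0"
    by (auto simp: offset_grid_def complex_eq_iff)
  then have "2 * i + 1 = 0" using \<open>0 < N\<close> by (simp only: divide_eq_0_iff of_int_eq_0_iff) auto
  then show False by presburger
qed

lemma offset_grid_dense:
  assumes N: "0 < N" and z: "cmod z < 1"
  shows "\<exists>p\<in>offset_grid N. dist p z < 1 / real N"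
proof -
  have one: "\<exists>i\<in>{- int N..<int N}. \<bar>real_of_int (2 * i + 1) / (2 * real N) - x\<bar> \<le> 1 / (2 * real N)"
    if x: "\<bar>x\<bar> < 1" for x :: real
  proof (intro bexI[of _ "\<lfloor>real N * x\<rfloor>"])
    have "\<bar>real N * x\<bar> < real N" using N x by (simp add: abs_mult)
    then have "- real N \<le> real N * x" "real N * x < real N" by linarith+
    then show "\<lfloor>real N * x\<rfloor> \<in> {- int N..<int N}" by (simp add: le_floor_iff floor_less_iff)
    have "\<bar>real_of_int (2 * \<lfloor>real N * x\<rfloor> + 1) - 2 * (real N * x)\<bar> \<le> 1"
    proof -
      have "real_of_int (2 * \<lfloor>real N * x\<rfloor> + 1) = 2 * real_of_int \<lfloor>real N * x\<rfloor> + 1" by simp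
      then show ?thesis
        using of_int_floor_le[of "real N * x"] real_of_int_floor_add_one_gt[of "real N * x"] by linarith
    qed
    then have "\<bar>real_of_int (2 * \<lfloor>real N * x\<rfloor> + 1) - 2 * (real N * x)\<bar> / (2 * real N) \<le> 1 / (2 * real N)"
      by (intro divide_right_mono) auto
    moreover have "real_of_int (2 * \<lfloor>real N * x\<rfloor> + 1) / (2 * real N) - x = (real_of_int (2 * \<lfloor>real N * x\<rfloor> + 1) - 2 * (real N * x)) / (2 * real N)"
      using N by (simp add: field_simps)
    ultimately show "\<bar>real_of_int (2 * \<lfloor>real N * x\<rfloor> + 1) / (2 * real N) - x\<bar> \<le> 1 / (2 * real N)"
      using N by (simp add: abs_divide)
  qed
  have "\<bar>Re z\<bar> < 1" "\<bar>Im z\<bar> < 1"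
    using z abs_Re_le_cmod[of z] abs_Im_le_cmod[of z] by linarith+
  then obtain i j where i: "i \<in> {- int N..<int N}" "\<bar>real_of_int (2 * i + 1) / (2 * real N) - Re z\<bar> \<le> 1 / (2 * real N)"
    and j: "j \<in> {- int N..<int N}" "\<bar>real_of_int (2 * j + 1) / (2 * real N) - Im z\<bar> \<le> 1 / (2 * real N)"
    using one by meson
  define p where "p = Complex (real_of_int (2 * i + 1) / (2 * real N)) (real_of_int (2 * j + 1) / (2 * real N))"
  \<comment> \<open>Each coordinate error may equal 1 / (2 N), so strictness needs an argument: |x|
    + |y| strictly exceeds the modulus unless a coordinate vanishes, and then a single error
    remains.\<close>
  have "cmod (p - z) < \<bar>Re (p - z)\<bar> + \<bar>Im (p - z)\<bar> \<or> cmod (p - z) < 1 / real N"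
  proof (cases "Re (p - z) = 0 \<or> Im (p - z) = 0")
    case True
    then have "cmod (p - z) \<le> 1 / (2 * real N)"
      using i j by (auto simp: cmod_def p_def)
    also have "\<dots> < 1 / real N" using N by (simp add: field_simps)
    finally show ?thesis by simp
  next
    case False
    have "(cmod (p - z))\<^sup>2 < (\<bar>Re (p - z)\<bar> + \<bar>Im (p - z)\<bar>)\<^sup>2"
      using False by (simp add: cmod_power2 power2_sum)
    then show ?thesis
      by (intro disjI1) (rule power2_less_imp_less, assumption, intro add_nonneg_nonneg abs_ge_zero)
  qed
  moreover have "\<bar>Re (p - z)\<bar> + \<bar>Im (p - z)\<bar> \<le> 1 / (2 * real N) + 1 / (2 * real N)"
    using i j by (intro add_mono) (auto simp: p_def)
  ultimately have "dist p z < 1 / real N"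
    using N by (auto simp: dist_norm)
  moreover have "p \<in> offset_grid N" using i j by (auto simp: offset_grid_def p_def)
  ultimately show ?thesis by blast
qed

text \<open>The disc of radius \<open>R\<close> is covered by balls of radius 1 / N around grid
  points in the open unit disc, which is ensured by R + 1 / N \<le> 1. Each lies in the ball of
  radius 2 / N around a good point \<open>q\<close>. At most 4 N^2 balls contribute 4 \<epsilon>
  \<pi> (2 / N)^2 each, which gives 64 \<pi> \<epsilon>.\<close>

lemma nn_integral_log_potential_diff:
  assumes N: "0 < N" and R: "R + 1 / real N \<le> 1" and fin: "finite A" and m: "\<And>i. i \<in> A \<Longrightarrow> 0 \<le> m i"
    and [measurable]: "\<Phi> \<in> borel_measurable borel" and e: "0 \<le> \<epsilon>"
    and upper: "\<And>z. z \<notin> t ` A \<Longrightarrow> log_potential K A m t z \<le> \<Phi> z + \<epsilon>"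
    and q: "\<And>p. p \<in> offset_grid N \<Longrightarrow> cmod p < 1 \<Longrightarrow>
      \<exists>q\<in>ball p (1 / real N). q \<notin> t ` A \<and> \<Phi> q - \<epsilon> \<le> log_potential K A m t q"
    and \<Phi>: "\<And>z q. cmod q < 2 \<Longrightarrow> dist q z < 2 / real N \<Longrightarrow> \<bar>\<Phi> z - \<Phi> q\<bar> \<le> \<epsilon>"
  shows "(\<integral>\<^sup>+ z. ennreal \<bar>log_potential K A m t z - \<Phi> z\<bar> * indicator (ball 0 R) z \<partial>lborel) \<le> ennreal (64 * pi * \<epsilon>)"
proof -
  define G where "G = {p \<in> offset_grid N. cmod p < 1}"
  have finG: "finite G" by (simp add: G_def finite_offset_grid)
  define f where "f z = ennreal \<bar>log_potential K A m t z - \<Phi> z\<bar>" for z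
  have [measurable]: "f \<in> borel_measurable borel" unfolding f_def by measurable
  have "(\<integral>\<^sup>+ z. f z * indicator (ball 0 R) z \<partial>lborel) \<le> (\<integral>\<^sup>+ z. (\<Sum>p\<in>G. f z * indicator (ball p (1 / real N)) z) \<partial>lborel)"
  proof (rule nn_integral_mono)
    fix z
    show "f z * indicator (ball 0 R) z \<le> (\<Sum>p\<in>G. f z * indicator (ball p (1 / real N)) z)"
    proof (cases "z \<in> ball 0 R")
      case True
      moreover have "R < 1" using R N by (smt (verit) divide_pos_pos of_nat_0_less_iff)
      ultimately have z1: "cmod z < 1" by simp
      obtain p where p: "p \<in> offset_grid N" "dist p z < 1 / real N"
        using offset_grid_dense[OF N z1] by blast
      have "cmod p \<le> cmod z + dist p z" using norm_triangle_sub[of p z] by (simp add: dist_norm)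
      then have "cmod p < 1" using True R p(2) by simp
      then have "p \<in> G" using p by (simp add: G_def)
      then have "f z * indicator (ball p (1 / real N)) z \<le> (\<Sum>p\<in>G. f z * indicator (ball p (1 / real N)) z)"
        using finG by (intro member_le_sum) auto
      then show ?thesis using True p by simp
    qed simp
  qed
  also have "\<dots> = (\<Sum>p\<in>G. \<integral>\<^sup>+ z. f z * indicator (ball p (1 / real N)) z \<partial>lborel)"
    by (rule nn_integral_sum) measurable
  also have "\<dots> \<le> (\<Sum>p\<in>G. ennreal (4 * \<epsilon> * (pi * (2 / real N)\<^sup>2)))"
  proof (rule sum_mono)
    fix p assume "p \<in> G"
    then obtain q where q: "dist p q < 1 / real N" "q \<notin> t ` A" "\<Phi> q - \<epsilon> \<le> log_potential K A m t q" and p: "cmod p < 1"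
      using q[of p] by (auto simp: G_def)
    have "cmod q \<le> cmod p + dist p q" using norm_triangle_sub[of q p] by (simp add: dist_norm norm_minus_commute)
    moreover have "1 / real N \<le> 1" using N by simp
    ultimately have q2: "cmod q < 2" using p q by linarith
    have "ball p (1 / real N) \<subseteq> ball q (2 / real N)"
    proof
      fix z assume z: "z \<in> ball p (1 / real N)"
      have "dist q z \<le> dist p q + dist p z" by (rule dist_triangle3)
      then show "z \<in> ball q (2 / real N)" using z q(1) by simp
    qed
    then have "(\<integral>\<^sup>+ z. f z * indicator (ball p (1 / real N)) z \<partial>lborel) \<le> (\<integral>\<^sup>+ z. f z * indicator (ball q (2 / real N)) z \<partial>lborel)"
      by (intro nn_integral_mono) (auto simp: indicator_def)
    also have "\<dots> \<le> ennreal (4 * \<epsilon> * (pi * (2 / real N)\<^sup>2))"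
      unfolding f_def by (rule nn_integral_ball_log_potential_diff) (use N fin m upper q q2 \<Phi> in auto)
    finally show "(\<integral>\<^sup>+ z. f z * indicator (ball p (1 / real N)) z \<partial>lborel) \<le> ennreal (4 * \<epsilon> * (pi * (2 / real N)\<^sup>2))" .
  qed
  also have "\<dots> = ennreal (real (card G) * (4 * \<epsilon> * (pi * (2 / real N)\<^sup>2)))"
    using e by (simp add: ennreal_mult ennreal_of_nat_eq_real_of_nat)
  also have "\<dots> \<le> ennreal (64 * pi * \<epsilon>)"
  proof (rule ennreal_leI)
    have "card G \<le> card (offset_grid N)"
      unfolding G_def by (rule card_mono) (auto simp: finite_offset_grid)
    then have "real (card G) \<le> real (4 * N\<^sup>2)" using card_offset_grid[of N] by linarith
    then have "real (card G) * (4 * \<epsilon> * (pi * (2 / real N)\<^sup>2)) \<le> real (4 * N\<^sup>2) * (4 * \<epsilon> * (pi * (2 / real N)\<^sup>2))"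
      using e by (intro mult_right_mono) auto
    also have "\<dots> = 64 * pi * \<epsilon>" using N by (simp add: power_divide)
    finally show "real (card G) * (4 * \<epsilon> * (pi * (2 / real N)\<^sup>2)) \<le> 64 * pi * \<epsilon>" .
  qed
  finally show ?thesis unfolding f_def .
qed

section \<open>From potentials to measures\<close>

lemma AE_radial_measure_less: "AE z in radial_measure \<gamma> R. cmod z < R"
  unfolding radial_measure_def by (subst AE_density) (auto simp: indicator_def)

lemma prob_space_radial_measure:
  assumes "0 < \<gamma>"
  shows "prob_space (radial_measure \<gamma> 1)"
proof
  have "emeasure (radial_measure \<gamma> 1) UNIV = emeasure (radial_measure \<gamma> 1) {z. cmod z < 1}"
    using AE_radial_measure_less[where \<gamma> = \<gamma> and R = 1] by (intro emeasure_eq_AE) auto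
  then show "emeasure (radial_measure \<gamma> 1) (space (radial_measure \<gamma> 1)) = 1"
    using assms by (simp add: radial_measure_ball)
qed

text \<open>Fubini for ln |z - a| with \<open>a\<close> distributed by the radial measure and
  \<open>z\<close> in the disc. Integrating first in \<open>a\<close> gives the potential of the
  measure at \<open>z\<close>, which has its inner form since the disc lies in the unit
  disc.\<close>

lemma integral_ball_mean_ln_radial_measure:
  assumes g: "0 < \<gamma>" and r: "0 < r" and cr: "cmod c + r \<le> 1"
  shows "integrable (radial_measure \<gamma> 1) (\<lambda>a. ball_mean_ln r (cmod (a - c)))"
    and "(\<integral>a. ball_mean_ln r (cmod (a - c)) \<partial>radial_measure \<gamma> 1) * (pi * r\<^sup>2) =
      (LINT z:ball c r|lborel. cmod z powr \<gamma> / \<gamma> - 1 / \<gamma>)"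
proof -
  define \<mu> where "\<mu> = radial_measure \<gamma> 1"
  interpret \<mu>: prob_space \<mu> unfolding \<mu>_def by (rule prob_space_radial_measure[OF g])
  interpret P: pair_sigma_finite \<mu> "lborel :: complex measure" ..
  have [measurable_cong]: "sets \<mu> = sets borel" by (simp add: \<mu>_def)
  have AE1: "AE a in \<mu>. cmod a < 1" unfolding \<mu>_def by (rule AE_radial_measure_less)
  have r1: "r \<le> 1" using cr norm_ge_zero[of c] by linarith
  define B where "B = \<bar>ln r\<bar> + 1 / 2 + ln 2"
  have mm: "\<bar>ball_mean_ln r (cmod (a - c))\<bar> \<le> B" if "cmod a < 1" for a
  proof -
    define b where "b = cmod (a - c)"
    have b: "b \<le> 2" using norm_triangle_ineq4[of a c] that cr r unfolding b_def by linarith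
    have "min r b \<le> r" "0 \<le> min r b" using r by (auto simp: b_def)
    then have "(min r b)\<^sup>2 \<le> r\<^sup>2" by (intro power_mono)
    then have "(min r b)\<^sup>2 / (2 * r\<^sup>2) \<le> 1 / 2" using r by (simp add: field_simps)
    moreover have "ln (max r b) \<le> ln 2" using r r1 b by (intro ln_mono) auto
    ultimately have "ball_mean_ln r b \<le> ln 2" by (simp add: ball_mean_ln_def)
    moreover have "ln r - 1 / 2 \<le> ball_mean_ln r b" by (rule ball_mean_ln_ge[OF r])
    moreover have "0 \<le> ln (2::real)" by simp
    ultimately show ?thesis unfolding B_def b_def by linarith
  qed
  have "integrable \<mu> (\<lambda>a. ball_mean_ln r (cmod (a - c)))"
    by (rule \<mu>.integrable_const_bound[where B = B]) (use AE1 in \<open>auto elim!: eventually_mono intro: mm\<close>)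
  then show "integrable (radial_measure \<gamma> 1) (\<lambda>a. ball_mean_ln r (cmod (a - c)))"
    by (simp add: \<mu>_def)
  define f where "f a z = indicator (ball c r) z * ln (cmod (z - a))" for a z
  have fz: "integrable lborel (f a)" "(\<integral>z. f a z \<partial>lborel) = pi * r\<^sup>2 * ball_mean_ln r (cmod (a - c))" for a
    using set_integrable_ball_ln[OF r, of c a] set_integral_ball_ln[OF r, of c a]
    by (simp_all add: f_def[abs_def] set_integrable_def set_lebesgue_integral_def)
  have intc: "integrable lborel (\<lambda>z. indicator (ball c r) z * K)"
      "(\<integral>z. indicator (ball c r) z * K \<partial>lborel) = pi * r\<^sup>2 * K" for K
    using set_integrable_ball_const[of r c K] set_integral_ball_const[of r c K] r
    by (simp_all only: set_integrable_def set_lebesgue_integral_def real_scaleR_def less_imp_le)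
  have meas[measurable]: "(\<lambda>(a, z). f a z) \<in> borel_measurable (\<mu> \<Otimes>\<^sub>M lborel)"
    unfolding f_def by measurable
  have zin: "cmod z < 1" if "z \<in> ball c r" for z
    using that norm_triangle_sub[of z c] cr by (simp add: dist_norm norm_minus_commute)
  have "integrable (\<mu> \<Otimes>\<^sub>M lborel) (\<lambda>(a, z). f a z)"
  proof (rule P.Fubini_integrable[OF meas])
    show "integrable \<mu> (\<lambda>a. \<integral>z. norm (case (a, z) of (a, z) \<Rightarrow> f a z) \<partial>lborel)"
    proof (rule \<mu>.integrable_const_bound)
      show "AE a in \<mu>. norm (\<integral>z. norm (case (a, z) of (a, z) \<Rightarrow> f a z) \<partial>lborel) \<le> pi * r\<^sup>2 * (2 * ln 2) + pi * r\<^sup>2 * B"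
        using AE1
      proof eventually_elim
        case (elim a)
        \<comment> \<open>Both points lie in the unit disc, so ln |z - a| \<le> ln 2 and |ln |z -
          a|| \<le> 2 ln 2 - ln |z - a|. The absolute integral is thus controlled by the integral
          already computed.\<close>
        have "(\<integral>z. norm (f a z) \<partial>lborel) \<le> (\<integral>z. indicator (ball c r) z * (2 * ln 2) - f a z \<partial>lborel)"
        proof (rule integral_mono)
          fix z
          show "norm (f a z) \<le> indicator (ball c r) z * (2 * ln 2) - f a z"
          proof (cases "z \<in> ball c r \<and> z \<noteq> a")
            case True
            have "cmod (z - a) \<le> 2" using zin[of z] elim True norm_triangle_ineq4[of z a] by linarith
            then have "ln (cmod (z - a)) \<le> ln 2" using True by (intro ln_mono) auto
            then show ?thesis using True by (auto simp: f_def abs_if)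
          qed (auto simp: f_def indicator_def)
        qed (intro integrable_norm fz Bochner_Integration.integrable_diff intc)+
        also have "\<dots> = pi * r\<^sup>2 * (2 * ln 2) - pi * r\<^sup>2 * ball_mean_ln r (cmod (a - c))"
          by (subst Bochner_Integration.integral_diff[OF intc(1) fz(1)]) (simp only: intc fz)
        also have "\<dots> \<le> pi * r\<^sup>2 * (2 * ln 2) + pi * r\<^sup>2 * B"
        proof -
          have "pi * r\<^sup>2 * (- ball_mean_ln r (cmod (a - c))) \<le> pi * r\<^sup>2 * B"
            using mm[OF elim] by (intro mult_left_mono) (auto simp: abs_le_iff)
          then show ?thesis by simp
        qed
        finally show ?case by (simp add: abs_of_nonneg)
      qed
    qed measurable
  qed (auto simp: fz)
  from P.Fubini_integral[OF this]
  have "(\<integral>z. (\<integral>a. f a z \<partial>\<mu>) \<partial>lborel) = (\<integral>a. (\<integral>z. f a z \<partial>lborel) \<partial>\<mu>)" .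
  also have "\<dots> = (\<integral>a. ball_mean_ln r (cmod (a - c)) \<partial>\<mu>) * (pi * r\<^sup>2)"
    by (simp add: fz mult.commute)
  also have "(\<integral>z. (\<integral>a. f a z \<partial>\<mu>) \<partial>lborel) = (LINT z:ball c r|lborel. cmod z powr \<gamma> / \<gamma> - 1 / \<gamma>)"
    unfolding set_lebesgue_integral_def
  proof (rule Bochner_Integration.integral_cong[OF refl])
    fix z :: complex
    have "(\<integral>a. f a z \<partial>\<mu>) = indicator (ball c r) z * (\<integral>a. ln (cmod (a - z)) \<partial>\<mu>)"
      unfolding f_def by (subst norm_minus_commute) simp
    also have "\<dots> = indicator (ball c r) z *\<^sub>R (cmod z powr \<gamma> / \<gamma> - 1 / \<gamma>)"
      using zin[of z] g by (auto simp: indicator_def \<mu>_def integral_radial_ln_dist)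
    finally show "(\<integral>a. f a z \<partial>\<mu>) = indicator (ball c r) z *\<^sub>R (cmod z powr \<gamma> / \<gamma> - 1 / \<gamma>)" .
  qed
  finally show "(\<integral>a. ball_mean_ln r (cmod (a - c)) \<partial>radial_measure \<gamma> 1) * (pi * r\<^sup>2) =
      (LINT z:ball c r|lborel. cmod z powr \<gamma> / \<gamma> - 1 / \<gamma>)"
    by (simp add: \<mu>_def)
qed

section \<open>Bumps and approximate identities\<close>

definition bump :: "real \<Rightarrow> real \<Rightarrow> real" where
  "bump r b = ball_mean_ln r b - ball_mean_ln (r / 2) b"

lemma measurable_bump [measurable]: "bump r \<in> borel_measurable borel"
  unfolding bump_def by measurable

lemma continuous_on_bump [continuous_intros]:
  "0 < r \<Longrightarrow> continuous_on S f \<Longrightarrow> continuous_on S (\<lambda>x. bump r (f x))"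
  unfolding bump_def by (intro continuous_intros) auto

lemma bump_outside: "0 < r \<Longrightarrow> r \<le> b \<Longrightarrow> bump r b = 0"
  by (simp add: bump_def ball_mean_ln_outside)

text \<open>Here the bump equals ln 2 - (3 / 2) (b / r)^2, at least 2 / 3 - 3 / 8. Any positive
  bound would do; it makes the total integral positive.\<close>

lemma bump_inside:
  assumes r: "0 < r" and b: "0 \<le> b" "b \<le> r / 2"
  shows "1 / 4 \<le> bump r b"
proof -
  have "bump r b = ln r - ln (r / 2) + b\<^sup>2 / (2 * r\<^sup>2) - b\<^sup>2 / (2 * (r / 2)\<^sup>2)"
    using assms by (simp add: bump_def ball_mean_ln_def)
  also have "ln r - ln (r / 2) = ln 2" using r by (simp add: ln_div)
  also have "b\<^sup>2 / (2 * (r / 2)\<^sup>2) = 2 * (b\<^sup>2 / r\<^sup>2)" by (simp add: power_divide)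
  finally have *: "bump r b = ln 2 - 3 / 2 * (b\<^sup>2 / r\<^sup>2)" by simp
  have "b\<^sup>2 \<le> (r / 2)\<^sup>2" using b by (intro power_mono) auto
  then have "b\<^sup>2 / r\<^sup>2 \<le> 1 / 4" using r by (simp add: field_simps power2_eq_square)
  then show ?thesis using ln2_ge_two_thirds unfolding * by linarith
qed

text \<open>Beyond r / 2 the smaller disc mean already equals ln b, so this is again the sub-mean
  value property for the larger disc.\<close>

lemma bump_nonneg:
  assumes r: "0 < r" and b: "0 \<le> b"
  shows "0 \<le> bump r b"
proof (cases "b \<le> r / 2")
  case True
  then show ?thesis using bump_inside[OF assms] by linarith
next
  case False
  then show ?thesis
    using ln_le_ball_mean_ln[of r b] ball_mean_ln_outside[of "r / 2" b] r by (simp add: bump_def)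
qed

lemma integrable_continuous_bump:
  fixes \<phi> :: "complex \<Rightarrow> real"
  assumes r: "0 < r" and \<phi>: "continuous_on UNIV \<phi>"
  shows "integrable lborel (\<lambda>c. \<phi> c * bump r (cmod (a - c)))"
proof -
  have "integrable lborel (\<lambda>c. indicator (cball a r) c *\<^sub>R (\<phi> c * bump r (cmod (a - c))))"
    by (rule borel_integrable_compact) (use r \<phi> in \<open>auto intro!: continuous_intros intro: continuous_on_subset\<close>)
  also have "(\<lambda>c. indicator (cball a r) c *\<^sub>R (\<phi> c * bump r (cmod (a - c)))) = (\<lambda>c. \<phi> c * bump r (cmod (a - c)))"
    using bump_outside[OF r] by (auto simp: fun_eq_iff indicator_def dist_norm)
  finally show ?thesis .
qed

lemma integral_bump_shift:
  assumes "0 < r"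
  shows "(\<integral>c. bump r (cmod (a - c)) \<partial>lborel) = (\<integral>c. bump r (cmod c) \<partial>lborel)"
proof -
  have "(\<integral>c. bump r (cmod (a - c)) \<partial>lborel) = (\<integral>c. bump r (cmod (a - c)) \<partial>distr lborel borel ((+) a))"
    by (simp add: lborel_distr_plus)
  also have "\<dots> = (\<integral>c. bump r (cmod (a - (a + c))) \<partial>lborel)"
    by (rule integral_distr) auto
  finally show ?thesis by simp
qed

lemma integral_bump_pos:
  assumes r: "0 < r"
  shows "0 < (\<integral>c. bump r (cmod c) \<partial>(lborel :: complex measure))"
proof -
  have c: "set_integrable lborel (ball (0::complex) (r / 2)) (\<lambda>c. 1 / 4 :: real)"
    "(LINT z:ball (0::complex) (r / 2)|lborel. 1 / 4 :: real) = pi * (r / 2)\<^sup>2 * (1 / 4)"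
    using set_integrable_ball_const[of "r / 2" 0 "1 / 4"] set_integral_ball_const[of "r / 2" 0 "1 / 4"] r by auto
  have "0 < pi * (r / 2)\<^sup>2 * (1 / 4)" using r by simp
  also have "\<dots> = (\<integral>c. indicator (ball (0::complex) (r / 2)) c *\<^sub>R (1 / 4) \<partial>lborel)"
    using c(2) by (simp only: set_lebesgue_integral_def)
  also have "\<dots> \<le> (\<integral>c. bump r (cmod (c :: complex)) \<partial>lborel)"
  proof (rule integral_mono)
    show "integrable lborel (\<lambda>c. indicator (ball (0::complex) (r / 2)) c *\<^sub>R (1 / 4 :: real))"
      using c(1) by (simp only: set_integrable_def)
    show "integrable lborel (\<lambda>c :: complex. bump r (cmod c))"
      using integrable_continuous_bump[OF r, of "\<lambda>_. 1" 0] by simp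
    show "indicator (ball 0 (r / 2)) c *\<^sub>R (1 / 4) \<le> bump r (cmod c)" for c :: complex
      using bump_inside[OF r, of "cmod c"] bump_nonneg[OF r, of "cmod c"] by (auto simp: indicator_def)
  qed
  finally show ?thesis .
qed

text \<open>Only centres within distance \<open>r\<close> of \<open>a\<close> contribute, and there
  \<phi> varies by at most \<open>e\<close>. The bump is not normalised, so its total integral
  appears on both sides.\<close>

lemma bump_approximate_identity:
  fixes \<phi> :: "complex \<Rightarrow> real"
  assumes r: "0 < r" and \<phi>: "continuous_on UNIV \<phi>" and osc: "\<And>x y. dist x y < r \<Longrightarrow> \<bar>\<phi> x - \<phi> y\<bar> \<le> e"
  shows "\<bar>\<phi> a * (\<integral>c. bump r (cmod c) \<partial>(lborel :: complex measure)) - (\<integral>c. \<phi> c * bump r (cmod (a - c)) \<partial>lborel)\<bar>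
    \<le> e * (\<integral>c. bump r (cmod c) \<partial>(lborel :: complex measure))"
proof -
  have int: "integrable lborel (\<lambda>c. \<psi> c * bump r (cmod (a - c)))" if "continuous_on UNIV \<psi>" for \<psi> :: "complex \<Rightarrow> real"
    by (rule integrable_continuous_bump[OF r that])
  have "\<phi> a * (\<integral>c. bump r (cmod c) \<partial>(lborel :: complex measure)) - (\<integral>c. \<phi> c * bump r (cmod (a - c)) \<partial>lborel)
    = (\<integral>c. \<phi> a * bump r (cmod (a - c)) \<partial>lborel) - (\<integral>c. \<phi> c * bump r (cmod (a - c)) \<partial>lborel)"
    using integral_bump_shift[OF r, of a] by simp
  also have "\<dots> = (\<integral>c. \<phi> a * bump r (cmod (a - c)) - \<phi> c * bump r (cmod (a - c)) \<partial>lborel)"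
    by (rule Bochner_Integration.integral_diff[symmetric]) (intro int continuous_intros \<phi>)+
  also have "\<dots> = (\<integral>c. (\<phi> a - \<phi> c) * bump r (cmod (a - c)) \<partial>lborel)"
    by (simp add: algebra_simps)
  also have "\<bar>\<dots>\<bar> \<le> (\<integral>c. e * bump r (cmod (a - c)) \<partial>lborel)"
    unfolding real_norm_def[symmetric]
  proof (rule Bochner_Integration.integral_norm_bound_integral)
    fix c
    show "norm ((\<phi> a - \<phi> c) * bump r (cmod (a - c))) \<le> e * bump r (cmod (a - c))"
    proof (cases "dist a c < r")
      case True
      then show ?thesis
        using osc[OF True] bump_nonneg[OF r, of "cmod (a - c)"] by (simp add: abs_mult mult_right_mono)
    next
      case False
      then show ?thesis using bump_outside[OF r, of "cmod (a - c)"] by (simp add: dist_norm)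
    qed
  qed (intro int continuous_intros \<phi>)+
  also have "\<dots> = e * (\<integral>c. bump r (cmod c) \<partial>(lborel :: complex measure))"
    using integral_bump_shift[OF r, of a] by simp
  finally show ?thesis .
qed

section \<open>From closeness of potentials to convergence of measures\<close>

text \<open>Turns a sum over zeros into area integrals of the potential, which an L1 bound controls.
  The constant \<open>K\<close> cancels between the two radii.\<close>

lemma integral_bump_log_potential:
  assumes r: "0 < r" and fin: "finite A"
  shows "(\<Sum>i\<in>A. m i * bump r (cmod (t i - c))) =
    (LINT z:ball c r|lborel. log_potential K A m t z) / (pi * r\<^sup>2) -
    (LINT z:ball c (r / 2)|lborel. log_potential K A m t z) / (pi * (r / 2)\<^sup>2)"
proof -
  have "(LINT z:ball c s|lborel. log_potential K A m t z) / (pi * s\<^sup>2) = K + (\<Sum>i\<in>A. m i * ball_mean_ln s (cmod (t i - c)))"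
    if "0 < s" for s
    using that by (simp add: set_integral_log_potential[OF that fin])
  from this[of r] this[of "r / 2"] show ?thesis
    using r by (simp add: bump_def right_diff_distrib sum_subtractf)
qed

lemma set_integrable_continuous_ball:
  fixes f :: "complex \<Rightarrow> real"
  assumes "continuous_on UNIV f"
  shows "set_integrable lborel (ball c r) f"
proof -
  have "set_integrable lborel (cball c r) f"
    unfolding set_integrable_def
    by (rule borel_integrable_compact) (use assms in \<open>auto intro: continuous_on_subset\<close>)
  then show ?thesis
    by (rule set_integrable_subset) auto
qed

lemma continuous_on_radial_potential:
  fixes f :: "'b::topological_space \<Rightarrow> complex"
  assumes "0 < \<gamma>" "continuous_on S f"
  shows "continuous_on S (\<lambda>z. cmod (f z) powr \<gamma> / \<gamma>)"
  using assms by (intro continuous_intros continuous_on_powr') auto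

lemma integral_bump_radial_measure:
  assumes g: "0 < \<gamma>" and r: "0 < r" and cr: "cmod c + r \<le> 1"
  shows "(\<integral>a. bump r (cmod (a - c)) \<partial>radial_measure \<gamma> 1) =
    (LINT z:ball c r|lborel. cmod z powr \<gamma> / \<gamma>) / (pi * r\<^sup>2) -
    (LINT z:ball c (r / 2)|lborel. cmod z powr \<gamma> / \<gamma>) / (pi * (r / 2)\<^sup>2)"
proof -
  have *: "integrable (radial_measure \<gamma> 1) (\<lambda>a. ball_mean_ln s (cmod (a - c)))"
    "(\<integral>a. ball_mean_ln s (cmod (a - c)) \<partial>radial_measure \<gamma> 1) = (LINT z:ball c s|lborel. cmod z powr \<gamma> / \<gamma>) / (pi * s\<^sup>2) - 1 / \<gamma>"
    if s: "0 < s" "cmod c + s \<le> 1" for s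
  proof -
    show "integrable (radial_measure \<gamma> 1) (\<lambda>a. ball_mean_ln s (cmod (a - c)))"
      by (rule integral_ball_mean_ln_radial_measure(1)[OF g s])
    have "(\<integral>a. ball_mean_ln s (cmod (a - c)) \<partial>radial_measure \<gamma> 1) * (pi * s\<^sup>2) =
      (LINT z:ball c s|lborel. cmod z powr \<gamma> / \<gamma> - 1 / \<gamma>)"
      by (rule integral_ball_mean_ln_radial_measure(2)[OF g s])
    also have "\<dots> = (LINT z:ball c s|lborel. cmod z powr \<gamma> / \<gamma>) - (LINT z:ball c s|lborel. 1 / \<gamma>)"
      by (rule set_integral_diff(2))
         (use s in \<open>auto intro!: set_integrable_continuous_ball continuous_on_radial_potential continuous_intros g\<close>)
    also have "(LINT z:ball c s|lborel. 1 / \<gamma>) = pi * s\<^sup>2 * (1 / \<gamma>)"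
      using s by (intro set_integral_ball_const) auto
    finally have *: "(\<integral>a. ball_mean_ln s (cmod (a - c)) \<partial>radial_measure \<gamma> 1) * (pi * s\<^sup>2) =
        (LINT z:ball c s|lborel. cmod z powr \<gamma> / \<gamma>) - pi * s\<^sup>2 * (1 / \<gamma>)" .
    have "I = X / P - q" if "I * P = X - P * q" "0 < P" for I P X q :: real
      using that by (simp add: field_simps)
    from this[OF *] show "(\<integral>a. ball_mean_ln s (cmod (a - c)) \<partial>radial_measure \<gamma> 1) = (LINT z:ball c s|lborel. cmod z powr \<gamma> / \<gamma>) / (pi * s\<^sup>2) - 1 / \<gamma>"
      using s by simp
  qed
  show ?thesis
    unfolding bump_def using r cr
    by (subst Bochner_Integration.integral_diff) (auto intro!: * simp: *(2))
qed

lemma set_integral_ball_diff_le: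
  fixes u v :: "complex \<Rightarrow> real"
  assumes u: "set_integrable lborel (ball c r) u" and v: "set_integrable lborel (ball c r) v" and E: "0 \<le> E"
    and le: "(\<integral>\<^sup>+ z. ennreal \<bar>u z - v z\<bar> * indicator (ball 0 R) z \<partial>lborel) \<le> ennreal E"
    and cr: "cmod c + r \<le> R"
  shows "\<bar>(LINT z:ball c r|lborel. u z) - (LINT z:ball c r|lborel. v z)\<bar> \<le> E"
proof -
  have sub: "ball c r \<subseteq> ball 0 R"
  proof
    fix z assume "z \<in> ball c r"
    then show "z \<in> ball 0 R"
      using norm_triangle_sub[of z c] cr by (simp add: dist_norm norm_minus_commute)
  qed
  have int: "integrable lborel (\<lambda>z. indicator (ball c r) z *\<^sub>R (u z - v z))"
    using set_integral_diff(1)[OF u v] by (simp only: set_integrable_def)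
  have "(LINT z:ball c r|lborel. u z) - (LINT z:ball c r|lborel. v z) = (LINT z:ball c r|lborel. u z - v z)"
    by (rule set_integral_diff(2)[OF u v, symmetric])
  then have "ennreal \<bar>(LINT z:ball c r|lborel. u z) - (LINT z:ball c r|lborel. v z)\<bar> =
      ennreal (norm (\<integral>z. indicator (ball c r) z *\<^sub>R (u z - v z) \<partial>lborel))"
    by (simp add: set_lebesgue_integral_def)
  also have "\<dots> \<le> (\<integral>\<^sup>+ z. ennreal (norm (indicator (ball c r) z *\<^sub>R (u z - v z))) \<partial>lborel)"
    by (rule integral_norm_bound_ennreal[OF int])
  also have "\<dots> \<le> (\<integral>\<^sup>+ z. ennreal \<bar>u z - v z\<bar> * indicator (ball 0 R) z \<partial>lborel)"
    by (rule nn_integral_mono) (use sub in \<open>auto simp: indicator_def\<close>)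
  also note le
  finally show ?thesis using E by simp
qed

lemma bump_sum_radial_measure_close:
  assumes g: "0 < \<gamma>" and r: "0 < r" and cr: "cmod c + r \<le> R" and R: "R \<le> 1" and fin: "finite A" and E: "0 \<le> E"
    and le: "(\<integral>\<^sup>+ z. ennreal \<bar>log_potential K A m t z - cmod z powr \<gamma> / \<gamma>\<bar> * indicator (ball 0 R) z \<partial>lborel) \<le> ennreal E"
  shows "\<bar>(\<Sum>i\<in>A. m i * bump r (cmod (t i - c))) - (\<integral>a. bump r (cmod (a - c)) \<partial>radial_measure \<gamma> 1)\<bar> \<le> 5 * E / (pi * r\<^sup>2)"
proof -
  define \<Phi> where "\<Phi> z = cmod z powr \<gamma> / \<gamma>" for z
  have \<Phi>: "set_integrable lborel (ball c s) \<Phi>" for s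
    unfolding \<Phi>_def by (intro set_integrable_continuous_ball continuous_on_radial_potential g continuous_intros)
  have D: "\<bar>(LINT z:ball c s|lborel. log_potential K A m t z) - (LINT z:ball c s|lborel. \<Phi> z)\<bar> \<le> E" if "0 < s" "s \<le> r" for s
    by (rule set_integral_ball_diff_le[OF set_integrable_log_potential[OF that(1) fin] \<Phi> E le[folded \<Phi>_def]]) (use cr that in auto)
  define x where "x = (LINT z:ball c r|lborel. log_potential K A m t z) - (LINT z:ball c r|lborel. \<Phi> z)"
  define y where "y = (LINT z:ball c (r / 2)|lborel. log_potential K A m t z) - (LINT z:ball c (r / 2)|lborel. \<Phi> z)"
  have "(\<Sum>i\<in>A. m i * bump r (cmod (t i - c))) - (\<integral>a. bump r (cmod (a - c)) \<partial>radial_measure \<gamma> 1)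
      = x / (pi * r\<^sup>2) - y / (pi * (r / 2)\<^sup>2)"
    unfolding integral_bump_log_potential[OF r fin, of m t c K]
    by (subst integral_bump_radial_measure[OF g r]) (use cr R in \<open>auto simp: x_def y_def \<Phi>_def diff_divide_distrib\<close>)
  \<comment> \<open>Normalising by the area of the disc of half the radius multiplies that error by
    4, hence 5 = 1 + 4 in the bound.\<close>
  also have "\<dots> = (x - 4 * y) / (pi * r\<^sup>2)"
    using r by (simp add: field_simps)
  also have "\<bar>\<dots>\<bar> \<le> 5 * E / (pi * r\<^sup>2)"
  proof -
    have "\<bar>x\<bar> \<le> E" "\<bar>y\<bar> \<le> E" unfolding x_def y_def using r by (auto intro!: D)
    then have "\<bar>x - 4 * y\<bar> \<le> 5 * E" by linarith
    then show ?thesis using r by (simp add: abs_divide abs_mult divide_right_mono)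
  qed
  finally show ?thesis .
qed

text \<open>The grid is fixed by the uniform continuity of \<Phi> before \<open>n\<close> grows, so
  finitely many lower bounds are needed and they eventually hold together. \<open>lower\<close>
  compares with \<Phi> at the grid point \<open>p\<close>; half of \<epsilon> is reserved for
  passing to \<Phi> at the good point \<open>q\<close>.\<close>

lemma log_potential_L1_small:
  fixes A :: "nat \<Rightarrow> 'i set"
  assumes g: "0 < \<gamma>"
    and weights: "\<forall>\<^sub>F n in sequentially. finite (A n) \<and> (\<forall>i\<in>A n. 0 \<le> m n i) \<and> sum (m n) (A n) \<le> 1"
    and upper: "\<And>\<epsilon>. 0 < \<epsilon> \<Longrightarrow> \<forall>\<^sub>F n in sequentially. \<forall>z. z \<notin> t n ` A n \<longrightarrow>
      log_potential (K n) (A n) (m n) (t n) z \<le> cmod z powr \<gamma> / \<gamma> + \<epsilon>"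
    and lower: "\<And>\<epsilon> N p. 0 < \<epsilon> \<Longrightarrow> 0 < N \<Longrightarrow> p \<in> offset_grid N \<Longrightarrow> cmod p < 1 \<Longrightarrow>
      \<forall>\<^sub>F n in sequentially. \<exists>z\<in>ball p (1 / real N). z \<notin> t n ` A n \<and>
        cmod p powr \<gamma> / \<gamma> - \<epsilon> \<le> log_potential (K n) (A n) (m n) (t n) z"
    and R: "R < 1" and e: "0 < e"
  shows "\<forall>\<^sub>F n in sequentially. (\<integral>\<^sup>+ z. ennreal \<bar>log_potential (K n) (A n) (m n) (t n) z - cmod z powr \<gamma> / \<gamma>\<bar>
    * indicator (ball 0 R) z \<partial>lborel) \<le> ennreal e"
proof -
  define \<Phi> where "\<Phi> z = cmod z powr \<gamma> / \<gamma>" for z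
  have cont: "continuous_on S \<Phi>" for S
    unfolding \<Phi>_def by (intro continuous_on_radial_potential g continuous_intros)
  then have [measurable]: "\<Phi> \<in> borel_measurable borel"
    by (rule borel_measurable_continuous_onI)
  define \<epsilon> where "\<epsilon> = e / (64 * pi)"
  have eps: "0 < \<epsilon>" using e by (simp add: \<epsilon>_def)
  \<comment> \<open>Radius 4 contains every \<open>q\<close> with |q| < 2 and every point within 2 /
    N \<le> 2 of it.\<close>
  have "uniformly_continuous_on (cball 0 4) \<Phi>"
    by (rule compact_uniformly_continuous[OF cont]) simp
  then obtain d where d: "0 < d" "\<And>x y. x \<in> cball 0 4 \<Longrightarrow> y \<in> cball 0 4 \<Longrightarrow> dist y x < d \<Longrightarrow> dist (\<Phi> y) (\<Phi> x) < \<epsilon> / 2"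
    using eps unfolding uniformly_continuous_on_def by (meson half_gt_zero)
  obtain N :: nat where N: "max (2 / d) (max 1 (1 / (1 - R))) < real N"
    using reals_Archimedean2 by blast
  have N0: "0 < N" and N1: "1 \<le> real N" using N by auto
  have Nd: "2 / real N < d" using N d N0 by (simp add: field_simps)
  have NR: "R + 1 / real N \<le> 1" using N R N0 by (simp add: field_simps)
  have N2: "2 / real N \<le> 2" using N1 by (simp add: field_simps)
  have osc: "\<bar>\<Phi> z - \<Phi> q\<bar> \<le> \<epsilon> / 2" if "cmod q < 2" "dist q z < 2 / real N" for q z
  proof -
    have "cmod z \<le> cmod q + dist q z" using norm_triangle_sub[of z q] by (simp add: dist_norm norm_minus_commute)
    then have "z \<in> cball 0 4" "q \<in> cball 0 4" using that N2 by auto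
    then have "dist (\<Phi> z) (\<Phi> q) < \<epsilon> / 2" using that Nd by (intro d(2)) (auto simp: dist_commute)
    then show ?thesis by (simp add: dist_real_def)
  qed
  define G where "G = {p \<in> offset_grid N. cmod p < 1}"
  have finG: "finite G" by (simp add: G_def finite_offset_grid)
  have "\<forall>\<^sub>F n in sequentially. \<forall>p\<in>G. \<exists>z\<in>ball p (1 / real N). z \<notin> t n ` A n \<and>
        \<Phi> p - \<epsilon> / 2 \<le> log_potential (K n) (A n) (m n) (t n) z"
    unfolding eventually_ball_finite_distrib[OF finG] \<Phi>_def
    by (intro ballI lower) (use eps N0 in \<open>auto simp: G_def\<close>)
  then show ?thesis
    using weights upper[OF eps]
  proof eventually_elim
    case (elim n)
    have "(\<integral>\<^sup>+ z. ennreal \<bar>log_potential (K n) (A n) (m n) (t n) z - \<Phi> z\<bar> * indicator (ball 0 R) z \<partial>lborel) \<le> ennreal (64 * pi * \<epsilon>)"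
    proof (rule nn_integral_log_potential_diff[OF N0 NR])
      fix p assume p: "p \<in> offset_grid N" "cmod p < 1"
      then obtain q where q: "dist p q < 1 / real N" "q \<notin> t n ` A n" "\<Phi> p - \<epsilon> / 2 \<le> log_potential (K n) (A n) (m n) (t n) q"
        using elim(1) by (auto simp: G_def)
      have "dist p q < 2 / real N" using q(1) N0 by (simp add: field_simps)
      then have "\<bar>\<Phi> q - \<Phi> p\<bar> \<le> \<epsilon> / 2" using p by (intro osc) auto
      then show "\<exists>q\<in>ball p (1 / real N). q \<notin> t n ` A n \<and> \<Phi> q - \<epsilon> \<le> log_potential (K n) (A n) (m n) (t n) q"
      proof (intro bexI[of _ q] conjI)
        show "\<Phi> q - \<epsilon> \<le> log_potential (K n) (A n) (m n) (t n) q"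
          using \<open>\<bar>\<Phi> q - \<Phi> p\<bar> \<le> \<epsilon> / 2\<close> q(3) by linarith
      qed (use q in auto)
    next
      fix z q assume "cmod q < 2" "dist q z < 2 / real N"
      from osc[OF this] show "\<bar>\<Phi> z - \<Phi> q\<bar> \<le> \<epsilon>" using eps by simp
    qed (use elim eps in \<open>auto simp: \<Phi>_def[symmetric]\<close>)
    then show ?case by (simp add: \<Phi>_def \<epsilon>_def)
  qed
qed

lemma integral_bump_Fubini:
  fixes \<phi> :: "complex \<Rightarrow> real"
  assumes g: "0 < \<gamma>" and r: "0 < r" and \<phi>: "continuous_on UNIV \<phi>" and B: "\<And>x. \<bar>\<phi> x\<bar> \<le> B"
  shows "integrable lborel (\<lambda>c. \<phi> c * (\<integral>a. bump r (cmod (a - c)) \<partial>radial_measure \<gamma> 1))"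
    and "(\<integral>a. (\<integral>c. \<phi> c * bump r (cmod (a - c)) \<partial>lborel) \<partial>radial_measure \<gamma> 1) =
      (\<integral>c. \<phi> c * (\<integral>a. bump r (cmod (a - c)) \<partial>radial_measure \<gamma> 1) \<partial>lborel)"
    and "integrable (radial_measure \<gamma> 1) (\<lambda>a. \<integral>c. \<phi> c * bump r (cmod (a - c)) \<partial>lborel)"
proof -
  define \<mu> where "\<mu> = radial_measure \<gamma> 1"
  interpret \<mu>: prob_space \<mu> unfolding \<mu>_def by (rule prob_space_radial_measure[OF g])
  interpret P: pair_sigma_finite \<mu> "lborel :: complex measure" ..
  have [measurable_cong]: "sets \<mu> = sets borel" by (simp add: \<mu>_def)
  have [measurable]: "\<phi> \<in> borel_measurable borel" using \<phi> by (rule borel_measurable_continuous_onI)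
  define f where "f a c = \<phi> c * bump r (cmod (a - c))" for a c
  define I where "I = (\<integral>c. bump r (cmod c) \<partial>(lborel :: complex measure))"
  have int: "integrable lborel (\<lambda>c. \<psi> c * bump r (cmod (a - c)))" if "continuous_on UNIV \<psi>" for \<psi> :: "complex \<Rightarrow> real" and a
    by (rule integrable_continuous_bump[OF r that])
  have meas[measurable]: "(\<lambda>(a, c). f a c) \<in> borel_measurable (\<mu> \<Otimes>\<^sub>M lborel)"
    unfolding f_def by measurable
  have F: "integrable (\<mu> \<Otimes>\<^sub>M lborel) (\<lambda>(a, c). f a c)"
  proof (rule P.Fubini_integrable[OF meas])
    show "integrable \<mu> (\<lambda>a. \<integral>c. norm (case (a, c) of (a, c) \<Rightarrow> f a c) \<partial>lborel)"
    proof (rule \<mu>.integrable_const_bound)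
      show "AE a in \<mu>. norm (\<integral>c. norm (case (a, c) of (a, c) \<Rightarrow> f a c) \<partial>lborel) \<le> B * I"
      proof (rule AE_I2)
        fix a
        have "(\<integral>c. norm (f a c) \<partial>lborel) \<le> (\<integral>c. B * bump r (cmod (a - c)) \<partial>lborel)"
        proof (rule integral_mono)
          show "integrable lborel (\<lambda>c. norm (f a c))" unfolding f_def by (intro integrable_norm int \<phi>)
          show "integrable lborel (\<lambda>c. B * bump r (cmod (a - c)))" by (intro int continuous_intros)
          show "norm (f a c) \<le> B * bump r (cmod (a - c))" for c
            using bump_nonneg[OF r, of "cmod (a - c)"] B[of c] by (simp add: f_def abs_mult mult_right_mono)
        qed
        also have "\<dots> = B * I" using integral_bump_shift[OF r, of a] by (simp add: I_def)
        finally show "norm (\<integral>c. norm (case (a, c) of (a, c) \<Rightarrow> f a c) \<partial>lborel) \<le> B * I"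
          by (simp add: abs_of_nonneg)
      qed
    qed measurable
  qed (auto simp: f_def int \<phi>)
  have "(\<integral>a. f a c \<partial>\<mu>) = \<phi> c * (\<integral>a. bump r (cmod (a - c)) \<partial>\<mu>)" for c
    unfolding f_def by simp
  then show "integrable lborel (\<lambda>c. \<phi> c * (\<integral>a. bump r (cmod (a - c)) \<partial>radial_measure \<gamma> 1))"
    and "(\<integral>a. (\<integral>c. \<phi> c * bump r (cmod (a - c)) \<partial>lborel) \<partial>radial_measure \<gamma> 1) =
      (\<integral>c. \<phi> c * (\<integral>a. bump r (cmod (a - c)) \<partial>radial_measure \<gamma> 1) \<partial>lborel)"
    using P.integrable_snd[OF F] P.Fubini_integral[OF F] by (simp_all add: \<mu>_def f_def)
  show "integrable (radial_measure \<gamma> 1) (\<lambda>a. \<integral>c. \<phi> c * bump r (cmod (a - c)) \<partial>lborel)"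
    using P.integrable_fst[OF F] by (simp add: \<mu>_def f_def)
qed

text \<open>Smearing by the bump replaces I \<phi>(a) by the integral of \<phi>(c) bump(|a - c|)
  over \<open>c\<close>, with error e I both for the weights and for the limit (\<open>A1\<close>,
  \<open>A2\<close>). The two smeared quantities are averages over centres |c| < R1, where the bump
  stays in a disc of radius R < 1 and the L1 bound is uniform in \<open>c\<close>
  (\<open>A3\<close>).\<close>

lemma log_potential_weights_tendsto_inside:
  fixes A :: "nat \<Rightarrow> 'i set" and \<phi> :: "complex \<Rightarrow> real"
  assumes g: "0 < \<gamma>"
    and weights: "\<forall>\<^sub>F n in sequentially. finite (A n) \<and> (\<forall>i\<in>A n. 0 \<le> m n i) \<and> sum (m n) (A n) \<le> 1"
    and L1: "\<And>R e. R < 1 \<Longrightarrow> 0 < e \<Longrightarrow> \<forall>\<^sub>F n in sequentially.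
      (\<integral>\<^sup>+ z. ennreal \<bar>log_potential (K n) (A n) (m n) (t n) z - cmod z powr \<gamma> / \<gamma>\<bar>
        * indicator (ball 0 R) z \<partial>lborel) \<le> ennreal e"
    and \<phi>: "continuous_on UNIV \<phi>" and R1: "0 < R1" "R1 < 1" and supp: "\<And>z. R1 \<le> cmod z \<Longrightarrow> \<phi> z = 0"
  shows "(\<lambda>n. \<Sum>i\<in>A n. m n i * \<phi> (t n i)) \<longlonglongrightarrow> (\<integral>z. \<phi> z \<partial>radial_measure \<gamma> 1)"
proof -
  define \<mu> where "\<mu> = radial_measure \<gamma> 1"
  interpret \<mu>: prob_space \<mu> unfolding \<mu>_def by (rule prob_space_radial_measure[OF g])
  have [measurable_cong]: "sets \<mu> = sets borel" by (simp add: \<mu>_def)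
  have [measurable]: "\<phi> \<in> borel_measurable borel" using \<phi> by (rule borel_measurable_continuous_onI)
  have "compact (\<phi> ` cball 0 1)"
    by (rule compact_continuous_image) (use \<phi> in \<open>auto intro: continuous_on_subset\<close>)
  then obtain B0 where B0: "\<And>x. x \<in> cball 0 1 \<Longrightarrow> \<bar>\<phi> x\<bar> \<le> B0"
    using compact_imp_bounded bounded_iff by (metis imageI real_norm_def)
  define B where "B = \<bar>B0\<bar> + 1"
  have B: "\<bar>\<phi> x\<bar> \<le> B" and B1: "0 < B" for x
  proof -
    show "0 < B" by (simp add: B_def)
    show "\<bar>\<phi> x\<bar> \<le> B"
    proof (cases "cmod x \<le> 1")
      case True
      then show ?thesis using B0[of x] by (simp add: B_def)
    qed (use supp[of x] R1 in \<open>simp add: B_def\<close>)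
  qed
  have uc: "uniformly_continuous_on (cball 0 2) \<phi>"
    by (rule compact_uniformly_continuous) (use \<phi> in \<open>auto intro: continuous_on_subset\<close>)
  have int\<phi>: "integrable \<mu> \<phi>"
    by (rule \<mu>.integrable_const_bound[where B = B]) (auto simp: B)
  show ?thesis
  proof (rule LIMSEQ_I)
    fix e0 :: real assume e0: "0 < e0"
    \<comment> \<open>Three errors of size e I arise, so a quarter leaves the inequality
      strict.\<close>
    define e where "e = e0 / 4"
    have e: "0 < e" using e0 by (simp add: e_def)
    obtain d where d: "0 < d" "\<And>x y. x \<in> cball 0 2 \<Longrightarrow> y \<in> cball 0 2 \<Longrightarrow> dist y x < d \<Longrightarrow> dist (\<phi> y) (\<phi> x) < e"
      using uc e unfolding uniformly_continuous_on_def by meson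
    define r where "r = min d ((1 - R1) / 2)"
    have r: "0 < r" "r \<le> d" "r \<le> (1 - R1) / 2"
    proof -
      show "0 < r" using d(1) R1 by (simp add: r_def)
      show "r \<le> d" "r \<le> (1 - R1) / 2" unfolding r_def by (rule min.cobounded1, rule min.cobounded2)
    qed
    have osc: "\<bar>\<phi> x - \<phi> y\<bar> \<le> e" if "dist x y < r" for x y
    proof (cases "cmod x \<le> 2 \<and> cmod y \<le> 2")
      case True
      then have "dist (\<phi> x) (\<phi> y) < e" using that r by (intro d(2)) auto
      then show ?thesis by (simp add: dist_real_def)
    next
      case False
      have "\<bar>cmod x - cmod y\<bar> \<le> dist x y" using norm_triangle_ineq3[of x y] by (simp add: dist_norm)
      moreover have "2 * r \<le> 1 - R1" using r(3) by simp
      ultimately have "R1 \<le> cmod x" "R1 \<le> cmod y" using False that R1 by linarith+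
      then show ?thesis using supp e by simp
    qed
    define I where "I = (\<integral>c. bump r (cmod c) \<partial>(lborel :: complex measure))"
    have I: "0 < I" unfolding I_def by (rule integral_bump_pos[OF r(1)])
    note approx = bump_approximate_identity[OF r(1) \<phi> osc, folded I_def]
    define R where "R = R1 + r"
    have R: "R < 1" using r(3) R1 by (simp add: R_def)
    \<comment> \<open>Makes the bound B * 5 E / (\<pi> r^2), integrated over the disc of radius R1,
      equal to R1^2 e I.\<close>
    define E where "E = e * I * r\<^sup>2 / (5 * B)"
    have E: "0 < E" using e I r B1 by (simp add: E_def)
    define H where "H c = (\<integral>a. bump r (cmod (a - c)) \<partial>\<mu>)" for c
    define \<psi> where "\<psi> a = (\<integral>c. \<phi> c * bump r (cmod (a - c)) \<partial>lborel)" for a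
    note F = integral_bump_Fubini[OF g r(1) \<phi> B, folded \<mu>_def, folded H_def \<psi>_def]
    have A2: "\<bar>I * (\<integral>z. \<phi> z \<partial>\<mu>) - (\<integral>c. \<phi> c * H c \<partial>lborel)\<bar> \<le> e * I"
    proof -
      have "I * (\<integral>z. \<phi> z \<partial>\<mu>) - (\<integral>c. \<phi> c * H c \<partial>lborel) = (\<integral>a. \<phi> a * I - \<psi> a \<partial>\<mu>)"
        using F int\<phi> by (subst Bochner_Integration.integral_diff) auto
      also have "\<bar>\<dots>\<bar> \<le> (\<integral>a. \<bar>\<phi> a * I - \<psi> a\<bar> \<partial>\<mu>)"
        by (rule integral_abs_bound)
      also have "\<dots> \<le> (\<integral>a. e * I \<partial>\<mu>)"
        by (rule integral_mono) (use F int\<phi> approx in \<open>auto simp: \<psi>_def\<close>)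
      also have "\<dots> = e * I" by (simp add: \<mu>.prob_space)
      finally show ?thesis .
    qed
    have "\<forall>\<^sub>F n in sequentially. norm ((\<Sum>i\<in>A n. m n i * \<phi> (t n i)) - (\<integral>z. \<phi> z \<partial>\<mu>)) < e0"
      using weights L1[OF R E]
    proof eventually_elim
      case (elim n)
      then have fin: "finite (A n)" and m0: "\<And>i. i \<in> A n \<Longrightarrow> 0 \<le> m n i" and m1: "sum (m n) (A n) \<le> 1" by auto
      define S where "S c = (\<Sum>i\<in>A n. m n i * bump r (cmod (t n i - c)))" for c
      have intS: "integrable lborel (\<lambda>c. \<phi> c * S c)"
        unfolding S_def sum_distrib_left mult.left_commute[of "\<phi> _"]
        by (intro Bochner_Integration.integrable_sum integrable_mult_right integrable_continuous_bump r \<phi>)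
      have sum\<psi>: "(\<integral>c. \<phi> c * S c \<partial>lborel) = (\<Sum>i\<in>A n. m n i * \<psi> (t n i))"
        unfolding S_def sum_distrib_left mult.left_commute[of "\<phi> _"] \<psi>_def
        by (subst Bochner_Integration.integral_sum) (auto intro!: integrable_mult_right integrable_continuous_bump r \<phi>)
      have "\<bar>I * (\<Sum>i\<in>A n. m n i * \<phi> (t n i)) - (\<integral>c. \<phi> c * S c \<partial>lborel)\<bar> = \<bar>\<Sum>i\<in>A n. m n i * (\<phi> (t n i) * I - \<psi> (t n i))\<bar>"
        unfolding sum\<psi> by (simp add: sum_distrib_left sum_subtractf algebra_simps)
      also have "\<dots> \<le> (\<Sum>i\<in>A n. \<bar>m n i * (\<phi> (t n i) * I - \<psi> (t n i))\<bar>)" by (rule sum_abs)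
      also have "\<dots> \<le> (\<Sum>i\<in>A n. m n i * (e * I))"
        by (intro sum_mono) (use m0 approx in \<open>auto simp: abs_mult \<psi>_def intro!: mult_left_mono\<close>)
      also have "\<dots> \<le> e * I"
        using m1 e I mult_right_mono[of "sum (m n) (A n)" 1 "e * I"] by (simp flip: sum_distrib_right)
      finally have A1: "\<bar>I * (\<Sum>i\<in>A n. m n i * \<phi> (t n i)) - (\<integral>c. \<phi> c * S c \<partial>lborel)\<bar> \<le> e * I" .
      have A3: "\<bar>(\<integral>c. \<phi> c * S c \<partial>lborel) - (\<integral>c. \<phi> c * H c \<partial>lborel)\<bar> \<le> e * I"
      proof -
        have "(\<integral>c. \<phi> c * S c \<partial>lborel) - (\<integral>c. \<phi> c * H c \<partial>lborel) = (\<integral>c. \<phi> c * (S c - H c) \<partial>lborel)"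
          using intS F(1) by (subst Bochner_Integration.integral_diff[symmetric]) (auto simp: algebra_simps)
        also have "\<bar>\<dots>\<bar> \<le> (\<integral>c. indicator (ball (0 :: complex) R1) c *\<^sub>R (B * (5 * E / (pi * r\<^sup>2))) \<partial>lborel)"
          unfolding real_norm_def[symmetric]
        proof (rule Bochner_Integration.integral_norm_bound_integral)
          show "integrable lborel (\<lambda>c. \<phi> c * (S c - H c))"
            using Bochner_Integration.integrable_diff[OF intS F(1)] by (simp add: algebra_simps)
          show "integrable lborel (\<lambda>c :: complex. indicator (ball 0 R1) c *\<^sub>R (B * (5 * E / (pi * r\<^sup>2))))"
            using set_integrable_ball_const[of R1] R1 by (simp only: set_integrable_def less_imp_le)
          fix c :: complex
          show "norm (\<phi> c * (S c - H c)) \<le> indicator (ball 0 R1) c *\<^sub>R (B * (5 * E / (pi * r\<^sup>2)))"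
          proof (cases "c \<in> ball 0 R1")
            case True
            have "\<bar>S c - H c\<bar> \<le> 5 * E / (pi * r\<^sup>2)"
              unfolding S_def H_def \<mu>_def
              by (rule bump_sum_radial_measure_close[OF g r(1) _ _ fin _ elim(2)]) (use True R E in \<open>auto simp: R_def\<close>)
            then have "\<bar>\<phi> c\<bar> * \<bar>S c - H c\<bar> \<le> B * (5 * E / (pi * r\<^sup>2))"
              using B1 by (intro mult_mono B) auto
            then show ?thesis using True by (simp add: abs_mult)
          next
            case False
            then show ?thesis using supp[of c] by simp
          qed
        qed
        also have "\<dots> = pi * R1\<^sup>2 * (B * (5 * E / (pi * r\<^sup>2)))"
          using set_integral_ball_const[of R1 0 "B * (5 * E / (pi * r\<^sup>2))"] R1
          by (simp only: set_lebesgue_integral_def less_imp_le)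
        also have "\<dots> = R1\<^sup>2 * (e * I)"
          using B1 r by (simp add: E_def)
        also have "\<dots> \<le> 1 * (e * I)"
          using R1 e I by (intro mult_right_mono) (auto simp: power_le_one)
        finally show ?thesis by simp
      qed
      have "\<bar>I * ((\<Sum>i\<in>A n. m n i * \<phi> (t n i)) - (\<integral>z. \<phi> z \<partial>\<mu>))\<bar> \<le> 3 * (e * I)"
        using A1 A2 A3 by (simp add: right_diff_distrib)
      also have "\<dots> < I * e0" using e I by (simp add: e_def)
      finally have "I * \<bar>(\<Sum>i\<in>A n. m n i * \<phi> (t n i)) - (\<integral>z. \<phi> z \<partial>\<mu>)\<bar> < I * e0"
        using I by (simp add: abs_mult)
      then show ?case using I by simp
    qed
    then show "\<exists>no. \<forall>n\<ge>no. norm ((\<Sum>i\<in>A n. m n i * \<phi> (t n i)) - (\<integral>z. \<phi> z \<partial>radial_measure \<gamma> 1)) < e0"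
      by (simp add: eventually_sequentially \<mu>_def)
  qed
qed

text \<open>No mass is lost at or beyond the unit circle: the weights sum to at most 1, while the limit
  already has total mass 1 in the open disc.\<close>

lemma log_potential_weights_tendsto:
  fixes A :: "nat \<Rightarrow> 'i set" and \<phi> :: "complex \<Rightarrow> real"
  assumes g: "0 < \<gamma>"
    and weights: "\<forall>\<^sub>F n in sequentially. finite (A n) \<and> (\<forall>i\<in>A n. 0 \<le> m n i) \<and> sum (m n) (A n) \<le> 1"
    and L1: "\<And>R e. R < 1 \<Longrightarrow> 0 < e \<Longrightarrow> \<forall>\<^sub>F n in sequentially.
      (\<integral>\<^sup>+ z. ennreal \<bar>log_potential (K n) (A n) (m n) (t n) z - cmod z powr \<gamma> / \<gamma>\<bar>
        * indicator (ball 0 R) z \<partial>lborel) \<le> ennreal e"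
    and \<phi>: "continuous_on UNIV \<phi>" and B: "\<And>x. \<bar>\<phi> x\<bar> \<le> B"
  shows "(\<lambda>n. \<Sum>i\<in>A n. m n i * \<phi> (t n i)) \<longlonglongrightarrow> (\<integral>z. \<phi> z \<partial>radial_measure \<gamma> 1)"
proof (rule LIMSEQ_I)
  fix e0 :: real assume e0: "0 < e0"
  define \<mu> where "\<mu> = radial_measure \<gamma> 1"
  interpret \<mu>: prob_space \<mu> unfolding \<mu>_def by (rule prob_space_radial_measure[OF g])
  have [measurable_cong]: "sets \<mu> = sets borel" by (simp add: \<mu>_def)
  have [measurable]: "\<phi> \<in> borel_measurable borel" using \<phi> by (rule borel_measurable_continuous_onI)
  have B0: "0 \<le> B" using order.trans[OF abs_ge_zero B] .
  \<comment> \<open>Each of the two tails costs at most B e < e0 / 4, and the cut-off part less than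
    e0 / 2; the summand 1 covers B = 0.\<close>
  define e where "e = e0 / (8 * (B + 1))"
  have e: "0 < e" using e0 B0 by (simp add: e_def)
  have "((\<lambda>r. r powr \<gamma>) \<longlongrightarrow> 1 powr \<gamma>) (at_left 1)"
    by (intro tendsto_intros) auto
  then have "\<forall>\<^sub>F r in at_left 1. 1 - e < r powr \<gamma>"
    using e by (intro order_tendstoD(1)) auto
  moreover have "\<forall>\<^sub>F r in at_left (1::real). 0 < r \<and> r < 1"
    by (rule eventually_at_leftI[of 0]) auto
  ultimately have "\<forall>\<^sub>F r in at_left 1. 0 < r \<and> r < 1 \<and> 1 - e < r powr \<gamma>"
    by eventually_elim auto
  then have "\<exists>r. 0 < r \<and> r < 1 \<and> 1 - e < r powr \<gamma>"
    by (rule eventually_happens'[OF trivial_limit_at_left_real])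
  then obtain R1 where R1: "0 < R1" "R1 < 1" "1 - e < R1 powr \<gamma>" by blast
  define R2 where "R2 = (1 + R1) / 2"
  have R2: "R1 < R2" "R2 < 1" "0 < R2" using R1 by (auto simp: R2_def)
  \<comment> \<open>A radial cut-off, 1 for |z| < R1 and 0 from R2 on, so \<phi> \<kappa> is
    supported strictly inside the disc. R1 is chosen so that the limit gives the region |z| < R1
    mass R1 powr \<gamma> > 1 - e.\<close>
  define \<kappa> where "\<kappa> z = max 0 (min 1 ((R2 - cmod z) / (R2 - R1)))" for z :: complex
  have cont: "continuous_on UNIV \<kappa>" unfolding \<kappa>_def by (intro continuous_intros) (use R2 in auto)
  have [measurable]: "\<kappa> \<in> borel_measurable borel" using cont by (rule borel_measurable_continuous_onI)
  have \<kappa>01: "0 \<le> \<kappa> z" "\<kappa> z \<le> 1" for z by (auto simp: \<kappa>_def)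
  have \<kappa>1: "\<kappa> z = 1" if "cmod z < R1" for z using that R2 by (auto simp: \<kappa>_def min_def)
  have \<kappa>0: "\<kappa> z = 0" if "R2 \<le> cmod z" for z
  proof -
    have "(R2 - cmod z) / (R2 - R1) \<le> 0" using that R2 by (intro divide_nonpos_pos) auto
    then show ?thesis by (auto simp: \<kappa>_def)
  qed
  have int: "integrable \<mu> \<phi>" "integrable \<mu> \<kappa>" "integrable \<mu> (\<lambda>z. \<phi> z * \<kappa> z)"
  proof -
    show "integrable \<mu> \<phi>" by (rule \<mu>.integrable_const_bound[where B = B]) (auto simp: B)
    show "integrable \<mu> \<kappa>" by (rule \<mu>.integrable_const_bound[where B = 1]) (auto simp: \<kappa>01)
    have "\<bar>\<phi> z * \<kappa> z\<bar> \<le> B" for z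
      using mult_mono[OF B[of z] \<kappa>01(2)[of z]] B0 \<kappa>01[of z] by (simp add: abs_mult)
    then show "integrable \<mu> (\<lambda>z. \<phi> z * \<kappa> z)" by (intro \<mu>.integrable_const_bound[where B = B]) auto
  qed
  have mass: "1 - e < (\<integral>z. \<kappa> z \<partial>\<mu>)"
  proof -
    have "R1 powr \<gamma> = measure \<mu> {z. cmod z < R1}"
      using R1 g by (simp add: measure_def \<mu>_def radial_measure_ball)
    also have "\<dots> = (\<integral>z. indicator {z. cmod z < R1} z \<partial>\<mu>)" by simp
    also have "\<dots> \<le> (\<integral>z. \<kappa> z \<partial>\<mu>)"
    proof (rule integral_mono)
      show "integrable \<mu> (\<lambda>z. indicator {z. cmod z < R1} z :: real)"
        by (rule \<mu>.integrable_const_bound[where B = 1]) (auto simp: indicator_def)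
    qed (use int \<kappa>01 \<kappa>1 in \<open>auto simp: indicator_def\<close>)
    finally show ?thesis using R1 by simp
  qed
  have "(\<lambda>n. \<Sum>i\<in>A n. m n i * \<kappa> (t n i)) \<longlonglongrightarrow> (\<integral>z. \<kappa> z \<partial>\<mu>)"
    unfolding \<mu>_def by (rule log_potential_weights_tendsto_inside[OF g weights L1 cont R2(3,2) \<kappa>0])
  then have ev1: "\<forall>\<^sub>F n in sequentially. 1 - e < (\<Sum>i\<in>A n. m n i * \<kappa> (t n i))"
    using mass by (rule order_tendstoD)
  have "(\<lambda>n. \<Sum>i\<in>A n. m n i * (\<phi> (t n i) * \<kappa> (t n i))) \<longlonglongrightarrow> (\<integral>z. \<phi> z * \<kappa> z \<partial>\<mu>)"
    unfolding \<mu>_def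
    by (rule log_potential_weights_tendsto_inside[OF g weights L1 _ R2(3,2)])
       (auto intro!: continuous_intros \<phi> cont \<kappa>0)
  then have ev2: "\<forall>\<^sub>F n in sequentially. dist (\<Sum>i\<in>A n. m n i * (\<phi> (t n i) * \<kappa> (t n i))) (\<integral>z. \<phi> z * \<kappa> z \<partial>\<mu>) < e0 / 2"
    by (rule tendstoD) (use e0 in simp)
  have tail\<mu>: "\<bar>(\<integral>z. \<phi> z \<partial>\<mu>) - (\<integral>z. \<phi> z * \<kappa> z \<partial>\<mu>)\<bar> \<le> B * e"
  proof -
    have "(\<integral>z. \<phi> z \<partial>\<mu>) - (\<integral>z. \<phi> z * \<kappa> z \<partial>\<mu>) = (\<integral>z. \<phi> z - \<phi> z * \<kappa> z \<partial>\<mu>)"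
      using int by simp
    also have "\<bar>\<dots>\<bar> \<le> (\<integral>z. B * (1 - \<kappa> z) \<partial>\<mu>)"
      unfolding real_norm_def[symmetric]
    proof (rule Bochner_Integration.integral_norm_bound_integral)
      fix z
      have "\<phi> z - \<phi> z * \<kappa> z = \<phi> z * (1 - \<kappa> z)" by (simp add: algebra_simps)
      then show "norm (\<phi> z - \<phi> z * \<kappa> z) \<le> B * (1 - \<kappa> z)"
        using B[of z] \<kappa>01[of z] by (simp add: abs_mult mult_right_mono)
    qed (use int in auto)
    also have "\<dots> = B * (1 - (\<integral>z. \<kappa> z \<partial>\<mu>))" using int by (simp add: \<mu>.prob_space)
    also have "\<dots> \<le> B * e" using mass B0 by (intro mult_left_mono) auto
    finally show ?thesis .
  qed
  have "\<forall>\<^sub>F n in sequentially. norm ((\<Sum>i\<in>A n. m n i * \<phi> (t n i)) - (\<integral>z. \<phi> z \<partial>\<mu>)) < e0"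
    using weights ev1 ev2
  proof eventually_elim
    case (elim n)
    then have m0: "\<And>i. i \<in> A n \<Longrightarrow> 0 \<le> m n i" and m1: "sum (m n) (A n) \<le> 1" by auto
    have "\<bar>(\<Sum>i\<in>A n. m n i * \<phi> (t n i)) - (\<Sum>i\<in>A n. m n i * (\<phi> (t n i) * \<kappa> (t n i)))\<bar>
        = \<bar>\<Sum>i\<in>A n. m n i * (\<phi> (t n i) * (1 - \<kappa> (t n i)))\<bar>"
      by (simp add: sum_subtractf algebra_simps)
    also have "\<dots> \<le> (\<Sum>i\<in>A n. \<bar>m n i * (\<phi> (t n i) * (1 - \<kappa> (t n i)))\<bar>)" by (rule sum_abs)
    also have "\<dots> \<le> (\<Sum>i\<in>A n. m n i * (B * (1 - \<kappa> (t n i))))"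
      by (intro sum_mono) (use m0 B \<kappa>01 in \<open>auto simp: abs_mult intro!: mult_left_mono mult_right_mono\<close>)
    also have "\<dots> = B * (sum (m n) (A n) - (\<Sum>i\<in>A n. m n i * \<kappa> (t n i)))"
      by (simp add: sum_distrib_left sum_subtractf algebra_simps)
    also have "\<dots> \<le> B * e" using m1 elim B0 by (intro mult_left_mono) auto
    finally have "\<bar>(\<Sum>i\<in>A n. m n i * \<phi> (t n i)) - (\<Sum>i\<in>A n. m n i * (\<phi> (t n i) * \<kappa> (t n i)))\<bar> \<le> B * e" .
    moreover have "B * e < e0 / 4"
    proof -
      have "0 \<le> B * e" using e B0 by simp
      then have "B * e < (B + 1) * (2 * e)" using e by (simp add: algebra_simps)
      also have "\<dots> = e0 / 4" proof -
        have "B + 1 \<noteq> 0" using B0 by simp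
        then show ?thesis unfolding e_def by (simp add: divide_simps)
      qed
      finally show ?thesis .
    qed
    ultimately show ?case using elim(3) tail\<mu> unfolding dist_real_def real_norm_def by linarith
  qed
  then show "\<exists>no. \<forall>n\<ge>no. norm ((\<Sum>i\<in>A n. m n i * \<phi> (t n i)) - (\<integral>z. \<phi> z \<partial>radial_measure \<gamma> 1)) < e0"
    by (simp add: eventually_sequentially \<mu>_def)
qed

section \<open>Zeros of random polynomials\<close>

lemma integral_scale_measure:
  fixes f :: "'a \<Rightarrow> real"
  assumes "0 \<le> r" and [measurable]: "f \<in> borel_measurable M"
  shows "(\<integral>x. f x \<partial>scale_measure (ennreal r) M) = r * (\<integral>x. f x \<partial>M)"
proof -
  have "scale_measure (ennreal r) M = density M (\<lambda>_. ennreal r)"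
    by (rule measure_eqI) (auto simp: emeasure_density nn_integral_cmult_indicator)
  then show ?thesis
    using assms(1) by (simp add: integral_real_density)
qed

lemma integral_scaled_zero_measure:
  fixes \<phi> :: "complex \<Rightarrow> real"
  assumes W: "W \<noteq> 0" and n: "0 < n" and [measurable]: "\<phi> \<in> borel_measurable borel"
  shows "(\<integral>z. \<phi> z \<partial>scale_measure (ennreal (1 / real n)) (dilate_measure c (zero_measure W))) =
    (\<Sum>a | poly W a = 0. real (order a W) / real n * \<phi> (a /\<^sub>R c))"
proof -
  have fin: "finite {a. poly W a = 0}" using W by (rule poly_roots_finite)
  have [measurable]: "(\<lambda>z :: complex. z /\<^sub>R c) \<in> borel_measurable borel" by measurable
  have "(\<integral>z. \<phi> z \<partial>scale_measure (ennreal (1 / real n)) (dilate_measure c (zero_measure W))) =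
      1 / real n * (\<integral>z. \<phi> z \<partial>dilate_measure c (zero_measure W))"
    by (rule integral_scale_measure) (auto simp: dilate_measure_def)
  also have "(\<integral>z. \<phi> z \<partial>dilate_measure c (zero_measure W)) = (\<integral>z. \<phi> (z /\<^sub>R c) \<partial>zero_measure W)"
    unfolding dilate_measure_def by (rule integral_distr) auto
  also have "\<dots> = (\<integral>z. \<phi> (z /\<^sub>R c) \<partial>point_measure {z. poly W z = 0} (\<lambda>z. ennreal (real (order z W))))"
    using W by (simp add: zero_measure_def ennreal_of_nat_eq_real_of_nat)
      (subst integral_distr, auto simp: point_measure_def)
  also have "\<dots> = (\<Sum>a | poly W a = 0. real (order a W) * \<phi> (a /\<^sub>R c))"
    using fin by (subst lebesgue_integral_point_measure_finite) auto
  finally show ?thesis by (simp add: sum_distrib_left)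
qed

text \<open>Factorise over the distinct roots with y - a = c (z - a / c). Each root counted with
  multiplicity contributes one ln c, which joins the leading coefficient in the additive
  constant.\<close>

lemma ln_cmod_poly_eq_log_potential:
  fixes W :: "complex poly"
  assumes c: "0 < c" and n: "0 < n" and z: "poly W (of_real c * z) \<noteq> 0"
  shows "ln (cmod (poly W (of_real c * z))) / real n =
    log_potential ((ln (cmod (lead_coeff W)) + (\<Sum>a | poly W a = 0. real (order a W)) * ln c) / real n)
      {a. poly W a = 0} (\<lambda>a. real (order a W) / real n) (\<lambda>a. a /\<^sub>R c) z"
proof -
  have W: "W \<noteq> 0" using z by auto
  have fin: "finite {a. poly W a = 0}" using W by (rule poly_roots_finite)
  define y where "y = of_real c * z"
  have ya: "y - a = of_real c * (z - a /\<^sub>R c)" for a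
    using c by (simp add: y_def scaleR_conv_of_real algebra_simps)
  have nz: "z - a /\<^sub>R c \<noteq> 0" if "poly W a = 0" for a
    using z that ya[of a] by (auto simp: y_def)
  have "poly W y = lead_coeff W * (\<Prod>a | poly W a = 0. (y - a) ^ order a W)"
    by (subst complex_poly_decompose[of W, symmetric]) (simp add: poly_prod poly_power)
  then have "cmod (poly W y) = cmod (lead_coeff W) * (\<Prod>a | poly W a = 0. (c * cmod (z - a /\<^sub>R c)) ^ order a W)"
    using c by (simp add: ya norm_mult prod_norm[symmetric] norm_power)
  then have "ln (cmod (poly W y)) = ln (cmod (lead_coeff W)) + (\<Sum>a | poly W a = 0. ln ((c * cmod (z - a /\<^sub>R c)) ^ order a W))"
  proof -
    have pos: "0 < (c * cmod (z - a /\<^sub>R c)) ^ order a W" if "poly W a = 0" for a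
      using c nz[OF that] by simp
    then have "0 < (\<Prod>a | poly W a = 0. (c * cmod (z - a /\<^sub>R c)) ^ order a W)"
      by (intro prod_pos) auto
    then have "ln (cmod (poly W y)) = ln (cmod (lead_coeff W)) + ln (\<Prod>a | poly W a = 0. (c * cmod (z - a /\<^sub>R c)) ^ order a W)"
      using W unfolding \<open>cmod (poly W y) = _\<close> by (intro ln_mult_pos) auto
    also have "ln (\<Prod>a | poly W a = 0. (c * cmod (z - a /\<^sub>R c)) ^ order a W) =
        (\<Sum>a | poly W a = 0. ln ((c * cmod (z - a /\<^sub>R c)) ^ order a W))"
    proof (rule ln_prod[OF fin])
      fix a assume "a \<in> {a. poly W a = 0}"
      then show "(c * cmod (z - a /\<^sub>R c)) ^ order a W \<noteq> 0"
        by (intro less_imp_neq[THEN not_sym] pos) simp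
    qed
    finally show ?thesis .
  qed
  also have "(\<Sum>a | poly W a = 0. ln ((c * cmod (z - a /\<^sub>R c)) ^ order a W)) =
      (\<Sum>a | poly W a = 0. real (order a W) * ln c + real (order a W) * ln (cmod (z - a /\<^sub>R c)))"
    using c nz by (intro sum.cong) (auto simp: ln_realpow ln_mult distrib_left)
  finally show ?thesis
    by (simp add: log_potential_def y_def[symmetric] sum.distrib sum_distrib_right add_divide_distrib sum_divide_distrib)
qed

section \<open>Uniform upper bound and the limit theorem for a fixed sample\<close>

lemma random_poly_upper_bound:
  fixes w x :: "nat \<Rightarrow> complex"
  assumes asy: "(\<lambda>k. ln (cmod (w k)) - (- \<alpha> * (real k * ln (real k) - real k) - \<beta> * real k))
           \<in> o(\<lambda>k. real k)"
    and a: "0 < \<alpha>" and e: "0 < \<epsilon>"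
    and growth: "\<And>\<epsilon>. 0 < \<epsilon> \<Longrightarrow> \<forall>\<^sub>F k in sequentially. ln (1 + cmod (x k)) < \<epsilon> * real k"
  shows "\<forall>\<^sub>F n in sequentially. \<forall>z. cmod (\<Sum>k\<le>n. x k * w k * (complex_of_real (exp \<beta> * real n powr \<alpha>) * z) ^ k)
    \<le> exp (real n * (\<alpha> * cmod z powr (1 / \<alpha>) + \<epsilon>))"
proof -
  \<comment> \<open>One share for the coefficients, one for the weights, and one for the number n +
    1 of terms together with the constants.\<close>
  define \<epsilon>' where "\<epsilon>' = \<epsilon> / 3"
  have e': "0 < \<epsilon>'" using e by (simp add: \<epsilon>'_def)
  obtain K where K: "0 < K" "\<And>n k r. 0 \<le> r \<Longrightarrow>
      cmod (w k) * (exp \<beta> * real n powr \<alpha> * r) ^ k \<le> K * exp (\<epsilon>' * real k + \<alpha> * real n * r powr (1 / \<alpha>))"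
    using weight_upper_bound[OF asy a e'] by metis
  obtain k0 where k0: "\<And>k. k \<ge> k0 \<Longrightarrow> ln (1 + cmod (x k)) < \<epsilon>' * real k"
    using growth[OF e'] by (auto simp: eventually_sequentially)
  define L where "L = 1 + (\<Sum>k<k0. cmod (x k))"
  have L: "1 \<le> L" by (auto simp: L_def intro!: sum_nonneg)
  have xL: "cmod (x k) \<le> L * exp (\<epsilon>' * real k)" for k
  proof (cases "k < k0")
    case True
    then have "cmod (x k) \<le> (\<Sum>k<k0. cmod (x k))" by (intro member_le_sum) auto
    then have "cmod (x k) \<le> L" by (simp add: L_def)
    also have "\<dots> \<le> L * exp (\<epsilon>' * real k)" using L e' by simp
    finally show ?thesis .
  next
    case False
    have "1 + cmod (x k) = exp (ln (1 + cmod (x k)))" by (simp add: add_pos_nonneg)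
    also have "\<dots> \<le> exp (\<epsilon>' * real k)" using k0[of k] False by simp
    also have "\<dots> \<le> L * exp (\<epsilon>' * real k)" using L by simp
    finally show ?thesis by simp
  qed
  have "(\<lambda>n. (real n + 1) * (L * K) * exp (- \<epsilon>' * real n)) \<longlonglongrightarrow> 0"
    using e' by real_asymp
  then have "\<forall>\<^sub>F n in sequentially. (real n + 1) * (L * K) * exp (- \<epsilon>' * real n) < 1"
    by (rule order_tendstoD) simp
  then show ?thesis
  proof eventually_elim
    case (elim n)
    show ?case
    proof
      fix z
      define P where "P = \<alpha> * real n * cmod z powr (1 / \<alpha>)"
      have "cmod (\<Sum>k\<le>n. x k * w k * (complex_of_real (exp \<beta> * real n powr \<alpha>) * z) ^ k) \<le> (\<Sum>k\<le>n. L * K * exp (2 * \<epsilon>' * real n + P))"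
      proof (rule sum_norm_le)
        fix k assume k: "k \<in> {..n}"
        have "cmod (x k * w k * (complex_of_real (exp \<beta> * real n powr \<alpha>) * z) ^ k) = cmod (x k) * (cmod (w k) * (exp \<beta> * real n powr \<alpha> * cmod z) ^ k)"
          by (simp add: norm_mult norm_power)
        also have "\<dots> \<le> (L * exp (\<epsilon>' * real k)) * (K * exp (\<epsilon>' * real k + P))"
          unfolding P_def by (intro mult_mono xL K) (use L in auto)
        also have "\<dots> = L * K * exp (2 * \<epsilon>' * real k + P)"
          by (simp add: algebra_simps flip: exp_add)
        also have "\<dots> \<le> L * K * exp (2 * \<epsilon>' * real n + P)"
          using k e' L K by (intro mult_left_mono) auto
        finally show "cmod (x k * w k * (complex_of_real (exp \<beta> * real n powr \<alpha>) * z) ^ k) \<le> L * K * exp (2 * \<epsilon>' * real n + P)" .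
      qed
      also have "\<dots> = ((real n + 1) * (L * K) * exp (- \<epsilon>' * real n)) * exp (3 * \<epsilon>' * real n + P)"
      proof -
        have "exp (2 * \<epsilon>' * real n + P) = exp (- \<epsilon>' * real n) * exp (3 * \<epsilon>' * real n + P)"
          by (simp flip: exp_add)
        then show ?thesis by simp
      qed
      also have "\<dots> \<le> 1 * exp (3 * \<epsilon>' * real n + P)"
        using elim by (intro mult_right_mono) auto
      also have "\<dots> = exp (real n * (\<alpha> * cmod z powr (1 / \<alpha>) + \<epsilon>))"
        by (simp add: P_def \<epsilon>'_def algebra_simps)
      finally show "cmod (\<Sum>k\<le>n. x k * w k * (complex_of_real (exp \<beta> * real n powr \<alpha>) * z) ^ k)
        \<le> exp (real n * (\<alpha> * cmod z powr (1 / \<alpha>) + \<epsilon>))" .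
    qed
  qed
qed

text \<open>Randomness has left the argument here: the lemma is applied to a fixed sample point at
  which the two bounds hold. The degree bound makes the normalised multiplicities sum to at most
  1.\<close>

lemma scaled_zero_measure_tendsto:
  fixes W :: "nat \<Rightarrow> complex poly" and c :: "nat \<Rightarrow> real" and \<phi> :: "complex \<Rightarrow> real"
  assumes g: "0 < \<gamma>" and c: "\<And>n. 0 < n \<Longrightarrow> 0 < c n" and deg: "\<And>n. degree (W n) \<le> n"
    and upper: "\<And>\<epsilon>. 0 < \<epsilon> \<Longrightarrow> \<forall>\<^sub>F n in sequentially. \<forall>z.
      cmod (poly (W n) (of_real (c n) * z)) \<le> exp (real n * (cmod z powr \<gamma> / \<gamma> + \<epsilon>))"
    and lower: "\<And>\<epsilon> N p. 0 < \<epsilon> \<Longrightarrow> 0 < N \<Longrightarrow> p \<in> offset_grid N \<Longrightarrow> cmod p < 1 \<Longrightarrow> \<forall>\<^sub>F n in sequentially.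
      \<exists>z\<in>ball p (1 / real N). exp (real n * (cmod p powr \<gamma> / \<gamma> - \<epsilon>)) < cmod (poly (W n) (of_real (c n) * z))"
    and \<phi>: "continuous_on UNIV \<phi>" and B: "\<And>x. \<bar>\<phi> x\<bar> \<le> B"
  shows "(\<lambda>n. \<integral>z. \<phi> z \<partial>scale_measure (ennreal (1 / real n)) (dilate_measure (c n) (zero_measure (W n))))
    \<longlonglongrightarrow> (\<integral>z. \<phi> z \<partial>radial_measure \<gamma> 1)"
proof -
  have [measurable]: "\<phi> \<in> borel_measurable borel" using \<phi> by (rule borel_measurable_continuous_onI)
  define A where "A n = {a. poly (W n) a = 0}" for n
  define m where "m n a = real (order a (W n)) / real n" for n a
  define t where "t n a = a /\<^sub>R c n" for n and a :: complex
  define K where "K n = (ln (cmod (lead_coeff (W n))) + (\<Sum>a\<in>A n. real (order a (W n))) * ln (c n)) / real n" for n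
  \<comment> \<open>A lower bound at any grid point shows that \<open>W n\<close> is eventually
    nonzero, so the convention for the zero polynomial does not affect the limit.\<close>
  have "\<exists>p\<in>offset_grid 1. dist p 0 < 1 / real 1" by (rule offset_grid_dense) auto
  then obtain p0 where p0: "p0 \<in> offset_grid 1" "cmod p0 < 1" by auto
  have "\<forall>\<^sub>F n in sequentially. \<exists>z\<in>ball p0 (1 / real 1).
      exp (real n * (cmod p0 powr \<gamma> / \<gamma> - 1)) < cmod (poly (W n) (of_real (c n) * z))"
    by (rule lower) (use p0 in auto)
  then have "\<forall>\<^sub>F n in sequentially. W n \<noteq> 0"
    by eventually_elim (auto simp: not_less)
  then have nz: "\<forall>\<^sub>F n in sequentially. W n \<noteq> 0 \<and> 0 < n"
    using eventually_gt_at_top[of 0] by eventually_elim auto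
  have tA: "z \<in> t n ` A n \<longleftrightarrow> poly (W n) (of_real (c n) * z) = 0" if "0 < n" for n z
  proof -
    have "z = t n a \<longleftrightarrow> a = of_real (c n) * z" for a
      using c[OF that] by (auto simp: t_def scaleR_conv_of_real field_simps)
    then show ?thesis by (auto simp: A_def image_iff)
  qed
  have u: "log_potential (K n) (A n) (m n) (t n) z = ln (cmod (poly (W n) (of_real (c n) * z))) / real n"
    if "0 < n" "z \<notin> t n ` A n" for n z
    unfolding K_def A_def m_def t_def
    using that tA[of n z] c[of n] by (intro ln_cmod_poly_eq_log_potential[symmetric]) auto
  have "(\<lambda>n. \<Sum>a\<in>A n. m n a * \<phi> (t n a)) \<longlonglongrightarrow> (\<integral>z. \<phi> z \<partial>radial_measure \<gamma> 1)"
  proof (rule log_potential_weights_tendsto[OF g _ _ \<phi> B])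
    show weights: "\<forall>\<^sub>F n in sequentially. finite (A n) \<and> (\<forall>i\<in>A n. 0 \<le> m n i) \<and> sum (m n) (A n) \<le> 1"
      using nz
    proof eventually_elim
      case (elim n)
      have "(\<Sum>a\<in>A n. order a (W n)) \<le> degree (W n)"
        unfolding A_def using elim by (intro sum_order_le_degree) auto
      then have "(\<Sum>a\<in>A n. order a (W n)) \<le> n" using deg[of n] by simp
      then have "real (\<Sum>a\<in>A n. order a (W n)) \<le> real n" by (simp only: of_nat_le_iff)
      moreover have "sum (m n) (A n) = real (\<Sum>a\<in>A n. order a (W n)) / real n"
        by (simp add: m_def sum_divide_distrib)
      ultimately have "sum (m n) (A n) \<le> 1" using elim by simp
      then show ?case using elim poly_roots_finite[of "W n"] by (auto simp: A_def m_def)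
    qed
    fix R e :: real assume R: "R < 1" and e: "0 < e"
    show "\<forall>\<^sub>F n in sequentially. (\<integral>\<^sup>+ z. ennreal \<bar>log_potential (K n) (A n) (m n) (t n) z - cmod z powr \<gamma> / \<gamma>\<bar>
        * indicator (ball 0 R) z \<partial>lborel) \<le> ennreal e"
    proof (rule log_potential_L1_small[OF g weights _ _ R e])
      fix \<epsilon> :: real assume eps: "0 < \<epsilon>"
      show "\<forall>\<^sub>F n in sequentially. \<forall>z. z \<notin> t n ` A n \<longrightarrow>
          log_potential (K n) (A n) (m n) (t n) z \<le> cmod z powr \<gamma> / \<gamma> + \<epsilon>"
        using upper[OF eps] nz
      proof eventually_elim
        case (elim n)
        show ?case
        proof (intro allI impI)
          fix z assume z: "z \<notin> t n ` A n"
          have "0 < cmod (poly (W n) (of_real (c n) * z))" using tA[of n z] z elim by simp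
          then have "ln (cmod (poly (W n) (of_real (c n) * z))) \<le> real n * (cmod z powr \<gamma> / \<gamma> + \<epsilon>)"
            using elim(1) by (subst ln_exp[symmetric], intro ln_mono) auto
          then show "log_potential (K n) (A n) (m n) (t n) z \<le> cmod z powr \<gamma> / \<gamma> + \<epsilon>"
            using elim z by (subst u) (auto simp: divide_le_eq mult.commute)
        qed
      qed
      fix N :: nat and p assume "0 < N" "p \<in> offset_grid N" "cmod p < 1"
      from lower[OF eps this] nz
      show "\<forall>\<^sub>F n in sequentially. \<exists>z\<in>ball p (1 / real N). z \<notin> t n ` A n \<and>
          cmod p powr \<gamma> / \<gamma> - \<epsilon> \<le> log_potential (K n) (A n) (m n) (t n) z"
      proof eventually_elim
        case (elim n)
        then obtain z where z: "z \<in> ball p (1 / real N)"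
          "exp (real n * (cmod p powr \<gamma> / \<gamma> - \<epsilon>)) < cmod (poly (W n) (of_real (c n) * z))" by blast
        have pos: "0 < cmod (poly (W n) (of_real (c n) * z))"
          using z(2) by (rule less_trans[OF exp_gt_zero])
        then have zt: "z \<notin> t n ` A n" using tA[of n z] elim by auto
        have "real n * (cmod p powr \<gamma> / \<gamma> - \<epsilon>) \<le> ln (cmod (poly (W n) (of_real (c n) * z)))"
          using z(2) pos by (subst ln_ge_iff) auto
        then have "cmod p powr \<gamma> / \<gamma> - \<epsilon> \<le> log_potential (K n) (A n) (m n) (t n) z"
          using elim zt by (subst u) (auto simp: le_divide_eq mult.commute)
        then show ?case using z zt by blast
      qed
    qed
  qed
  then show ?thesis
  proof (rule Lim_transform_eventually)
    show "\<forall>\<^sub>F n in sequentially. (\<Sum>a\<in>A n. m n a * \<phi> (t n a)) =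
        (\<integral>z. \<phi> z \<partial>scale_measure (ennreal (1 / real n)) (dilate_measure (c n) (zero_measure (W n))))"
      using nz by eventually_elim (simp add: integral_scaled_zero_measure A_def m_def t_def)
  qed
qed

section \<open>Both implications almost surely\<close>

lemma degree_random_poly: "degree (random_poly \<xi> w n \<omega>) \<le> n"
  unfolding random_poly_def
  by (rule degree_sum_le) (auto intro: order.trans[OF degree_monom_le])

text \<open>A tent function vanishing outside 1/2 < |z| < 1, part of the rescaled region that record
  coefficients clear of zeros. It is at least 1/8 for 5/8 \<le> |z| < 7/8, an annulus of mass (7/8)
  powr \<gamma> - (5/8) powr \<gamma> > 0.\<close>

lemma radial_measure_annulus_test:
  fixes \<phi> :: "complex \<Rightarrow> real"
  assumes g: "0 < \<gamma>" and \<phi>: "\<And>z. \<phi> z = max 0 (1 / 4 - \<bar>cmod z - 3 / 4\<bar>)"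
  shows "0 < (\<integral>z. \<phi> z \<partial>radial_measure \<gamma> 1)"
proof -
  define \<mu> where "\<mu> = radial_measure \<gamma> 1"
  interpret prob_space \<mu> unfolding \<mu>_def by (rule prob_space_radial_measure[OF g])
  have [measurable_cong]: "sets \<mu> = sets borel" and sp: "space \<mu> = UNIV" by (auto simp: \<mu>_def)
  have "\<phi> = (\<lambda>z. max 0 (1 / 4 - \<bar>cmod z - 3 / 4\<bar>))" using \<phi> by auto
  then have [measurable]: "\<phi> \<in> borel_measurable borel" by simp
  have m: "measure \<mu> {z. cmod z < r} = r powr \<gamma>" if "0 \<le> r" "r \<le> 1" for r
    using that g by (simp add: measure_def \<mu>_def radial_measure_ball)
  define S where "S = {z::complex. cmod z < 7 / 8} - {z. cmod z < 5 / 8}"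
  have "measure \<mu> S = measure \<mu> {z. cmod z < 7 / 8} - measure \<mu> {z. cmod z < 5 / 8}"
    unfolding S_def by (rule finite_measure_Diff) auto
  moreover have "measure \<mu> {z. cmod z < 7 / 8} = (7 / 8) powr \<gamma>" "measure \<mu> {z. cmod z < 5 / 8} = (5 / 8) powr \<gamma>"
    by (rule m; simp)+
  moreover have "(5 / 8 :: real) powr \<gamma> < (7 / 8) powr \<gamma>" by (rule powr_less_mono2[OF g]) auto
  ultimately have "0 < measure \<mu> S * (1 / 8)" by simp
  also have "\<dots> = (\<integral>z. indicator S z * (1 / 8) \<partial>\<mu>)" by (simp add: sp)
  also have "\<dots> \<le> (\<integral>z. \<phi> z \<partial>\<mu>)"
  proof (rule integral_mono)
    show "integrable \<mu> (\<lambda>z. indicator S z * (1 / 8 :: real))"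
      by (rule integrable_const_bound[where B = 1]) (auto simp: S_def indicator_def)
    show "integrable \<mu> \<phi>"
      by (rule integrable_const_bound[where B = 1]) (auto simp: \<phi>)
    show "indicator S z * (1 / 8) \<le> \<phi> z" for z
      by (auto simp: \<phi> S_def indicator_def abs_if not_less)
  qed
  finally show ?thesis by (simp add: \<mu>_def)
qed

theorem theorem2p5:
  fixes M :: "'a measure"
    and \<xi> :: "nat \<Rightarrow> 'a \<Rightarrow> complex"
    and w :: "nat \<Rightarrow> complex"
    and \<alpha> \<beta> C :: real
  assumes "prob_space M"
    and "prob_space.iid_complex M \<xi>"
    and "\<forall>k. prob_space.nondegenerate M (\<xi> k)"
    and "\<alpha> > 0"
    and "(\<lambda>k. ln (cmod (w k)) - (- \<alpha> * (real k * ln (real k) - real k) - \<beta> * real k))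
           \<in> o(\<lambda>k. real k)"
    and "C > 0"
    and "\<forall>n\<ge>1. w n \<noteq> 0"
    and "\<forall>n\<ge>1. \<forall>k\<le>n. cmod (w (n - k) / w n) < C * exp (\<beta> * real k) * real n powr (\<alpha> * real k)"
  shows
    "as_vague_conv M
        (\<lambda>n \<omega>. scale_measure (ennreal (1 / real n))
                 (dilate_measure (exp \<beta> * real n powr \<alpha>) (zero_measure (random_poly \<xi> w n \<omega>))))
        (density lborel (\<lambda>z. ennreal
           (1 / (2 * pi * \<alpha>) * cmod z powr (1 / \<alpha> - 2) * indicator {z. cmod z < 1} z)))
     \<longleftrightarrow> (\<integral>\<^sup>+ \<omega>. ennreal (ln (1 + cmod (\<xi> 0 \<omega>))) \<partial>M) < \<infinity>"
proof -
  interpret prob_space M by fact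
  note iid = assms(2) and a = assms(4) and asy = assms(5) and w = assms(7)
  define \<gamma> where "\<gamma> = 1 / \<alpha>"
  have g: "0 < \<gamma>" using a by (simp add: \<gamma>_def)
  have \<Phi>: "x powr \<gamma> / \<gamma> = \<alpha> * x powr (1 / \<alpha>)" for x using a by (simp add: \<gamma>_def)
  define c where "c n = exp \<beta> * real n powr \<alpha>" for n :: nat
  have c: "0 < c n" if "0 < n" for n using that by (simp add: c_def)
  define W where "W n \<omega> = random_poly \<xi> w n \<omega>" for n \<omega>
  define \<nu> where "\<nu> n \<omega> = scale_measure (ennreal (1 / real n)) (dilate_measure (c n) (zero_measure (W n \<omega>)))" for n \<omega>
  have limit: "density lborel (\<lambda>z. ennreal
      (1 / (2 * pi * \<alpha>) * cmod z powr (1 / \<alpha> - 2) * indicator {z. cmod z < 1} z)) = radial_measure \<gamma> 1"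
    unfolding radial_measure_def \<gamma>_def
    by (intro arg_cong2[where f = density] refl ext) (simp add: indicator_def mult.commute)
  have polyW: "poly (W n \<omega>) y = (\<Sum>k\<le>n. \<xi> k \<omega> * w k * y ^ k)" for n \<omega> y
    by (simp add: W_def poly_random_poly)
  have "as_vague_conv M \<nu> (radial_measure \<gamma> 1) \<longleftrightarrow> (\<integral>\<^sup>+ \<omega>. ennreal (ln (1 + cmod (\<xi> 0 \<omega>))) \<partial>M) < \<infinity>"
  proof
    assume fin: "(\<integral>\<^sup>+ \<omega>. ennreal (ln (1 + cmod (\<xi> 0 \<omega>))) \<partial>M) < \<infinity>"
    \<comment> \<open>Errors are restricted to the values 1 / (j + 1), and below the grids to a
      countable family, so that countably many null sets suffice for every \<epsilon> and N.\<close>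
    have AEgrowth: "AE \<omega> in M. \<forall>j::nat. \<forall>\<^sub>F k in sequentially. ln (1 + cmod (\<xi> k \<omega>)) < 1 / real (Suc j) * real k"
      unfolding AE_all_countable by (intro allI AE_growth[OF iid fin]) simp
    have AElower: "AE \<omega> in M. \<forall>N j. \<forall>p\<in>{p \<in> offset_grid (Suc N). cmod p < 1}. \<forall>\<^sub>F n in sequentially. \<exists>z\<in>ball p (1 / real (Suc N)).
        exp (real n * (\<alpha> * cmod p powr (1 / \<alpha>) - 1 / real (Suc j))) < cmod (poly (W n \<omega>) (complex_of_real (c n) * z))"
      unfolding AE_all_countable
    proof (intro allI)
      fix N j
      have "countable {p \<in> offset_grid (Suc N). cmod p < 1}"
        by (rule countable_subset[OF _ countable_finite[OF finite_offset_grid]]) auto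
      then show "AE \<omega> in M. \<forall>p\<in>{p \<in> offset_grid (Suc N). cmod p < 1}. \<forall>\<^sub>F n in sequentially. \<exists>z\<in>ball p (1 / real (Suc N)).
        exp (real n * (\<alpha> * cmod p powr (1 / \<alpha>) - 1 / real (Suc j))) < cmod (poly (W n \<omega>) (complex_of_real (c n) * z))"
      proof (subst AE_ball_countable, assumption, intro ballI)
        fix p assume p: "p \<in> {p \<in> offset_grid (Suc N). cmod p < 1}"
        \<comment> \<open>At the origin the optimal index degenerates to 0, where no long block is
          available; the offset of the grid avoids this point.\<close>
        then have "p \<noteq> 0" using zero_notin_offset_grid[of "Suc N"] by auto
        then show "AE \<omega> in M. \<forall>\<^sub>F n in sequentially. \<exists>z\<in>ball p (1 / real (Suc N)).
            exp (real n * (\<alpha> * cmod p powr (1 / \<alpha>) - 1 / real (Suc j))) < cmod (poly (W n \<omega>) (complex_of_real (c n) * z))"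
          unfolding polyW c_def
          using p by (intro AE_poly_lower_bound[OF iid assms(3)[rule_format] asy a w]) auto
      qed
    qed
    show "as_vague_conv M \<nu> (radial_measure \<gamma> 1)"
      unfolding as_vague_conv_def
    proof (intro allI impI)
      fix \<phi> :: "complex \<Rightarrow> real"
      assume \<phi>: "continuous_on UNIV \<phi>" and supp: "compact (closure {z. \<phi> z \<noteq> 0})"
      have "compact (\<phi> ` closure {z. \<phi> z \<noteq> 0})"
        by (rule compact_continuous_image[OF _ supp]) (use \<phi> in \<open>auto intro: continuous_on_subset\<close>)
      then have "bounded (\<phi> ` closure {z. \<phi> z \<noteq> 0})" by (rule compact_imp_bounded)
      then have "\<exists>B. \<forall>y\<in>\<phi> ` closure {z. \<phi> z \<noteq> 0}. norm y \<le> B"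
        by (simp only: bounded_iff)
      then obtain B where B: "\<forall>y\<in>\<phi> ` closure {z. \<phi> z \<noteq> 0}. norm y \<le> B" ..
      have B': "\<bar>\<phi> x\<bar> \<le> \<bar>B\<bar>" for x
      proof (cases "\<phi> x = 0")
        case False
        then have "x \<in> closure {z. \<phi> z \<noteq> 0}" by (intro subsetD[OF closure_subset]) simp
        then have "norm (\<phi> x) \<le> B" by (intro B[rule_format] imageI)
        then show ?thesis by simp
      qed simp
      show "AE \<omega> in M. (\<lambda>n. \<integral>z. \<phi> z \<partial>\<nu> n \<omega>) \<longlonglongrightarrow> (\<integral>z. \<phi> z \<partial>radial_measure \<gamma> 1)"
        using AEgrowth AElower
      proof eventually_elim
        case (elim \<omega>)
        have inv: "\<exists>j::nat. 1 / real (Suc j) < \<epsilon>" if "0 < \<epsilon>" for \<epsilon> :: real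
          using nat_approx_posE[OF that] by metis
        have growth: "\<forall>\<^sub>F k in sequentially. ln (1 + cmod (\<xi> k \<omega>)) < \<epsilon> * real k" if "0 < \<epsilon>" for \<epsilon>
        proof -
          obtain j :: nat where j: "1 / real (Suc j) < \<epsilon>" using inv[OF \<open>0 < \<epsilon>\<close>] ..
          from elim(1)[rule_format, of j] show ?thesis
          proof eventually_elim
            case (elim k)
            also have "1 / real (Suc j) * real k \<le> \<epsilon> * real k" using j by (intro mult_right_mono) auto
            finally show ?case .
          qed
        qed
        show ?case
          unfolding \<nu>_def
        proof (rule scaled_zero_measure_tendsto[OF g c _ _ _ \<phi> B'])
          show "degree (W n \<omega>) \<le> n" for n unfolding W_def by (rule degree_random_poly)
          show "\<forall>\<^sub>F n in sequentially. \<forall>z. cmod (poly (W n \<omega>) (complex_of_real (c n) * z))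
              \<le> exp (real n * (cmod z powr \<gamma> / \<gamma> + \<epsilon>))" if "0 < \<epsilon>" for \<epsilon>
            unfolding polyW c_def \<Phi> by (rule random_poly_upper_bound[OF asy a that growth])
          fix \<epsilon> :: real and N :: nat and p assume eps: "0 < \<epsilon>" and N: "0 < N" and p: "p \<in> offset_grid N" "cmod p < 1"
          obtain j :: nat where j: "1 / real (Suc j) < \<epsilon>" using inv[OF eps] ..
          obtain N' where N': "N = Suc N'" using N by (cases N) auto
          have "\<forall>\<^sub>F n in sequentially. \<exists>z\<in>ball p (1 / real N).
              exp (real n * (\<alpha> * cmod p powr (1 / \<alpha>) - 1 / real (Suc j))) < cmod (poly (W n \<omega>) (complex_of_real (c n) * z))"
            using elim(2)[rule_format, of p N' j] p unfolding N' by simp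
          then show "\<forall>\<^sub>F n in sequentially. \<exists>z\<in>ball p (1 / real N).
              exp (real n * (cmod p powr \<gamma> / \<gamma> - \<epsilon>)) < cmod (poly (W n \<omega>) (complex_of_real (c n) * z))"
            unfolding \<Phi>
          proof eventually_elim
            case (elim n)
            have "exp (real n * (\<alpha> * cmod p powr (1 / \<alpha>) - \<epsilon>)) \<le> exp (real n * (\<alpha> * cmod p powr (1 / \<alpha>) - 1 / real (Suc j)))"
              using j by (subst exp_le_cancel_iff, intro mult_left_mono) auto
            then show ?case using elim by (meson le_less_trans)
          qed
        qed
      qed
    qed
  next
    assume conv: "as_vague_conv M \<nu> (radial_measure \<gamma> 1)"
    show "(\<integral>\<^sup>+ \<omega>. ennreal (ln (1 + cmod (\<xi> 0 \<omega>))) \<partial>M) < \<infinity>"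
    proof (rule ccontr)
      assume "\<not> ?thesis"
      then have inf: "(\<integral>\<^sup>+ \<omega>. ennreal (ln (1 + cmod (\<xi> 0 \<omega>))) \<partial>M) = \<infinity>" by (simp add: not_less top_unique)
      \<comment> \<open>This one test function already yields the contradiction: its limit integral
        is positive, but it vanishes at every rescaled zero for record indices \<open>n\<close>,
        which occur beyond any bound.\<close>
      define \<phi> :: "complex \<Rightarrow> real" where "\<phi> z = max 0 (1 / 4 - \<bar>cmod z - 3 / 4\<bar>)" for z
      have \<phi>: "continuous_on UNIV \<phi>" unfolding \<phi>_def by (intro continuous_intros)
      then have [measurable]: "\<phi> \<in> borel_measurable borel" by (rule borel_measurable_continuous_onI)
      have "{z. \<phi> z \<noteq> 0} \<subseteq> cball 0 1" by (auto simp: \<phi>_def)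
      then have "bounded {z. \<phi> z \<noteq> 0}" using bounded_cball bounded_subset by blast
      then have "compact (closure {z. \<phi> z \<noteq> 0})" by (simp add: compact_closure)
      then have "AE \<omega> in M. (\<lambda>n. \<integral>z. \<phi> z \<partial>\<nu> n \<omega>) \<longlonglongrightarrow> (\<integral>z. \<phi> z \<partial>radial_measure \<gamma> 1)"
        using conv \<phi> unfolding as_vague_conv_def by blast
      moreover have "AE \<omega> in M. \<forall>A::nat. \<exists>n\<ge>1. real A * real n < ln (1 + cmod (\<xi> n \<omega>))"
        by (rule AE_unbounded_growth[OF iid inf])
      ultimately have "AE \<omega> in M. False"
      proof eventually_elim
        case (elim \<omega>)
        have "0 < (\<integral>z. \<phi> z \<partial>radial_measure \<gamma> 1)"
          by (rule radial_measure_annulus_test[OF g \<phi>_def])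
        then have "\<forall>\<^sub>F n in sequentially. 0 < (\<integral>z. \<phi> z \<partial>\<nu> n \<omega>)"
          by (rule order_tendstoD(1)[OF elim(1)])
        then obtain N where N: "\<And>n. n \<ge> N \<Longrightarrow> 0 < (\<integral>z. \<phi> z \<partial>\<nu> n \<omega>)"
          by (auto simp: eventually_sequentially)
        obtain n where n: "n \<ge> max N 1" "\<And>z. c n / 2 \<le> cmod z \<Longrightarrow> poly (W n \<omega>) z \<noteq> 0"
          using record_dominates[OF elim(2) assms(6) w assms(8), of "max N 1"] unfolding polyW c_def by blast
        have n0: "0 < n" using n by simp
        have W0: "W n \<omega> \<noteq> 0"
        proof
          assume "W n \<omega> = 0"
          then show False using n(2)[of "of_real (c n)"] c[OF n0] by simp
        qed
        have "(\<integral>z. \<phi> z \<partial>\<nu> n \<omega>) = (\<Sum>a | poly (W n \<omega>) a = 0. real (order a (W n \<omega>)) / real n * \<phi> (a /\<^sub>R c n))"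
          unfolding \<nu>_def by (rule integral_scaled_zero_measure[OF W0 n0]) simp
        also have "\<dots> = 0"
        proof (rule sum.neutral, safe)
          fix a assume "poly (W n \<omega>) a = 0"
          then have "cmod a < c n / 2" using n(2)[of a] by force
          then have "cmod (a /\<^sub>R c n) < 1 / 2" using c[OF n0] by (simp add: field_simps)
          then have "\<phi> (a /\<^sub>R c n) = 0" unfolding \<phi>_def by linarith
          then show "real (order a (W n \<omega>)) / real n * \<phi> (a /\<^sub>R c n) = 0" by simp
        qed
        finally show False using N[of n] n by simp
      qed
      then show False by simp
    qed
  qed
  then show ?thesis
    unfolding limit \<nu>_def c_def W_def .
qed

end
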